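(* Every commutative association scheme whose first eigenmatrix (for suitable orderings of relations $R_0,\dots,R_7$ and primitive idempotents) is \[ \begin{bmatrix} 1 & 1 & 1 & 1 & 63 & 63 & 63 & 63\\ 1 & i & -1 & -i & 21 & 21i & -21 & -21i\\ 1 & -1 & 1 & -1 & -9 & 9 & -9 & 9\\ 1 & -i & -1 & i & 21 & -21i & -21 & 21i\\ 1 & 1 & 1 & 1 & -1 & -1 & -1 & -1\\ 1 & i & -1 & -i & -3 & -3i & 3 & 3i\\ 1 & -1 & 1 & -1 & 7 & -7 & 7 & -7\\ 1 & -i & -1 & i & -3 & 3i & 3 & -3i \end{bmatrix} \] is isomorphic to Hoggar's scheme $\mathcal{H}$.
   Context: Let $\Phi=\{\varphi_j\}_{j=1}^{64}$ be unit vectors spanning Hoggar's $64$ equiangular lines in $\mathbb{C}^8$ (so $|\langle\varphi_i,\varphi_j\rangle|=1/3$ for $i\neq j$), and $\Omega=\Phi\cup i\Phi\cup(-\Phi)\cup(-i\Phi)$ ($256$ vectors). Hoggar's scheme $\mathcal{H}$ is $(\Omega,\{R_0,\dots,R_7\})$ with $(\mathbf{x},\mathbf{y})\in R_j$ iff $\langle\mathbf{x},\mathbf{y}\rangle=\alpha_j$, where $\alpha_0=1,\alpha_1=i,\alpha_2=-1,\alpha_3=-i,\alpha_4=1/3,\alpha_5=i/3,\alpha_6=-1/3,\alpha_7=-i/3$; it is a $7$-class association scheme. The first eigenmatrix $\mathsf{P}$ of a scheme is defined by $\mathsf{A}_j=\sum_i\mathsf{P}_{ij}\mathsf{E}_i$,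 where $\mathsf{A}_j$ is the adjacency matrix of $R_j$ and $\mathsf{E}_i$ are the primitive idempotents of the Bose–Mesner algebra (rows indexed by idempotents, columns by relations $R_0,\dots,R_7$). *)

theory Defs
  imports "HOL-Analysis.Analysis" "HOL-Combinatorics.Permutations" "Jordan_Normal_Form.Matrix"
begin

section \<open>Association schemes\<close>

locale association_scheme =
  fixes X :: "'a set" and d :: nat and R :: "nat \<Rightarrow> ('a \<times> 'a) set"
  assumes finite_points: "finite X"
    and nonempty_points: "X \<noteq> {}"
    and identity_relation: "R 0 = Id_on X"
    and nonempty_relation: "j \<le> d \<Longrightarrow> R j \<noteq> {}"
    and disjoint_relations: "disjoint_family_on R {..d}"
    and union_relations: "(\<Union>j\<le>d. R j) = X \<times> X"
    and converse_relation: "j \<le> d \<Longrightarrow> \<exists>j'\<le>d. (R j)\<inverse> = R j'"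
    and intersection_numbers:
      "\<lbrakk>i \<le> d; j \<le> d; k \<le> d\<rbrakk> \<Longrightarrow>
        \<exists>p. \<forall>(x, y) \<in> R k. card {z \<in> X. (x, z) \<in> R i \<and> (z, y) \<in> R j} = p"

locale commutative_association_scheme = association_scheme +
  assumes commutative:
    "\<lbrakk>i \<le> d; j \<le> d; k \<le> d; (x, y) \<in> R k\<rbrakk> \<Longrightarrow>
      card {z \<in> X. (x, z) \<in> R i \<and> (z, y) \<in> R j}
      = card {z \<in> X. (x, z) \<in> R j \<and> (z, y) \<in> R i}"

text \<open>Relations may be permuted: the numbering of the classes is not part of the structure that
  an isomorphism has to preserve.\<close>

definition scheme_isomorphic ::
    "nat \<Rightarrow> 'a set \<Rightarrow> (nat \<Rightarrow> ('a \<times> 'a) set) \<Rightarrow> 'b set \<Rightarrow> (nat \<Rightarrow> ('b \<times> 'b) set) \<Rightarrow> bool" where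
  "scheme_isomorphic d X R Y S \<longleftrightarrow>
    (\<exists>f \<sigma>. bij_betw f X Y \<and> \<sigma> permutes {..d} \<and>
      (\<forall>j\<le>d. \<forall>x\<in>X. \<forall>y\<in>X. (x, y) \<in> R j \<longleftrightarrow> (f x, f y) \<in> S (\<sigma> j)))"

section \<open>The Bose--Mesner algebra and the first eigenmatrix\<close>

text \<open>Complex matrices with rows and columns indexed by the point set \<open>X\<close> are functions of type
  \<open>'a \<Rightarrow> 'a \<Rightarrow> complex\<close>. All matrices below lie in the Bose--Mesner algebra, hence vanish outside
  \<open>X \<times> X\<close>, so that equality of functions is equality of matrices.\<close>

definition adjacency :: "('a \<times> 'a) set \<Rightarrow> 'a \<Rightarrow> 'a \<Rightarrow> complex" where
  "adjacency r x y = (if (x, y) \<in> r then 1 else 0)"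

definition matrix_product ::
    "'a set \<Rightarrow> ('a \<Rightarrow> 'a \<Rightarrow> complex) \<Rightarrow> ('a \<Rightarrow> 'a \<Rightarrow> complex) \<Rightarrow> 'a \<Rightarrow> 'a \<Rightarrow> complex" where
  "matrix_product X M N x y = (\<Sum>z\<in>X. M x z * N z y)"

definition bose_mesner :: "nat \<Rightarrow> (nat \<Rightarrow> ('a \<times> 'a) set) \<Rightarrow> ('a \<Rightarrow> 'a \<Rightarrow> complex) set" where
  "bose_mesner d R = {M. \<exists>c. M = (\<lambda>x y. \<Sum>j\<le>d. c j * adjacency (R j) x y)}"

definition nonzero_idempotent ::
    "'a set \<Rightarrow> nat \<Rightarrow> (nat \<Rightarrow> ('a \<times> 'a) set) \<Rightarrow> ('a \<Rightarrow> 'a \<Rightarrow> complex) \<Rightarrow> bool" where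
  "nonzero_idempotent X d R E \<longleftrightarrow>
    E \<in> bose_mesner d R \<and> E \<noteq> (\<lambda>x y. 0) \<and> matrix_product X E E = E"

definition primitive_idempotent ::
    "'a set \<Rightarrow> nat \<Rightarrow> (nat \<Rightarrow> ('a \<times> 'a) set) \<Rightarrow> ('a \<Rightarrow> 'a \<Rightarrow> complex) \<Rightarrow> bool" where
  "primitive_idempotent X d R E \<longleftrightarrow>
    nonzero_idempotent X d R E \<and>
    \<not> (\<exists>F G. nonzero_idempotent X d R F \<and> nonzero_idempotent X d R G \<and>
          matrix_product X F G = (\<lambda>x y. 0) \<and> matrix_product X G F = (\<lambda>x y. 0) \<and>
          E = (\<lambda>x y. F x y + G x y))"

text \<open>\<open>P\<close> is the first eigenmatrix with respect to the ordering \<open>R 0, \<dots>, R d\<close> of the relations and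
  the ordering \<open>E 0, \<dots>, E d\<close> of the primitive idempotents.\<close>

definition is_first_eigenmatrix ::
    "'a set \<Rightarrow> nat \<Rightarrow> (nat \<Rightarrow> ('a \<times> 'a) set) \<Rightarrow> (nat \<Rightarrow> 'a \<Rightarrow> 'a \<Rightarrow> complex) \<Rightarrow> complex mat \<Rightarrow> bool"
  where
  "is_first_eigenmatrix X d R E P \<longleftrightarrow>
    bij_betw E {..d} {M. primitive_idempotent X d R M} \<and>
    P \<in> carrier_mat (d + 1) (d + 1) \<and>
    (\<forall>j\<le>d. adjacency (R j) = (\<lambda>x y. \<Sum>i\<le>d. P $$ (i, j) * E i x y))"

definition hoggar_eigenmatrix :: "complex mat" where
  "hoggar_eigenmatrix = mat_of_rows_list 8
    [[1,  1,  1,  1, 63,      63,  63,       63],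
     [1,  \<i>, -1, -\<i>, 21,  21 * \<i>, -21, -21 * \<i>],
     [1, -1,  1, -1, -9,       9,  -9,        9],
     [1, -\<i>, -1,  \<i>, 21, -21 * \<i>, -21,  21 * \<i>],
     [1,  1,  1,  1, -1,      -1,  -1,       -1],
     [1,  \<i>, -1, -\<i>, -3,  -3 * \<i>,   3,   3 * \<i>],
     [1, -1,  1, -1,  7,      -7,   7,       -7],
     [1, -\<i>, -1,  \<i>, -3,   3 * \<i>,   3,  -3 * \<i>]]"

section \<open>Hoggar's scheme\<close>

text \<open>Entries of the Sylvester Hadamard matrix of order 8: the exponent is the scalar product of
  the binary expansions of \<open>b\<close> and \<open>y\<close>.\<close>

definition sylvester :: "nat \<Rightarrow> nat \<Rightarrow> complex" where
  "sylvester b y = (- 1) ^ card {k. k < 3 \<and> bit b k \<and> bit y k}"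

text \<open>Unit vectors spanning the 64 Hoggar lines, in the coordinates of Jedwab and Wiebe: the vectors are the rows \<open>b\<close> of the
  Sylvester matrix with entry \<open>a\<close> multiplied by \<open>-1 + 2\<i>\<close>, normalised. Up to signs they form the
  orbit of \<open>(-1 + 2\<i>, 1, 1, 1, 1, 1, 1, 1) / sqrt 12\<close> under the three-qubit Pauli group. With this
  choice of unit vectors all inner products of distinct vectors are \<open>\<plusminus>1/3\<close> or \<open>\<plusminus>\<i>/3\<close>.\<close>

definition hoggar_vector :: "nat \<Rightarrow> nat \<Rightarrow> complex vec" where
  "hoggar_vector a b =
    vec 8 (\<lambda>y. sylvester b y * (if y = a then -1 + 2 * \<i> else 1) / complex_of_real (sqrt 12))"

definition hoggar_vectors :: "complex vec set" where
  "hoggar_vectors = {hoggar_vector a b |a b. a < 8 \<and> b < 8}"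

definition hoggar_points :: "complex vec set" where
  "hoggar_points = {c \<cdot>\<^sub>v v |c v. c \<in> {1, \<i>, -1, -\<i>} \<and> v \<in> hoggar_vectors}"

definition hoggar_inner_products :: "complex list" where
  "hoggar_inner_products = [1, \<i>, -1, -\<i>, 1/3, \<i>/3, -1/3, -\<i>/3]"

definition hoggar_relation :: "nat \<Rightarrow> (complex vec \<times> complex vec) set" where
  "hoggar_relation j =
    {(x, y) \<in> hoggar_points \<times> hoggar_points. x \<bullet>c y = hoggar_inner_products ! j}"

end

theory Submission
  imports Defs
begin

text \<open>Scaled by 3, the idempotent of rank 8 is the Gram matrix \<open>G\<close> of 256 vectors in \<open>\<complex>\<^sup>8\<close>, four on
  each of 64 lines. Relative to a fixed vector \<open>x\<close>, represent every other line by the vector whose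
  inner product with \<open>x\<close> is 1. The matrices \<open>G\<close> and \<open>G \<circ> G\<close> are multiples of idempotents of rank 8 and 36,
  and the squares of the vectors span the symmetric square of \<open>\<complex>\<^sup>8\<close>; this forces the relation
  \<open>G y z = -1\<close> on the 63 representatives to be collinearity in a generalised hexagon of order 2.
  Orthogonal projection away from \<open>x\<close>, a point \<open>c\<close> and its neighbours then yields eight
  lines all of whose mutual inner products are 1. They form a basis of \<open>\<complex>\<^sup>8\<close>. By an integrality
  argument the inner products of any other line with this basis are, up to a unit, \<open>\<plusminus>\<i>\<close> on a
  4-subset \<open>H\<close>, 1 at one element and -1 at the remaining three, with the same sign for all lines
  (up to complex conjugation), and any two of the \<open>H\<close> meet evenly. So the \<open>H\<close> are the words
  of weight 4 of the extended Hamming code, that is, the affine planes of \<open>\<F>\<^sub>2\<^sup>3\<close>. This determines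
  all 64 lines, and Hoggar's lines have the same description.\<close>

section \<open>Gram matrices of Hoggar type\<close>

text \<open>Ranks and dimensions never occur explicitly: the vectors are the rows of
  \<open>G\<close>, and a claim that some vectors span is proved by a sum of squared norms that
  evaluates to 0. The constants encode the ranks. \<open>G / 96\<close> and the entrywise square of
  \<open>G\<close> divided by 64 are idempotent with traces 256 * 3 / 96 = 8 and 256 * 9 / 64 = 36,
  the dimensions of \<complex>^8 and of its symmetric square.

  The obstacle is to find eight lines with consistent phases, since the hexagon only records where
  the value -1 occurs. Orthogonally to \<open>x\<close>, \<open>c\<close> and three neighbours of
  \<open>c\<close> only three dimensions remain. There the points at distance two from
  \<open>c\<close> leave unit vectors, and for points over different neighbours the discreteness of
  \<open>G\<close> with the Cauchy-Schwarz inequality allows only orthogonal or proportional ones.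
  Three mutually inconsistent orientations cannot satisfy this.

  Complex conjugation is a symmetry of the hypotheses on \<open>G\<close>, so the Gram matrix is
  determined only up to conjugation. This exchanges the relations of \<i> and -\<i>, which an
  isomorphism of schemes may do.\<close>

lemma all_less_8: "(\<forall>j<8. P j) \<longleftrightarrow> P 0 \<and> P 1 \<and> P 2 \<and> P 3 \<and> P 4 \<and> P 5 \<and> P 6 \<and> P (7 :: nat)"
  by (simp add: numeral_eq_Suc All_less_Suc conj_ac)

lemma sum_less_8: "sum f {..<8} = f 0 + f 1 + f 2 + f 3 + f 4 + f 5 + f 6 + f (7 :: nat)"
  for f :: "nat \<Rightarrow> 'b :: comm_monoid_add"
  by (simp add: numeral_eq_Suc lessThan_Suc add_ac)

text \<open>\<open>G x y\<close> stands for \<open>3 \<langle>x, y\<rangle>\<close>, so that all its values are Gaussian integers.\<close>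

locale hoggar_gram =
  fixes X :: "'a set" and G :: "'a \<Rightarrow> 'a \<Rightarrow> complex"
  assumes finite_X: "finite X"
    and hermitian: "x \<in> X \<Longrightarrow> y \<in> X \<Longrightarrow> G y x = cnj (G x y)"
    and G_values: "x \<in> X \<Longrightarrow> y \<in> X \<Longrightarrow> G x y \<in> {3, 3 * \<i>, -3, -3 * \<i>, 1, \<i>, -1, -\<i>}"
    and G_eq_3_iff: "x \<in> X \<Longrightarrow> y \<in> X \<Longrightarrow> G x y = 3 \<longleftrightarrow> x = y"
    and rotation_exists: "x \<in> X \<Longrightarrow> \<exists>x'\<in>X. \<forall>y\<in>X. G x' y = \<i> * G x y"
    and G_square: "x \<in> X \<Longrightarrow> y \<in> X \<Longrightarrow> (\<Sum>w\<in>X. G x w * G w y) = 96 * G x y"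
    and G2_square: "x \<in> X \<Longrightarrow> y \<in> X \<Longrightarrow>
      (\<Sum>w\<in>X. (G x w)\<^sup>2 * (G w y)\<^sup>2) = 64 * (G x y)\<^sup>2"
begin

lemma G_self [simp]: "x \<in> X \<Longrightarrow> G x x = 3"
  using G_eq_3_iff by blast

lemma G2_cnj: "x \<in> X \<Longrightarrow> y \<in> X \<Longrightarrow> cnj ((G x y)\<^sup>2) = (G x y)\<^sup>2"
  using G_values[of x y] by auto

lemma G2_commute: "x \<in> X \<Longrightarrow> y \<in> X \<Longrightarrow> (G y x)\<^sup>2 = (G x y)\<^sup>2"
  using G2_cnj[of x y] by (simp add: hermitian[of x y])

text \<open>Conjugation exchanges the two chiralities found later, so that only one of them has to
  be matched with Hoggar's vectors.\<close>

lemma conjugate_gram: "hoggar_gram X (\<lambda>x y. cnj (G x y))"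
proof
  fix x y assume x: "x \<in> X" and y: "y \<in> X"
  show "cnj (G y x) = cnj (cnj (G x y))" using hermitian[OF x y] by simp
  show "cnj (G x y) \<in> {3, 3 * \<i>, -3, -3 * \<i>, 1, \<i>, -1, -\<i>}" using G_values[OF x y] by auto
  show "cnj (G x y) = 3 \<longleftrightarrow> x = y" using G_eq_3_iff[OF x y]
    by (metis complex_cnj_cnj complex_cnj_numeral)
  show "(\<Sum>w\<in>X. cnj (G x w) * cnj (G w y)) = 96 * cnj (G x y)"
    using arg_cong[OF G_square[OF x y], of cnj] by simp
  show "(\<Sum>w\<in>X. (cnj (G x w))\<^sup>2 * (cnj (G w y))\<^sup>2) = 64 * (cnj (G x y))\<^sup>2"
    using arg_cong[OF G2_square[OF x y], of cnj] by simp
next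
  fix x assume x: "x \<in> X"
  \<comment> \<open>Conjugation turns the factor \<i> into -\<i>, so the new rotation is three old
    ones.\<close>
  obtain x1 where "x1 \<in> X" "\<forall>y\<in>X. G x1 y = \<i> * G x y" using rotation_exists[OF x] by blast
  moreover obtain x2 where "x2 \<in> X" "\<forall>y\<in>X. G x2 y = \<i> * G x1 y"
    using rotation_exists \<open>x1 \<in> X\<close> by blast
  moreover obtain x3 where "x3 \<in> X" "\<forall>y\<in>X. G x3 y = \<i> * G x2 y"
    using rotation_exists \<open>x2 \<in> X\<close> by blast
  ultimately show "\<exists>x'\<in>X. \<forall>y\<in>X. cnj (G x' y) = \<i> * cnj (G x y)"
    by (intro bexI[of _ x3]) (auto simp: algebra_simps)
qed (rule finite_X)

lemma norm_row: assumes "x \<in> X" shows "(\<Sum>w\<in>X. G x w * cnj (G x w)) = 288"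
proof -
  have "(\<Sum>w\<in>X. G x w * cnj (G x w)) = (\<Sum>w\<in>X. G x w * G w x)"
    by (intro sum.cong refl) (use assms hermitian[of x] in auto)
  then show ?thesis using G_square[OF assms assms] assms by simp
qed

text \<open>This replaces dimension counts: a defect is shown to vanish by evaluating its total
  squared norm.\<close>

lemma zero_if_sum_norm_zero:
  fixes F :: "'b \<Rightarrow> complex"
  assumes "finite A" "(\<Sum>a\<in>A. F a * cnj (F a)) = 0" "a \<in> A"
  shows "F a = 0"
proof -
  have "(\<Sum>a\<in>A. F a * cnj (F a)) = of_real (\<Sum>a\<in>A. (cmod (F a))\<^sup>2)"
    by (simp add: complex_mult_cnj cmod_power2)
  then have "(\<Sum>a\<in>A. (cmod (F a))\<^sup>2) = 0" using assms(2) of_real_eq_0_iff by metis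
  then show ?thesis using assms(1,3) by (simp add: sum_nonneg_eq_0_iff)
qed

text \<open>The squares of the vectors span the symmetric square of \<open>\<complex>\<^sup>8\<close>, hence so do the products
  of two vectors: a vanishing Krein parameter. The norms of the defects add up to zero.\<close>

lemma krein:
  assumes "y \<in> X" "x \<in> X" "z \<in> X"
  shows "(\<Sum>w\<in>X. (G y w)\<^sup>2 * (G w x * G w z)) = 64 * (G y x * G y z)"
proof -
  define f where "f x z w = G w x * G w z" for x z w
  define T where "T y w = (G y w)\<^sup>2" for y w
  define D where "D x z y = (\<Sum>w\<in>X. T y w * f x z w) - 64 * f x z y" for x z y
  define A where "A x z = (\<Sum>y\<in>X. \<Sum>w\<in>X. T y w * f x z w * cnj (f x z y))" for x z
  define B where "B x z = (\<Sum>w\<in>X. f x z w * cnj (f x z w))" for x z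
  have cT: "cnj (T y w) = T y w" "T w y = T y w" if "y \<in> X" "w \<in> X" for y w
    using that G2_cnj G2_commute by (auto simp: T_def)
  have TT: "(\<Sum>y\<in>X. T y w * T y v) = 64 * T v w" if "w \<in> X" "v \<in> X" for w v
  proof -
    have "(\<Sum>y\<in>X. T y w * T y v) = (\<Sum>y\<in>X. T v y * T y w)"
      by (intro sum.cong refl) (use that cT in auto)
    then show ?thesis using G2_square[OF that(2,1)] by (simp add: T_def)
  qed
  \<comment> \<open>\<open>T / 64\<close> is a real symmetric idempotent, so the cross terms and the
    square of the image all reduce to \<open>A x z\<close>.\<close>
  have D2: "(\<Sum>y\<in>X. D x z y * cnj (D x z y)) = 64 * (64 * B x z - A x z)" for x z
  proof -
    let ?f = "f x z"
    have "(\<Sum>y\<in>X. (\<Sum>w\<in>X. T y w * ?f w) * cnj (\<Sum>v\<in>X. T y v * ?f v))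
      = (\<Sum>y\<in>X. \<Sum>w\<in>X. \<Sum>v\<in>X. T y w * T y v * (?f w * cnj (?f v)))"
      unfolding cnj_sum sum_product by (intro sum.cong refl) (use cT in auto)
    also have "\<dots> = (\<Sum>w\<in>X. \<Sum>y\<in>X. \<Sum>v\<in>X. T y w * T y v * (?f w * cnj (?f v)))"
      by (rule sum.swap)
    also have "\<dots> = (\<Sum>w\<in>X. \<Sum>v\<in>X. \<Sum>y\<in>X. T y w * T y v * (?f w * cnj (?f v)))"
      by (rule sum.cong[OF refl], rule sum.swap)
    also have "\<dots> = (\<Sum>w\<in>X. \<Sum>v\<in>X. 64 * T v w * (?f w * cnj (?f v)))"
      by (intro sum.cong refl) (simp add: sum_distrib_right[symmetric] TT)
    also have "\<dots> = 64 * A x z"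
      unfolding A_def sum_distrib_left mult.assoc by (rule sum.swap)
    finally have 1: "(\<Sum>y\<in>X. (\<Sum>w\<in>X. T y w * ?f w) * cnj (\<Sum>v\<in>X. T y v * ?f v)) = 64 * A x z" .
    have 2: "(\<Sum>y\<in>X. (\<Sum>w\<in>X. T y w * ?f w) * cnj (?f y)) = A x z"
      unfolding A_def by (simp add: sum_distrib_right)
    have 3: "(\<Sum>y\<in>X. ?f y * cnj (\<Sum>w\<in>X. T y w * ?f w)) = A x z"
    proof -
      have "(\<Sum>y\<in>X. ?f y * cnj (\<Sum>w\<in>X. T y w * ?f w))
         = (\<Sum>y\<in>X. \<Sum>w\<in>X. T w y * ?f y * cnj (?f w))"
        unfolding cnj_sum sum_distrib_left by (intro sum.cong refl) (use cT in auto)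
      also have "\<dots> = A x z" unfolding A_def by (rule sum.swap)
      finally show ?thesis .
    qed
    have "(\<Sum>y\<in>X. D x z y * cnj (D x z y))
      = (\<Sum>y\<in>X. (\<Sum>w\<in>X. T y w * ?f w) * cnj (\<Sum>v\<in>X. T y v * ?f v)
           - 64 * ((\<Sum>w\<in>X. T y w * ?f w) * cnj (?f y))
           - 64 * (?f y * cnj (\<Sum>w\<in>X. T y w * ?f w)) + 4096 * (?f y * cnj (?f y)))"
      unfolding D_def by (intro sum.cong refl) (simp add: algebra_simps del: cnj_sum)
    also have "\<dots> = 64 * A x z - 64 * A x z - 64 * A x z + 4096 * B x z"
      unfolding sum.distrib sum_subtractf sum_distrib_left[symmetric] 1 2 3 B_def ..
    finally show ?thesis by simp
  qed
  have SB: "(\<Sum>x\<in>X. \<Sum>z\<in>X. B x z) = (\<Sum>w\<in>X. 288 * 288)"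
  proof -
    have "(\<Sum>x\<in>X. \<Sum>z\<in>X. B x z) = (\<Sum>w\<in>X. \<Sum>x\<in>X. \<Sum>z\<in>X. f x z w * cnj (f x z w))"
    proof -
      have "(\<Sum>x\<in>X. \<Sum>z\<in>X. B x z) = (\<Sum>x\<in>X. \<Sum>w\<in>X. \<Sum>z\<in>X. f x z w * cnj (f x z w))"
        unfolding B_def by (rule sum.cong[OF refl], rule sum.swap)
      then show ?thesis using sum.swap by (rule trans)
    qed
    also have "\<dots> = (\<Sum>w\<in>X. (\<Sum>x\<in>X. G w x * cnj (G w x)) * (\<Sum>z\<in>X. G w z * cnj (G w z)))"
      unfolding sum_product f_def by (intro sum.cong refl) simp
    finally show ?thesis by (simp add: norm_row)
  qed
  have SA: "(\<Sum>x\<in>X. \<Sum>z\<in>X. A x z) = (\<Sum>y\<in>X. 9216 * 576)"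
  proof -
    have "(\<Sum>x\<in>X. \<Sum>z\<in>X. A x z)
       = (\<Sum>y\<in>X. \<Sum>w\<in>X. \<Sum>x\<in>X. \<Sum>z\<in>X. T y w * f x z w * cnj (f x z y))"
    proof -
      have "(\<Sum>x\<in>X. \<Sum>z\<in>X. A x z) = (\<Sum>x\<in>X. \<Sum>y\<in>X. \<Sum>z\<in>X. \<Sum>w\<in>X. T y w * f x z w * cnj (f x z y))"
        unfolding A_def by (rule sum.cong[OF refl], rule sum.swap)
      also have "\<dots> = (\<Sum>y\<in>X. \<Sum>x\<in>X. \<Sum>z\<in>X. \<Sum>w\<in>X. T y w * f x z w * cnj (f x z y))"
        by (rule sum.swap)
      also have "\<dots> = (\<Sum>y\<in>X. \<Sum>x\<in>X. \<Sum>w\<in>X. \<Sum>z\<in>X. T y w * f x z w * cnj (f x z y))"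
        by (rule sum.cong[OF refl], rule sum.cong[OF refl], rule sum.swap)
      also have "\<dots> = (\<Sum>y\<in>X. \<Sum>w\<in>X. \<Sum>x\<in>X. \<Sum>z\<in>X. T y w * f x z w * cnj (f x z y))"
        by (rule sum.cong[OF refl], rule sum.swap)
      finally show ?thesis .
    qed
    also have "\<dots> = (\<Sum>y\<in>X. \<Sum>w\<in>X. T y w * ((\<Sum>x\<in>X. G w x * G x y) * (\<Sum>z\<in>X. G w z * G z y)))"
      unfolding sum_product
      unfolding sum_distrib_left f_def
    proof (intro sum.cong refl)
      fix y w x z assume "y \<in> X" "w \<in> X" "x \<in> X" "z \<in> X"
      then show "T y w * (G w x * G w z) * cnj (G y x * G y z) = T y w * (G w x * G x y * (G w z * G z y))"
        using hermitian[of y x] hermitian[of y z] by simp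
    qed
    also have "\<dots> = (\<Sum>y\<in>X. 9216 * (\<Sum>w\<in>X. (G y w)\<^sup>2 * (G w y)\<^sup>2))"
    proof (intro sum.cong refl)
      fix y assume y: "y \<in> X"
      have "(\<Sum>w\<in>X. T y w * ((\<Sum>x\<in>X. G w x * G x y) * (\<Sum>z\<in>X. G w z * G z y)))
        = (\<Sum>w\<in>X. 9216 * ((G y w)\<^sup>2 * (G w y)\<^sup>2))"
        by (rule sum.cong[OF refl]) (simp add: G_square y T_def power2_eq_square)
      then show "(\<Sum>w\<in>X. T y w * ((\<Sum>x\<in>X. G w x * G x y) * (\<Sum>z\<in>X. G w z * G z y)))
        = 9216 * (\<Sum>w\<in>X. (G y w)\<^sup>2 * (G w y)\<^sup>2)" by (simp add: sum_distrib_left)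
    qed
    also have "\<dots> = (\<Sum>y\<in>X. 9216 * 576)"
      by (intro sum.cong refl) (simp add: G2_square)
    finally show ?thesis .
  qed
  have "(\<Sum>(x, z, y)\<in>X \<times> X \<times> X. D x z y * cnj (D x z y))
     = (\<Sum>x\<in>X. \<Sum>z\<in>X. 64 * (64 * B x z - A x z))"
    by (simp add: sum.cartesian_product[symmetric] D2)
  also have "\<dots> = 64 * (64 * (\<Sum>x\<in>X. \<Sum>z\<in>X. B x z) - (\<Sum>x\<in>X. \<Sum>z\<in>X. A x z))"
    by (simp only: sum_distrib_left sum_subtractf right_diff_distrib)
  \<comment> \<open>64 * 288 * 288 = 9216 * 576; this numerical coincidence expresses that the rank
    36 equals 8 * 9 / 2.\<close>
  also have "\<dots> = 0" unfolding SA SB by simp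
  finally have 0: "(\<Sum>(x, z, y)\<in>X \<times> X \<times> X. D x z y * cnj (D x z y)) = 0" .
  have "D x z y = 0"
    using zero_if_sum_norm_zero[of "X \<times> X \<times> X" "\<lambda>(x, z, y). D x z y" "(x, z, y)"] 0 assms finite_X
    by (simp add: case_prod_unfold)
  then show ?thesis by (simp add: D_def T_def f_def)
qed

end

section \<open>Rotations and representatives of lines\<close>

context hoggar_gram
begin

lemma i_times_i [simp]: "\<i> * a * (\<i> * b) = - (a * b)"
  by (simp add: complex_eq_iff)

definition rot :: "'a \<Rightarrow> 'a" where
  "rot x = (SOME x'. x' \<in> X \<and> (\<forall>y\<in>X. G x' y = \<i> * G x y))"

lemma rot_props: "x \<in> X \<Longrightarrow> rot x \<in> X \<and> (\<forall>y\<in>X. G (rot x) y = \<i> * G x y)"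
  unfolding rot_def using someI_ex[OF rotation_exists[of x, unfolded Bex_def]] .

lemma rot_in_X [simp]: "x \<in> X \<Longrightarrow> rot x \<in> X"
  using rot_props by blast

lemma G_rot_left [simp]: "x \<in> X \<Longrightarrow> y \<in> X \<Longrightarrow> G (rot x) y = \<i> * G x y"
  using rot_props by blast

lemma G_rot_right [simp]: "x \<in> X \<Longrightarrow> y \<in> X \<Longrightarrow> G x (rot y) = - \<i> * G x y"
  using hermitian[of "rot y" x] hermitian[of y x] by simp

lemma bij_rot: "bij_betw rot X X"
proof -
  have "inj_on rot X"
  proof
    fix x y assume "x \<in> X" "y \<in> X" "rot x = rot y"
    then have "\<i> * G x y = \<i> * 3" using G_rot_left[of x y] G_rot_left[of y y] by simp
    then show "x = y" using G_eq_3_iff \<open>x \<in> X\<close> \<open>y \<in> X\<close> by simp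
  qed
  moreover from this have "rot ` X = X" by (intro endo_inj_surj finite_X) auto
  ultimately show ?thesis by (simp add: bij_betw_def)
qed

lemma rot_power:
  assumes "x \<in> X"
  shows "(rot ^^ k) x \<in> X" "y \<in> X \<Longrightarrow> G ((rot ^^ k) x) y = \<i> ^ k * G x y"
    "y \<in> X \<Longrightarrow> G y ((rot ^^ k) x) = (- \<i>) ^ k * G y x"
  using assms by (induction k) auto

text \<open>The equality case of Cauchy-Schwarz: rotating \<open>y\<close> by \<open>k\<close> steps
  makes the inner product 3, which characterises equality.\<close>

lemma parallel:
  assumes "x \<in> X" "y \<in> X" "w \<in> X" "G x y = 3 * \<i> ^ k"
  shows "x = (rot ^^ k) y" "G x w = \<i> ^ k * G y w"
proof -
  have "G x ((rot ^^ k) y) = 3 * ((- \<i>) * \<i>) ^ k"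
    using assms rot_power(3) unfolding power_mult_distrib by simp
  then show "x = (rot ^^ k) y" using G_eq_3_iff assms rot_power(1) by simp
  then show "G x w = \<i> ^ k * G y w" using assms rot_power(2) by simp
qed

text \<open>One vector from each line other than that of \<open>x\<close>; these are the 63 points
  of the hexagon.\<close>

definition Y :: "'a \<Rightarrow> 'a set" where
  "Y x = {w \<in> X. G x w = 1}"

lemma finite_Y [simp]: "finite (Y x)"
  using finite_X by (simp add: Y_def)

text \<open>The eight fibres of \<open>G x\<close> are permuted by \<open>rot\<close> in two cycles
  of length four, represented by \<open>{x}\<close> and \<open>Y x\<close>.\<close>

lemma sum_orbits:
  fixes F :: "'a \<Rightarrow> complex"
  assumes x: "x \<in> X" and inv: "\<And>w. w \<in> X \<Longrightarrow> F (rot w) = F w"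
  shows "sum F X = 4 * (F x + sum F (Y x))"
proof -
  define W where "W v = {w \<in> X. G x w = v}" for v
  have step: "sum F (W (- \<i> * v)) = sum F (W v)" for v
  proof -
    have "bij_betw rot (W v) (W (- \<i> * v))"
      unfolding bij_betw_def
    proof
      show "inj_on rot (W v)"
        using bij_rot by (auto simp: bij_betw_def W_def intro: inj_on_subset)
      show "rot ` W v = W (- \<i> * v)"
      proof
        show "rot ` W v \<subseteq> W (- \<i> * v)" using x by (auto simp: W_def)
        show "W (- \<i> * v) \<subseteq> rot ` W v"
        proof
          fix w assume w: "w \<in> W (- \<i> * v)"
          then obtain w' where w': "w' \<in> X" "w = rot w'"
            using bij_rot by (auto simp: W_def bij_betw_def image_iff)
          then have "\<i> * G x w' = \<i> * v" using w x by (simp add: W_def)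
          then show "w \<in> rot ` W v" using w' by (simp add: W_def)
        qed
      qed
    qed
    then have "sum F (W (- \<i> * v)) = sum (\<lambda>w. F (rot w)) (W v)"
      by (rule sum.reindex_bij_betw[symmetric])
    also have "\<dots> = sum F (W v)" by (rule sum.cong) (auto simp: W_def inv)
    finally show ?thesis .
  qed
  have s: "sum F (W (-(\<i> * v))) = sum F (W v)" for v using step[of v] by simp
  have e: "sum F (W (\<i> * v)) = sum F (W v)" "sum F (W (- v)) = sum F (W v)" for v
  proof -
    show "sum F (W (- v)) = sum F (W v)" for v using s[of "- (\<i> * v)"] s[of v] by simp
    then show "sum F (W (\<i> * v)) = sum F (W v)" for v using s[of "- v"] by simp
  qed
  have "sum F X = (\<Sum>v\<in>{3, 3 * \<i>, -3, -3 * \<i>, 1, \<i>, -1, -\<i>}. sum F (W v))"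
    unfolding W_def using x G_values by (intro sum.group[symmetric] finite_X) auto
  also have "\<dots> = sum F (W 3) + sum F (W (\<i> * 3)) + sum F (W (-3)) + sum F (W (- (\<i> * 3)))
     + sum F (W 1) + sum F (W (\<i> * 1)) + sum F (W (-1)) + sum F (W (- (\<i> * 1)))"
    by (simp add: complex_eq_iff add_ac mult.commute)
  also have "\<dots> = 4 * (sum F (W 3) + sum F (W 1))"
    unfolding s e by (simp add: algebra_simps)
  also have "W 3 = {x}" using x G_eq_3_iff by (auto simp: W_def)
  also have "W 1 = Y x" by (simp add: W_def Y_def)
  finally show ?thesis by simp
qed

lemma Y_D: "y \<in> Y x \<Longrightarrow> y \<in> X" "y \<in> Y x \<Longrightarrow> G x y = 1" "x \<in> X \<Longrightarrow> y \<in> Y x \<Longrightarrow> G y x = 1"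
  using hermitian[of x y] by (auto simp: Y_def)

text \<open>A value of modulus 3 would put \<open>y\<close> and \<open>z\<close> on one line, but a
  line contains at most one vector whose inner product with \<open>x\<close> is 1.\<close>

lemma Y_unit:
  assumes x: "x \<in> X" and "y \<in> Y x" "z \<in> Y x" "y \<noteq> z"
  shows "G y z \<in> {1, \<i>, -1, -\<i>}"
proof -
  have X: "y \<in> X" "z \<in> X" using assms Y_D by auto
  have False if "G y z \<in> {3 * \<i>, -3, -3 * \<i>}"
  proof -
    obtain k :: nat where k: "k \<in> {1, 2, 3}" "G y z = 3 * \<i> ^ k"
    proof -
      have "G y z = 3 * \<i> ^ 1 \<or> G y z = 3 * \<i> ^ 2 \<or> G y z = 3 * \<i> ^ 3"
        using \<open>G y z \<in> {3 * \<i>, -3, -3 * \<i>}\<close> by (auto simp: power3_eq_cube)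
      then show thesis using that[of 1] that[of 2] that[of 3] by blast
    qed
    then have "G y x = \<i> ^ k * G z x" using parallel(2)[OF X x k(2)] by simp
    then have "\<i> ^ k = 1" using Y_D(3)[OF x] assms by simp
    then show False using k(1) by (auto simp: numeral_eq_Suc complex_eq_iff)
  qed
  then show ?thesis using G_values[OF X] G_eq_3_iff[OF X] assms(4) by auto
qed

lemma card_Y: assumes "x \<in> X" shows "card (Y x) = 63" and card_X: "card X = 256"
proof -
  have "(\<Sum>w\<in>X. G x w * G w x) = 4 * (9 + (\<Sum>w\<in>Y x. G x w * G w x))"
    by (subst sum_orbits[OF assms]) (use assms in auto)
  also have "(\<Sum>w\<in>Y x. G x w * G w x) = of_nat (card (Y x))"
    using Y_D assms by simp
  finally have "96 * 3 = 4 * (9 + (of_nat (card (Y x)) :: complex))"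
    using G_square[OF assms assms] assms by simp
  then have "of_nat (card (Y x)) = (of_nat 63 :: complex)" by simp
  then show "card (Y x) = 63" unfolding of_nat_eq_iff .
  then show "card X = 256" using sum_orbits[OF assms, of "\<lambda>_. 1"] of_nat_eq_iff[where ?'a = complex, of "card X" 256] by simp
qed

lemma cancel_4: "c = 4 * (a + s) \<Longrightarrow> c = 4 * t \<Longrightarrow> s = t - (a :: complex)"
  by (metis add_diff_cancel_left' mult_left_cancel zero_neq_numeral)

section \<open>Moments of the inner products over \<open>Y x\<close>\<close>

context
  fixes x y z assumes x: "x \<in> X" and y: "y \<in> Y x" and z: "z \<in> Y x"
begin

private lemma yz: "y \<in> X" "z \<in> X" "G y x = 1" "G z x = 1" "G x y = 1" "G x z = 1"
  using x y z Y_D by auto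

lemma Y_moment_1: "(\<Sum>w\<in>Y x. G y w) = 21"
proof -
  have "(\<Sum>w\<in>X. G y w * G w x) = 4 * (3 + (\<Sum>w\<in>Y x. G y w * G w x))"
    by (subst sum_orbits[OF x]) (use x yz in auto)
  moreover have "(\<Sum>w\<in>Y x. G y w * G w x) = (\<Sum>w\<in>Y x. G y w)"
    by (rule sum.cong) (use x Y_D in auto)
  ultimately show ?thesis using G_square[of y x] x yz by simp
qed

lemma Y_moment_2: "(\<Sum>w\<in>Y x. (G y w)\<^sup>2) = 7"
proof -
  have "(\<Sum>w\<in>X. (G y w)\<^sup>2 * (G w x)\<^sup>2) = 4 * (9 + (\<Sum>w\<in>Y x. (G y w)\<^sup>2 * (G w x)\<^sup>2))"
    by (subst sum_orbits[OF x]) (use x yz in \<open>auto simp: power_mult_distrib\<close>)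
  moreover have "(\<Sum>w\<in>Y x. (G y w)\<^sup>2 * (G w x)\<^sup>2) = (\<Sum>w\<in>Y x. (G y w)\<^sup>2)"
    by (rule sum.cong) (use x Y_D in auto)
  ultimately show ?thesis using G2_square[of y x] x yz by simp
qed

lemma Y_moment_1_cnj: "(\<Sum>w\<in>Y x. G y w * G w z) = 24 * G y z - 1"
proof -
  have "(\<Sum>w\<in>X. G y w * G w z) = 4 * (1 + (\<Sum>w\<in>Y x. G y w * G w z))"
    by (subst sum_orbits[OF x]) (use x yz in auto)
  then show ?thesis by (rule cancel_4) (use G_square[of y z] yz in simp)
qed

text \<open>Both factors depend linearly on \<open>w\<close>, so \<open>G_square\<close> does not
  apply and the sum is not rotation invariant. The factor \<open>(G x w)\<^sup>2\<close>, equal to 1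
  on \<open>Y x\<close>, repairs this and brings the sum into the form of
  \<open>krein\<close>.\<close>

lemma Y_moment_1_1: "(\<Sum>w\<in>Y x. G w y * G w z) = 7"
proof -
  have "(\<Sum>w\<in>X. (G x w)\<^sup>2 * (G w y * G w z)) = 4 * (9 + (\<Sum>w\<in>Y x. (G x w)\<^sup>2 * (G w y * G w z)))"
    by (subst sum_orbits[OF x]) (use x yz in \<open>auto simp: power_mult_distrib algebra_simps\<close>)
  moreover have "(\<Sum>w\<in>Y x. (G x w)\<^sup>2 * (G w y * G w z)) = (\<Sum>w\<in>Y x. G w y * G w z)"
    by (rule sum.cong) (use x Y_D in auto)
  ultimately show ?thesis using krein[of x y z] x yz by simp
qed

lemma Y_moment_2_1: "(\<Sum>w\<in>Y x. (G y w)\<^sup>2 * G w z) = 16 * G y z - 3"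
proof -
  have "(\<Sum>w\<in>X. (G y w)\<^sup>2 * (G w x * G w z)) = 4 * (3 + (\<Sum>w\<in>Y x. (G y w)\<^sup>2 * (G w x * G w z)))"
    by (subst sum_orbits[OF x]) (use x yz in \<open>auto simp: power_mult_distrib algebra_simps\<close>)
  moreover have "(\<Sum>w\<in>Y x. (G y w)\<^sup>2 * (G w x * G w z)) = (\<Sum>w\<in>Y x. (G y w)\<^sup>2 * G w z)"
    by (rule sum.cong) (use x Y_D in auto)
  ultimately have "(\<Sum>w\<in>X. (G y w)\<^sup>2 * (G w x * G w z)) = 4 * (3 + (\<Sum>w\<in>Y x. (G y w)\<^sup>2 * G w z))"
    by simp
  then show ?thesis by (rule cancel_4) (use krein[of y x z] x yz in simp)
qed

lemma Y_moment_2_2: "(\<Sum>w\<in>Y x. (G y w)\<^sup>2 * (G w z)\<^sup>2) = 16 * (G y z)\<^sup>2 - 1"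
proof -
  have "(\<Sum>w\<in>X. (G y w)\<^sup>2 * (G w z)\<^sup>2) = 4 * (1 + (\<Sum>w\<in>Y x. (G y w)\<^sup>2 * (G w z)\<^sup>2))"
    by (subst sum_orbits[OF x]) (use x yz in \<open>auto simp: power_mult_distrib\<close>)
  then show ?thesis by (rule cancel_4) (use G2_square[of y z] yz in simp)
qed

end

text \<open>A closed neighbourhood: the value 3 adds \<open>y\<close> itself. The quadratic
  polynomial used for counting below equals 1 at -1 and at 3 alike.\<close>

definition nbhd :: "'a \<Rightarrow> 'a \<Rightarrow> 'a set" where
  "nbhd x y = {w \<in> Y x. G y w \<in> {-1, 3}}"

text \<open>On the possible values, (1 - t - cnj t + t^2) / 4 is the indicator of -1 and 3, so the
  count is a combination of moments. It equals 7, 3, 1, 0 when \<open>G y z\<close> is 3, -1, 1,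
  \<plusminus>\<i>, as for hexagon points at distance 0, 1, 2, 3.\<close>

lemma card_nbhd_Int:
  assumes x: "x \<in> X" and y: "y \<in> Y x" and z: "z \<in> Y x"
  shows "of_nat (card (nbhd x y \<inter> nbhd x z)) = 1 - (G y z + G z y) / 2 + (G y z)\<^sup>2"
proof -
  define D where "D t = (1 - t - cnj t + t\<^sup>2) / 4" for t :: complex
  have D: "D (G u w) = (if G u w \<in> {-1, 3} then 1 else 0)" if "u \<in> Y x" "w \<in> Y x" for u w
  proof (cases "u = w")
    case True
    then show ?thesis using that Y_D by (simp add: D_def)
  next
    case False
    then show ?thesis using Y_unit[OF x that] by (auto simp: D_def)
  qed
  have "of_nat (card (nbhd x y \<inter> nbhd x z)) = (\<Sum>w\<in>nbhd x y \<inter> nbhd x z. 1 :: complex)" by simp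
  also have "\<dots> = (\<Sum>w\<in>Y x. if w \<in> nbhd x y \<inter> nbhd x z then 1 else 0)"
    by (subst sum.inter_filter[symmetric], simp, rule sum.cong) (auto simp: nbhd_def)
  also have "\<dots> = (\<Sum>w\<in>Y x. D (G y w) * D (G z w))"
    by (rule sum.cong) (use D[OF y] D[OF z] in \<open>auto simp: nbhd_def\<close>)
  also have "\<dots> = (\<Sum>w\<in>Y x. (1 - G y w - G w y - G z w - G w z + (G y w)\<^sup>2 + (G z w)\<^sup>2
      + cnj (G w y * G w z) + G w y * G w z + G y w * G w z + G z w * G w y
      - (G y w)\<^sup>2 * G w z - cnj ((G y w)\<^sup>2 * G w z) - (G z w)\<^sup>2 * G w y - cnj ((G z w)\<^sup>2 * G w y)
      + (G y w)\<^sup>2 * (G w z)\<^sup>2) / 16)"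
  proof (rule sum.cong[OF refl])
    fix w assume w: "w \<in> Y x"
    have wX: "w \<in> X" "y \<in> X" "z \<in> X" using w y z Y_D by auto
    have h: "G w y = cnj (G y w)" "G w z = cnj (G z w)" "(G w y)\<^sup>2 = (G y w)\<^sup>2" "(G w z)\<^sup>2 = (G z w)\<^sup>2"
      "(cnj (G y w))\<^sup>2 = (G y w)\<^sup>2" "(cnj (G z w))\<^sup>2 = (G z w)\<^sup>2"
      using wX hermitian G2_commute G2_cnj unfolding complex_cnj_power by blast+
    show "D (G y w) * D (G z w) = (1 - G y w - G w y - G z w - G w z + (G y w)\<^sup>2 + (G z w)\<^sup>2
      + cnj (G w y * G w z) + G w y * G w z + G y w * G w z + G z w * G w y
      - (G y w)\<^sup>2 * G w z - cnj ((G y w)\<^sup>2 * G w z) - (G z w)\<^sup>2 * G w y - cnj ((G z w)\<^sup>2 * G w y)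
      + (G y w)\<^sup>2 * (G w z)\<^sup>2) / 16"
      unfolding D_def complex_cnj_mult complex_cnj_power h complex_cnj_cnj by (simp add: algebra_simps)
  qed
  also have "\<dots> = (63 - 21 - 21 - 21 - 21 + 7 + 7 + 7 + 7 + (24 * G y z - 1) + (24 * G z y - 1)
      - (16 * G y z - 3) - cnj (16 * G y z - 3) - (16 * G z y - 3) - cnj (16 * G z y - 3)
      + (16 * (G y z)\<^sup>2 - 1)) / 16"
  proof -
    have c: "(\<Sum>w\<in>Y x. G w u) = 21" if "u \<in> Y x" for u
    proof -
      have "(\<Sum>w\<in>Y x. G w u) = (\<Sum>w\<in>Y x. cnj (G u w))"
        by (rule sum.cong) (use that Y_D hermitian[of u] in auto)
      then show ?thesis using arg_cong[OF Y_moment_1[OF x that that], of cnj] by simp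
    qed
    show ?thesis
      unfolding sum_divide_distrib[symmetric] sum.distrib sum_subtractf cnj_sum[symmetric]
      by (simp only: Y_moment_1[OF x y y] Y_moment_1[OF x z z] Y_moment_2[OF x y y] Y_moment_2[OF x z z] Y_moment_1_cnj[OF x] Y_moment_1_1[OF x]
        Y_moment_2_1[OF x] Y_moment_2_2[OF x] c y z card_Y[OF x] sum_constant) simp
  qed
  also have "\<dots> = 1 - (G y z + G z y) / 2 + (G y z)\<^sup>2"
    using hermitian[of y z] y z Y_D by (simp add: field_simps)
  finally show ?thesis .
qed

section \<open>The hexagon of a point\<close>

text \<open>The scalar product for which the rows of \<open>G\<close> have Gram matrix
  \<open>G\<close>; the factor 1 / 96 is that of \<open>G_square\<close>.\<close>

definition ip :: "('a \<Rightarrow> complex) \<Rightarrow> ('a \<Rightarrow> complex) \<Rightarrow> complex" where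
  "ip u v = (\<Sum>w\<in>X. u w * cnj (v w)) / 96"

lemma ip_G [simp]: "x \<in> X \<Longrightarrow> y \<in> X \<Longrightarrow> ip (G x) (G y) = G x y"
proof -
  assume xy: "x \<in> X" "y \<in> X"
  then have "(\<Sum>w\<in>X. G x w * cnj (G y w)) = (\<Sum>w\<in>X. G x w * G w y)"
    by (intro sum.cong refl) (simp add: hermitian[of y])
  then show ?thesis using G_square[OF xy] by (simp add: ip_def)
qed

lemma ip_add_left: "ip (\<lambda>w. u w + v w) z = ip u z + ip v z"
  and ip_add_right: "ip z (\<lambda>w. u w + v w) = ip z u + ip z v"
  and ip_diff_left: "ip (\<lambda>w. u w - v w) z = ip u z - ip v z"
  and ip_diff_right: "ip z (\<lambda>w. u w - v w) = ip z u - ip z v"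
  and ip_scale_left: "ip (\<lambda>w. k * u w) z = k * ip u z"
  and ip_scale_right: "ip z (\<lambda>w. k * u w) = cnj k * ip z u"
  by (simp_all add: ip_def sum.distrib sum_subtractf distrib_left distrib_right left_diff_distrib
      right_diff_distrib add_divide_distrib diff_divide_distrib sum_distrib_left mult_ac)

lemmas ip_simps = ip_add_left ip_add_right ip_diff_left ip_diff_right ip_scale_left ip_scale_right

lemma ip_self: "ip u u = of_real ((\<Sum>w\<in>X. (cmod (u w))\<^sup>2) / 96)"
  by (simp add: ip_def complex_mult_cnj cmod_power2)

lemma ip_self_nonneg: "0 \<le> Re (ip u u)"
  by (simp add: ip_self sum_nonneg)

lemma ip_self_zero: "ip u u = 0 \<Longrightarrow> w \<in> X \<Longrightarrow> u w = 0"
  using zero_if_sum_norm_zero[OF finite_X, of u w] by (simp add: ip_def)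

text \<open>After fixing \<open>x\<close>, adjacency is collinearity in the split Cayley hexagon of order 2 on the
  63 lines different from \<open>x\<close>.\<close>

definition adj :: "'a \<Rightarrow> 'a \<Rightarrow> 'a \<Rightarrow> bool" where
  "adj x y z \<longleftrightarrow> y \<in> Y x \<and> z \<in> Y x \<and> G y z = -1"

lemma adj_sym: assumes "x \<in> X" "adj x y z" shows "adj x z y"
proof -
  have "y \<in> X" "z \<in> X" using assms by (auto simp: adj_def Y_def)
  then show ?thesis using assms hermitian[of y z] by (auto simp: adj_def)
qed

lemma adj_D: "adj x y z \<Longrightarrow> y \<in> X" "adj x y z \<Longrightarrow> z \<in> X" "adj x y z \<Longrightarrow> y \<in> Y x"
  "adj x y z \<Longrightarrow> z \<in> Y x" "adj x y z \<Longrightarrow> G y z = -1"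
  by (auto simp: adj_def Y_def)

lemma adj_irrefl: "\<not> adj x y y"
proof
  assume "adj x y y"
  then have "G y y = 3" "G y y = -1" by (auto simp: adj_def Y_def)
  then show False by simp
qed

lemma nbhd_adj: "y \<in> Y x \<Longrightarrow> nbhd x y = insert y {w. adj x y w}"
  using G_eq_3_iff[of y] by (auto simp: nbhd_def adj_def Y_def)

lemma card_adj:
  assumes "x \<in> X" "y \<in> Y x"
  shows "card {w. adj x y w} = 6"
proof -
  have "of_nat (card (nbhd x y)) = (of_nat 7 :: complex)"
    using card_nbhd_Int[OF assms assms(2)] assms by (simp add: Y_def)
  then have "card (nbhd x y) = 7" unfolding of_nat_eq_iff .
  moreover have "finite {w. adj x y w}" by (rule finite_subset[OF _ finite_Y[of x]]) (auto simp: adj_def)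
  ultimately show ?thesis using adj_irrefl nbhd_adj[OF assms(2)] by simp
qed

text \<open>The values \<plusminus>\<i> are impossible, since by \<open>card_nbhd_Int\<close> they
  make the closed neighbourhoods disjoint.\<close>

lemma adj_common:
  assumes x: "x \<in> X" and "adj x a y" "adj x a z" "y \<noteq> z" "\<not> adj x y z"
  shows "G y z = 1"
proof -
  have yz: "y \<in> Y x" "z \<in> Y x" "y \<in> X" "z \<in> X" using assms by (auto simp: adj_def Y_def)
  have "a \<in> nbhd x y \<inter> nbhd x z"
    using adj_sym[OF x] assms nbhd_adj yz by auto
  then have "card (nbhd x y \<inter> nbhd x z) \<noteq> 0" by (auto simp: nbhd_def)
  then have "1 - (G y z + G z y) / 2 + (G y z)\<^sup>2 \<noteq> 0"
    using card_nbhd_Int[OF x yz(1,2)] by (metis of_nat_eq_0_iff)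
  moreover have "G y z \<in> {1, \<i>, -1, -\<i>}" using Y_unit[OF x yz(1,2)] assms by simp
  moreover have "G y z \<noteq> -1" using assms yz by (simp add: adj_def)
  ultimately show ?thesis using hermitian[OF yz(3,4)] by auto
qed

text \<open>At the value 1 the count of \<open>card_nbhd_Int\<close> is one, so the midpoint is
  unique.\<close>

lemma adj_common_unique:
  assumes x: "x \<in> X" and "G y z = 1" "adj x a y" "adj x a z" "adj x a' y" "adj x a' z"
  shows "a = a'"
proof -
  have yz: "y \<in> Y x" "z \<in> Y x" "y \<in> X" "z \<in> X" using assms by (auto simp: adj_def Y_def)
  have "of_nat (card (nbhd x y \<inter> nbhd x z)) = (of_nat 1 :: complex)"
    using card_nbhd_Int[OF x yz(1,2)] hermitian[OF yz(3,4)] assms by simp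
  then have "card (nbhd x y \<inter> nbhd x z) = 1" unfolding of_nat_eq_iff .
  moreover have "a \<in> nbhd x y \<inter> nbhd x z" "a' \<in> nbhd x y \<inter> nbhd x z"
    using adj_sym[OF x] assms nbhd_adj yz by auto
  ultimately show ?thesis by (metis card_1_singletonE singletonD)
qed

text \<open>The closed neighbourhoods of \<open>y\<close> and \<open>z\<close> share three points,
  hence one besides \<open>y\<close> and \<open>z\<close>. The linear relation holds because y + z +
  b - x has squared norm 12 - 6 - 6 = 0.\<close>

lemma third_point:
  assumes x: "x \<in> X" and yz: "adj x y z"
  obtains b where "adj x y b" "adj x z b"
    "\<And>w. w \<in> X \<Longrightarrow> G y w + G z w + G b w = G x w"
    "\<And>w. adj x y w \<Longrightarrow> adj x z w \<Longrightarrow> w = b"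
proof -
  note D = adj_D[OF yz]
  have "of_nat (card (nbhd x y \<inter> nbhd x z)) = (of_nat 3 :: complex)"
    using card_nbhd_Int[OF x D(3,4)] hermitian[OF D(1,2)] D(5) by simp
  then have c3: "card (nbhd x y \<inter> nbhd x z) = 3" unfolding of_nat_eq_iff .
  have "y \<noteq> z" using yz adj_irrefl by auto
  have N: "nbhd x y \<inter> nbhd x z = {y, z} \<union> {w. adj x y w \<and> adj x z w}"
    using nbhd_adj[OF D(3)] nbhd_adj[OF D(4)] yz adj_sym[OF x yz] adj_irrefl by auto
  have "finite {w. adj x y w \<and> adj x z w}"
    by (rule finite_subset[OF _ finite_Y[of x]]) (auto simp: adj_def)
  then have "card {w. adj x y w \<and> adj x z w} = 1"
    using c3 \<open>y \<noteq> z\<close> adj_irrefl unfolding N by (subst (asm) card_Un_disjoint) auto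
  then obtain b where b: "{w. adj x y w \<and> adj x z w} = {b}" by (rule card_1_singletonE)
  then have yb: "adj x y b" "adj x z b" by auto
  note Db = adj_D[OF yb(1)] adj_D[OF yb(2)]
  have vals: "G x x = 3" "G y y = 3" "G z z = 3" "G b b = 3" "G x y = 1" "G x z = 1" "G x b = 1"
    "G y x = 1" "G z x = 1" "G b x = 1" "G y z = -1" "G z y = -1" "G y b = -1" "G b y = -1"
    "G z b = -1" "G b z = -1"
    using x D Db adj_sym[OF x yz] adj_sym[OF x yb(1)] adj_sym[OF x yb(2)] Y_D(2,3)
    by (auto dest: adj_D(5))
  have "ip (\<lambda>w. G y w + G z w + G b w - G x w) (\<lambda>w. G y w + G z w + G b w - G x w) = 0"
    using x D Db by (simp add: ip_simps vals)
  from ip_self_zero[OF this] show ?thesis using that[OF yb] b by auto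
qed

end

text \<open>The three lines \<open>{c, a i, b i}\<close> of the hexagon through a point \<open>c\<close>.\<close>

locale hexagon_fan = hoggar_gram +
  fixes x c :: 'a and a b :: "nat \<Rightarrow> 'a"
  assumes x: "x \<in> X"
    and c_a: "i < 3 \<Longrightarrow> adj x c (a i)"
    and c_b: "i < 3 \<Longrightarrow> adj x c (b i)"
    and a_b: "i < 3 \<Longrightarrow> adj x (a i) (b i)"
    and line: "i < 3 \<Longrightarrow> w \<in> X \<Longrightarrow> G c w + G (a i) w + G (b i) w = G x w"
    and distinct_lines: "i < 3 \<Longrightarrow> j < 3 \<Longrightarrow> i \<noteq> j \<Longrightarrow> {a i, b i} \<inter> {a j, b j} = {}"
begin

lemma c_Y: "c \<in> Y x" using c_a[of 0] adj_D by simp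

text \<open>The names of the two further points on a line are interchangeable. This transfers facts
  from \<open>over\<close> to \<open>over_b\<close> and later adjusts signs.\<close>

lemma swap_line:
  assumes "k < 3"
  shows "hexagon_fan X G x c (a(k := b k)) (b(k := a k))"
proof unfold_locales
  fix i w assume "i < (3::nat)"
  then show "adj x c ((a(k := b k)) i)" "adj x c ((b(k := a k)) i)"
    "adj x ((a(k := b k)) i) ((b(k := a k)) i)"
    using c_a c_b a_b adj_sym[OF x a_b] by auto
  show "w \<in> X \<Longrightarrow> G c w + G ((a(k := b k)) i) w + G ((b(k := a k)) i) w = G x w"
    using line[OF \<open>i < 3\<close>, of w] by (auto simp: algebra_simps)
next
  fix i j assume "i < (3::nat)" "j < (3::nat)" "i \<noteq> j"
  then show "{(a(k := b k)) i, (b(k := a k)) i} \<inter> {(a(k := b k)) j, (b(k := a k)) j} = {}"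
    using distinct_lines[of i j] by auto
qed (rule x)

lemma line_unique:
  assumes "i < 3"
  shows "adj x c w \<Longrightarrow> adj x (a i) w \<Longrightarrow> w = b i" "adj x c w \<Longrightarrow> adj x (b i) w \<Longrightarrow> w = a i"
    "adj x (a i) w \<Longrightarrow> adj x (b i) w \<Longrightarrow> w = c"
  using third_point[OF x c_a[OF assms]] third_point[OF x c_b[OF assms]]
    third_point[OF x a_b[OF assms]] c_a[OF assms] c_b[OF assms] a_b[OF assms] adj_sym[OF x]
  by metis+

lemma in_X [simp]: "c \<in> X" "i < 3 \<Longrightarrow> a i \<in> X" "i < 3 \<Longrightarrow> b i \<in> X" "x \<in> X"
  using adj_D(1)[OF c_a[of 0]] adj_D(2)[OF c_a] adj_D(2)[OF c_b] x by simp_all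

lemma a_a: "i < 3 \<Longrightarrow> j < 3 \<Longrightarrow> i \<noteq> j \<Longrightarrow> G (a i) (a j) = 1"
proof -
  assume ij: "i < 3" "j < 3" "i \<noteq> j"
  show ?thesis
  proof (rule adj_common[OF x c_a[OF ij(1)] c_a[OF ij(2)]])
    show "a i \<noteq> a j" using distinct_lines[OF ij] by auto
    show "\<not> adj x (a i) (a j)"
      using line_unique(1)[OF ij(1) c_a[OF ij(2)]] distinct_lines[OF ij] by auto
  qed
qed

text \<open>The points at distance two from \<open>c\<close> with midpoint \<open>a i\<close>: four
  for each \<open>i\<close>, on the two further lines through \<open>a i\<close>.\<close>

definition over :: "nat \<Rightarrow> 'a \<Rightarrow> bool" where
  "over i p \<longleftrightarrow> adj x (a i) p \<and> p \<noteq> c \<and> p \<noteq> b i"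

definition over_b :: "nat \<Rightarrow> 'a \<Rightarrow> bool" where
  "over_b i p \<longleftrightarrow> adj x (b i) p \<and> p \<noteq> c \<and> p \<noteq> a i"

lemma over_G:
  assumes "i < 3" "over i p"
  shows "p \<in> Y x" "p \<in> X" "G p c = 1" "G p (a i) = -1" "G p (b i) = 1"
proof -
  have ap: "adj x (a i) p" using assms by (simp add: over_def)
  show "p \<in> Y x" "p \<in> X" using ap adj_D by auto
  show "G p (a i) = -1" using adj_sym[OF x ap] adj_D by auto
  have "\<not> adj x p c" using line_unique(1)[OF assms(1) adj_sym[OF x] ap] assms by (auto simp: over_def)
  then show "G p c = 1"
    using adj_common[OF x ap adj_sym[OF x c_a[OF assms(1)]]] assms(2) by (auto simp: over_def)
  have "\<not> adj x p (b i)"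
    using line_unique(3)[OF assms(1) ap adj_sym[OF x]] assms by (auto simp: over_def)
  then show "G p (b i) = 1"
    using adj_common[OF x ap a_b[OF assms(1)]] assms(2) by (auto simp: over_def)
qed

text \<open>The relation on the line through \<open>c\<close>, \<open>a j\<close>,
  \<open>b j\<close> makes the two values opposite. Neither is -1, since \<open>a j\<close> or
  \<open>b j\<close> would be a second midpoint of \<open>p\<close> and \<open>c\<close>; being
  opposite, neither is 1.\<close>

lemma over_unit:
  assumes "i < 3" "j < 3" "i \<noteq> j" "over i p"
  shows "G p (a j) \<in> {\<i>, -\<i>}" "G p (b j) = - G p (a j)"
proof -
  note p = over_G[OF assms(1,4)]
  have "G c p + G (a j) p + G (b j) p = G x p" using line[OF assms(2) p(2)] .
  then have "cnj (G c p + G (a j) p + G (b j) p) = cnj (G x p)" by simp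
  then have "G p c + G p (a j) + G p (b j) = G p x"
    using hermitian[OF _ p(2)] assms by (auto simp: complex_eq_iff)
  then have s: "G p (a j) + G p (b j) = 0" using p Y_D(3)[OF x] by simp
  then show "G p (b j) = - G p (a j)" by (simp add: eq_neg_iff_add_eq_0 add.commute)
  have na: "\<not> adj x p q" if "q \<in> {a j, b j}" for q
  proof
    assume "adj x p q"
    then have "q = a i"
      using adj_common_unique[OF x p(3), of q "a i"] adj_sym[OF x] c_a c_b assms that
      by (auto simp: over_def)
    then show False using distinct_lines[OF assms(1-3)] that by auto
  qed
  have "p \<noteq> a j"
    using adj_sym[OF x c_a[OF assms(2)]] p(3) by (auto dest: adj_D(5))
  then have "G p (a j) \<in> {1, \<i>, -1, -\<i>}"
    using Y_unit[OF x p(1)] c_a[OF assms(2)] adj_D by blast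
  moreover have "G p (a j) \<noteq> -1" "G p (b j) \<noteq> -1"
    using na p c_a[OF assms(2)] c_b[OF assms(2)] by (auto simp: adj_def)
  moreover from this have "G p (a j) \<noteq> 1" using s by (metis add_eq_0_iff)
  ultimately show "G p (a j) \<in> {\<i>, -\<i>}" by auto
qed

lemma over_b_G:
  assumes "i < 3" "over_b i p"
  shows "p \<in> Y x" "p \<in> X" "G p c = 1" "G p (b i) = -1" "G p (a i) = 1"
proof -
  interpret s: hexagon_fan X G x c "a(i := b i)" "b(i := a i)" using swap_line[OF assms(1)] .
  have "s.over i p" using assms by (simp add: s.over_def over_b_def)
  from s.over_G[OF assms(1) this]
  show "p \<in> Y x" "p \<in> X" "G p c = 1" "G p (b i) = -1" "G p (a i) = 1" by auto
qed

lemma over_b_unit: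
  assumes "i < 3" "j < 3" "i \<noteq> j" "over_b i p"
  shows "G p (a j) \<in> {\<i>, -\<i>}"
proof -
  interpret s: hexagon_fan X G x c "a(i := b i)" "b(i := a i)" using swap_line[OF assms(1)] .
  have "s.over i p" using assms by (simp add: s.over_def over_b_def)
  from s.over_unit[OF assms(1-3) this] show ?thesis using assms by auto
qed

text \<open>The argument of \<open>over_unit\<close> for the line through \<open>b i\<close> and
  \<open>r\<close>: the only midpoint of \<open>p\<close> and \<open>b i\<close> is
  \<open>a i\<close>.\<close>

lemma over_over_b:
  assumes "i < 3" "over i p" "over_b i r"
  shows "G p r \<in> {\<i>, -\<i>}"
proof -
  note p = over_G[OF assms(1,2)] and r = over_b_G[OF assms(1,3)]
  have br: "adj x (b i) r" using assms by (simp add: over_b_def)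
  have ne: "p \<noteq> q" if "adj x (b i) q" for q
    using p(5) that adj_sym[OF x that] by (auto dest: adj_D(5))
  have na: "\<not> adj x p q" if "adj x (b i) q" "q \<noteq> a i" for q
    using adj_common_unique[OF x p(5), of q "a i"] adj_sym[OF x] that assms a_b
    by (auto simp: over_def)
  obtain q where q: "adj x (b i) q" "adj x r q" "\<And>w. w \<in> X \<Longrightarrow> G (b i) w + G r w + G q w = G x w"
    using third_point[OF x br] by metis
  have "q \<noteq> a i"
    using q(2) r(5) by (auto simp: adj_def)
  have "G (b i) p + G r p + G q p = G x p" using q(3) p by simp
  then have "cnj (G (b i) p + G r p + G q p) = cnj (G x p)" by simp
  then have "G p (b i) + G p r + G p q = G p x"
    using hermitian[OF _ p(2)] assms q(1) r adj_D(2) by (auto simp: complex_eq_iff)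
  then have s: "G p r + G p q = 0" using p Y_D(3)[OF x] by simp
  have "G p r \<in> {1, \<i>, -1, -\<i>}" using Y_unit[OF x p(1) r(1) ne[OF br]] .
  moreover have "G p r \<noteq> -1" "G p q \<noteq> -1"
    using na[OF br] na[OF q(1) \<open>q \<noteq> a i\<close>] p r q(1) assms by (auto simp: adj_def over_b_def)
  moreover from this have "G p r \<noteq> 1" using s by (metis add_eq_0_iff)
  ultimately show ?thesis by auto
qed

end

text \<open>If s * s' = t * t', the number subtracted from \<open>g\<close> is a unit, and any other
  unit is too far away, so \<open>K\<close> = 0. Otherwise it is 0 or 1 + t, and the units within
  distance 1 of it have distance exactly 1.\<close>

lemma kernel_cases:
  assumes "g \<in> {1, \<i>, -1, -\<i>}" "s \<in> {\<i>, -\<i>}" "s' \<in> {\<i>, -\<i>}" "t \<in> {\<i>, -\<i>}" "t' \<in> {\<i>, -\<i>}"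
    and K: "K = g - (1 - cnj t - s + s' * cnj t') / 2" and b: "(cmod K)\<^sup>2 \<le> 1"
  shows "(s = t \<longrightarrow> s' = t' \<longrightarrow> g = 1) \<and> (s * s' = t * t' \<longrightarrow> K = 0)
    \<and> (s * s' \<noteq> t * t' \<longrightarrow> (cmod K)\<^sup>2 = 1)"
proof -
  have "g = 1 \<or> g = \<i> \<or> g = -1 \<or> g = -\<i>" "s = \<i> \<or> s = -\<i>" "s' = \<i> \<or> s' = -\<i>" 
   "t = \<i> \<or> t = -\<i>" "t' = \<i> \<or> t' = -\<i>" using assms by auto
  then show ?thesis
  using b unfolding K cmod_power2
  by (elim disjE) (simp_all add: power2_eq_square complex_eq_iff)
qed
text \<open>If s * s' = t * t', the half sum is 1 or -1, which has distance sqrt 2 from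
  \<plusminus>\<i>.\<close>

lemma kernel_cases_b:
  assumes "g \<in> {\<i>, -\<i>}" "s \<in> {\<i>, -\<i>}" "s' \<in> {\<i>, -\<i>}" "t \<in> {\<i>, -\<i>}" "t' \<in> {\<i>, -\<i>}"
    and b: "(cmod (g - (s * cnj t + s' * cnj t') / 2))\<^sup>2 \<le> 1"
  shows "s * s' = - (t * t')"
proof -
  have "g = \<i> \<or> g = -\<i>" "s = \<i> \<or> s = -\<i>" "s' = \<i> \<or> s' = -\<i>"
    "t = \<i> \<or> t = -\<i>" "t' = \<i> \<or> t' = -\<i>" using assms by auto
  then show ?thesis
    using b unfolding cmod_power2
    by (elim disjE) (simp_all add: power2_eq_square complex_eq_iff)
qed

section \<open>Projection orthogonal to a fan\<close>

context hexagon_fan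
begin

definition M :: "'a set" where
  "M = {p \<in> Y x. G p c = 1}"

definition residual :: "'a \<Rightarrow> 'a \<Rightarrow> complex" where
  "residual p = (\<lambda>w. G p w - 1 / 4 * (G x w + G c w)
     - (G p (a 0) / 4 * (2 * G (a 0) w + G c w - G x w) + G p (a 1) / 4 * (2 * G (a 1) w + G c w - G x w)
     + G p (a 2) / 4 * (2 * G (a 2) w + G c w - G x w)))"

definition kernel :: "'a \<Rightarrow> 'a \<Rightarrow> complex" where
  "kernel p u = G p u - (1 + G p (a 0) * G (a 0) u + G p (a 1) * G (a 1) u + G p (a 2) * G (a 2) u) / 2"

lemma M_D: assumes "p \<in> M" shows "p \<in> X" "p \<in> Y x" "G p c = 1" "G c p = 1" "G p x = 1" "G x p = 1"
  using assms hermitian[of p c] Y_D x by (auto simp: M_def)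

text \<open>\<open>residual p\<close> is the component of \<open>p\<close> orthogonal to \<open>x\<close>, \<open>c\<close> and the \<open>a i\<close>;
  \<open>x\<close>, \<open>3c - x\<close> and the \<open>2 (a i) + c - x\<close> are orthogonal.\<close>

lemma ip_residual:
  assumes p: "p \<in> M" and u: "u \<in> M"
  shows "ip (residual p) (residual u) = kernel p u"
proof -
  have vals: "G x x = 3" "G c c = 3" "G (a 0) (a 0) = 3" "G (a 1) (a 1) = 3" "G (a 2) (a 2) = 3"
    "G c x = 1" "G x c = 1" "G (a 0) x = 1" "G x (a 0) = 1" "G (a 1) x = 1" "G x (a 1) = 1"
    "G (a 2) x = 1" "G x (a 2) = 1" "G c (a 0) = -1" "G (a 0) c = -1" "G c (a 1) = -1" "G (a 1) c = -1"
    "G c (a 2) = -1" "G (a 2) c = -1" "G (a 0) (a 1) = 1" "G (a 1) (a 0) = 1" "G (a 0) (a 2) = 1"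
    "G (a 2) (a 0) = 1" "G (a 1) (a 2) = 1" "G (a 2) (a 1) = 1"
    using c_a[of 0] c_a[of 1] c_a[of 2] a_a Y_D(2,3) x c_Y
      adj_sym[OF x c_a[of 0]] adj_sym[OF x c_a[of 1]] adj_sym[OF x c_a[of 2]]
    by (auto dest: adj_D) 
  have cp: "cnj (G p (a i)) = G (a i) p" "cnj (G u (a i)) = G (a i) u" if "i < 3" for i
    using hermitian[of p "a i"] hermitian[of u "a i"] M_D[OF p] M_D[OF u] that by auto
  have X: "a 0 \<in> X" "a 1 \<in> X" "a 2 \<in> X" by auto
  show ?thesis
    unfolding residual_def kernel_def ip_simps
    using M_D[OF p] M_D[OF u] X x
    by (simp add: vals cp ip_simps del: One_nat_def) (simp add: algebra_simps del: One_nat_def)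
qed

text \<open>Cauchy-Schwarz for the unit vectors \<open>residual p\<close> and
  \<open>residual u\<close>. In the case of equality they are proportional, which makes the kernel
  multiplicative.\<close>

lemma kernel_bound:
  assumes p: "p \<in> M" and u: "u \<in> M" and "kernel p p = 1" "kernel u u = 1"
  shows "(cmod (kernel p u))\<^sup>2 \<le> 1"
    and "(cmod (kernel p u))\<^sup>2 = 1 \<Longrightarrow> w \<in> M \<Longrightarrow> kernel p w = kernel p u * kernel u w"
proof -
  define k where "k = kernel p u"
  define v where "v w = residual p w - k * residual u w" for w
  have "kernel u p = cnj k"
    unfolding ip_residual[OF u p, symmetric] k_def ip_residual[OF p u, symmetric]
    by (simp add: ip_def mult.commute)
  then have vv: "ip v v = 1 - k * cnj k"
    unfolding v_def ip_simps using assms by (simp add: ip_residual k_def)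
  then have "Re (ip v v) = 1 - (cmod k)\<^sup>2"
    by (simp add: complex_mult_cnj cmod_power2)
  then show "(cmod (kernel p u))\<^sup>2 \<le> 1" using ip_self_nonneg[of v] by (simp add: k_def)
  assume "(cmod (kernel p u))\<^sup>2 = 1" and w: "w \<in> M"
  then have "k * cnj k = 1" by (simp add: k_def complex_mult_cnj cmod_power2)
  then have "v t = 0" if "t \<in> X" for t using ip_self_zero[OF _ that] vv by simp
  then have "ip v (residual w) = 0" by (simp add: ip_def)
  then show "kernel p w = kernel p u * kernel u w"
    unfolding v_def ip_simps using p u w by (simp add: ip_residual k_def)
qed

lemma M_a_unit: assumes "p \<in> M" "i < 3" shows "G p (a i) \<in> {1, \<i>, -1, -\<i>}"
proof -
  have "p \<noteq> a i" using M_D(4)[OF assms(1)] adj_D(5)[OF c_a[OF assms(2)]] by auto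
  then show ?thesis using Y_unit[OF x M_D(2)[OF assms(1)] adj_D(4)[OF c_a[OF assms(2)]]] by blast
qed

lemma kernel_alt:
  assumes "p \<in> M" "u \<in> M"
  shows "kernel p u = G p u - (1 + G p (a 0) * cnj (G u (a 0)) + G p (a 1) * cnj (G u (a 1))
    + G p (a 2) * cnj (G u (a 2))) / 2"
  using hermitian[of u "a 0"] hermitian[of u "a 1"] hermitian[of u "a 2"] M_D[OF assms(2)]
  by (simp add: kernel_def)

lemma kernel_self:
  assumes "p \<in> M"
  shows "kernel p p = 1"
proof -
  have "G p (a i) * cnj (G p (a i)) = 1" if "i < 3" for i
    using M_a_unit[OF assms that] by auto
  then show ?thesis unfolding kernel_alt[OF assms assms] using M_D[OF assms] by simp
qed

lemma over_M: "i < 3 \<Longrightarrow> over i p \<Longrightarrow> p \<in> M"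
  using over_G by (simp add: M_def)

lemma over_b_M: "i < 3 \<Longrightarrow> over_b i p \<Longrightarrow> p \<in> M"
  using over_b_G by (simp add: M_def)

lemma index_D:
  assumes "{i, j, k} = {0, 1, 2 :: nat}"
  shows "i < 3" "j < 3" "k < 3" "i \<noteq> j" "i \<noteq> k" "j \<noteq> k"
proof -
  have c: "card {i, j, k} = 3" unfolding assms by simp
  show "i \<noteq> j" "i \<noteq> k" "j \<noteq> k"
    using c by (auto simp: card_insert_if split: if_splits)
  have "i \<in> {0, 1, 2}" "j \<in> {0, 1, 2}" "k \<in> {0, 1, 2}" unfolding assms[symmetric] by simp_all
  then show "i < 3" "j < 3" "k < 3" by auto
qed

lemma kernel_ijk:
  assumes "p \<in> M" "u \<in> M" "{i, j, k} = {0, 1, 2 :: nat}"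
  shows "kernel p u = G p u - (1 + G p (a i) * cnj (G u (a i)) + G p (a j) * cnj (G u (a j))
    + G p (a k) * cnj (G u (a k))) / 2"
proof -
  have "i \<noteq> j" "i \<noteq> k" "j \<noteq> k"
    using index_D[OF assms(3)] by auto
  then have "(\<Sum>l\<in>{i, j, k}. G p (a l) * cnj (G u (a l))) = G p (a i) * cnj (G u (a i))
    + G p (a j) * cnj (G u (a j)) + G p (a k) * cnj (G u (a k))" by simp
  then show ?thesis unfolding assms(3) kernel_alt[OF assms(1,2)] by (simp add: add.assoc)
qed

text \<open>The products compared here are signs, the orientations of \<open>p\<close> and
  \<open>r\<close>. In the kernel the term 1 cancels against
  \<open>G p (a i) * cnj (G r (a i))\<close> = -1, which leaves the situation of
  \<open>kernel_cases_b\<close>.\<close>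

lemma over_over_b_sign:
  assumes ijk: "{i, j, k} = {0, 1, 2}" and p: "over i p" and r: "over_b i r"
  shows "G p (a j) * G p (a k) = - (G r (a j) * G r (a k))"
proof -
  note I = index_D[OF ijk]
  note pM = over_M[OF I(1) p] and rM = over_b_M[OF I(1) r]
  have "(cmod (kernel p r))\<^sup>2 \<le> 1" using kernel_bound(1) kernel_self pM rM by blast
  moreover have "kernel p r = G p r - (G p (a j) * cnj (G r (a j)) + G p (a k) * cnj (G r (a k))) / 2"
    unfolding kernel_ijk[OF pM rM ijk] using over_G[OF I(1) p] over_b_G[OF I(1) r] by simp
  ultimately show ?thesis
    using kernel_cases_b[OF over_over_b[OF I(1) p r] over_unit(1)[OF I(1,2,4) p]
      over_unit(1)[OF I(1,3,5) p] over_b_unit[OF I(1,2,4) r] over_b_unit[OF I(1,3,5) r]] by simp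
qed

text \<open>For points over different \<open>a i\<close>, equal orientations make the residuals
  orthogonal and opposite ones make them proportional.\<close>

lemma over_over:
  assumes ijk: "{i, j, k} = {0, 1, 2}" and p: "over i p" and u: "over j u"
  shows "G p (a j) = G u (a i) \<Longrightarrow> G p (a k) = G u (a k) \<Longrightarrow> G p u = 1"
    and "G p (a j) * G p (a k) = G u (a i) * G u (a k) \<Longrightarrow> kernel p u = 0"
    and "G p (a j) * G p (a k) \<noteq> G u (a i) * G u (a k) \<Longrightarrow> (cmod (kernel p u))\<^sup>2 = 1"
proof -
  note I = index_D[OF ijk]
  note pM = over_M[OF I(1) p] and uM = over_M[OF I(2) u]
  note v = over_G[OF I(1) p] over_G[OF I(2) u]
  note s = over_unit(1)[OF I(1,2,4) p] over_unit(1)[OF I(1,3,5) p]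
    over_unit(1)[OF I(2,1) I(4)[symmetric] u] over_unit(1)[OF I(2,3,6) u]
  have "p \<noteq> u" using v(4) s(3) by (auto simp: complex_eq_iff)
  then have g: "G p u \<in> {1, \<i>, -1, -\<i>}" using Y_unit[OF x] v by blast
  have b: "(cmod (kernel p u))\<^sup>2 \<le> 1" using kernel_bound(1) kernel_self pM uM by blast
  have K: "kernel p u = G p u - (1 - cnj (G u (a i)) - G p (a j) + G p (a k) * cnj (G u (a k))) / 2"
    unfolding kernel_ijk[OF pM uM ijk] using v by simp
  note c = kernel_cases[OF g s(1,2,3,4) K b]
  show "G p (a j) = G u (a i) \<Longrightarrow> G p (a k) = G u (a k) \<Longrightarrow> G p u = 1"
    "G p (a j) * G p (a k) = G u (a i) * G u (a k) \<Longrightarrow> kernel p u = 0"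
    "G p (a j) * G p (a k) \<noteq> G u (a i) * G u (a k) \<Longrightarrow> (cmod (kernel p u))\<^sup>2 = 1"
    using c by blast+
qed

end

section \<open>Existence of fans\<close>

context hoggar_gram
begin

lemma third_point_symmetric:
  assumes x: "x \<in> X" and "adj x c p" "adj x c q" "adj x p q"
  shows "adj x c w \<Longrightarrow> adj x p w \<Longrightarrow> w = q" "adj x c w \<Longrightarrow> adj x q w \<Longrightarrow> w = p"
proof -
  obtain u v where "\<And>w. adj x c w \<Longrightarrow> adj x p w \<Longrightarrow> w = u" "\<And>w. adj x c w \<Longrightarrow> adj x q w \<Longrightarrow> w = v"
    using third_point[OF x assms(2)] third_point[OF x assms(3)] by metis
  then show "adj x c w \<Longrightarrow> adj x p w \<Longrightarrow> w = q" "adj x c w \<Longrightarrow> adj x q w \<Longrightarrow> w = p"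
    using assms adj_sym[OF x assms(4)] by blast+
qed

lemma third_point_disjoint:
  assumes x: "x \<in> X" and "adj x c p" "adj x c q" "adj x p q"
    and "adj x c r" "adj x c s" "adj x r s" "r \<notin> {p, q}"
  shows "{p, q} \<inter> {r, s} = {}" "u \<in> {p, q} \<Longrightarrow> v \<in> {r, s} \<Longrightarrow> \<not> adj x u v"
proof -
  have "s \<notin> {p, q}"
    using third_point_symmetric[OF x assms(2-4) assms(5)] adj_sym[OF x assms(7)] assms(8) by blast
  then show d: "{p, q} \<inter> {r, s} = {}" using assms(8) by auto
  assume u: "u \<in> {p, q}" and v: "v \<in> {r, s}"
  show "\<not> adj x u v"
  proof
    assume "adj x u v"
    then have "v \<in> {p, q}"
      using third_point_symmetric[OF x assms(2-4), of v] u v assms(5,6) by blast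
    then show False using v d by auto
  qed
qed

lemma pick_adj:
  assumes "x \<in> X" "c \<in> Y x" "finite S" "card S < 6"
  obtains w where "adj x c w" "w \<notin> S"
proof -
  have "\<not> {w. adj x c w} \<subseteq> S"
    using card_mono[OF assms(3), of "{w. adj x c w}"] card_adj[OF assms(1,2)] assms(4) by linarith
  then show ?thesis using that by auto
qed

lemma fan_exists:
  assumes x: "x \<in> X"
  obtains c a b where "hexagon_fan X G x c a b"
proof -
  have "Y x \<noteq> {}" using card_Y[OF x] by auto
  then obtain c where c: "c \<in> Y x" by blast
  obtain a0 where a0: "adj x c a0" using pick_adj[OF x c, of "{}"] by auto
  obtain b0 where b0: "adj x c b0" "adj x a0 b0" "\<And>w. w \<in> X \<Longrightarrow> G c w + G a0 w + G b0 w = G x w"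
    using third_point[OF x a0] by metis
  have "card {a0, b0} < 6" by (simp add: card_insert_if)
  then obtain a1 where a1: "adj x c a1" "a1 \<notin> {a0, b0}" using pick_adj[OF x c, of "{a0, b0}"] by auto
  obtain b1 where b1: "adj x c b1" "adj x a1 b1" "\<And>w. w \<in> X \<Longrightarrow> G c w + G a1 w + G b1 w = G x w"
    using third_point[OF x a1(1)] by metis
  have "card {a0, b0, a1, b1} < 6" by (simp add: card_insert_if)
  then obtain a2 where a2: "adj x c a2" "a2 \<notin> {a0, b0, a1, b1}"
    using pick_adj[OF x c, of "{a0, b0, a1, b1}"] by auto
  obtain b2 where b2: "adj x c b2" "adj x a2 b2" "\<And>w. w \<in> X \<Longrightarrow> G c w + G a2 w + G b2 w = G x w"
    using third_point[OF x a2(1)] by metis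
  have d: "{a0, b0} \<inter> {a1, b1} = {}" "{a0, b0} \<inter> {a2, b2} = {}" "{a1, b1} \<inter> {a2, b2} = {}"
    using third_point_disjoint(1)[OF x a0 b0(1,2) a1(1) b1(1,2)]
      third_point_disjoint(1)[OF x a0 b0(1,2) a2(1) b2(1,2)]
      third_point_disjoint(1)[OF x a1(1) b1(1,2) a2(1) b2(1,2)] a1 a2 by auto
  define a where "a = (\<lambda>i::nat. if i = 0 then a0 else if i = 1 then a1 else a2)"
  define b where "b = (\<lambda>i::nat. if i = 0 then b0 else if i = 1 then b1 else b2)"
  have "hexagon_fan X G x c a b"
  proof unfold_locales
    fix i j :: nat assume "i < 3" "j < 3" "i \<noteq> j"
    then show "{a i, b i} \<inter> {a j, b j} = {}" using d unfolding a_def b_def by (auto split: if_splits)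
  qed (use x a0 b0 a1 b1 a2 b2 in \<open>auto simp: a_def b_def\<close>)
  then show ?thesis by (rule that)
qed

end

context hexagon_fan
begin

text \<open>On each of the two further lines through \<open>a i\<close> the two points other than
  \<open>a i\<close> have opposite values in \<open>a j\<close>, so one of them has value \<i>. The
  points chosen on the two lines are not adjacent but share the neighbour \<open>a i\<close>, whence
  their inner product is 1.\<close>

lemma two_over:
  assumes "i < 3" "j < 3" "i \<noteq> j"
  obtains p p' where "over i p" "over i p'" "G p (a j) = \<i>" "G p' (a j) = \<i>" "G p p' = 1"
proof -
  have ai: "a i \<in> Y x" using adj_D(3)[OF a_b[OF assms(1)]] .
  have "card {c, b i} < 6" by (simp add: card_insert_if)
  then obtain p1 where p1: "adj x (a i) p1" "p1 \<notin> {c, b i}"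
    using pick_adj[OF x ai, of "{c, b i}"] by auto
  obtain q1 where q1: "adj x (a i) q1" "adj x p1 q1"
    "\<And>w. w \<in> X \<Longrightarrow> G (a i) w + G p1 w + G q1 w = G x w"
    using third_point[OF x p1(1)] by metis
  have "card {c, b i, p1, q1} < 6" by (simp add: card_insert_if)
  then obtain p2 where p2: "adj x (a i) p2" "p2 \<notin> {c, b i, p1, q1}"
    using pick_adj[OF x ai, of "{c, b i, p1, q1}"] by auto
  obtain q2 where q2: "adj x (a i) q2" "adj x p2 q2"
    "\<And>w. w \<in> X \<Longrightarrow> G (a i) w + G p2 w + G q2 w = G x w"
    using third_point[OF x p2(1)] by metis
  note ac = adj_sym[OF x c_a[OF assms(1)]] a_b[OF assms(1)] c_b[OF assms(1)]
  have q: "q1 \<notin> {c, b i}" "q2 \<notin> {c, b i}"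
    using third_point_disjoint(1)[OF x ac p1(1) q1(1,2)] third_point_disjoint(1)[OF x ac p2(1) q2(1,2)]
      p1 p2 by auto
  have o: "over i p1" "over i q1" "over i p2" "over i q2"
    using p1 p2 q1 q2 q by (auto simp: over_def)
  have pick: "\<exists>r\<in>{p, q}. G r (a j) = \<i>"
    if "over i p" "over i q" "\<And>w. w \<in> X \<Longrightarrow> G (a i) w + G p w + G q w = G x w" for p q
  proof -
    have "1 + G p (a j) + G q (a j) = 1"
      using that(3)[of "a j"] a_a[OF assms] Y_D(2)[OF adj_D(4)[OF c_a[OF assms(2)]]] assms by simp
    then have "G q (a j) = - G p (a j)" by (simp add: eq_neg_iff_add_eq_0 add.commute)
    then show ?thesis using over_unit(1)[OF assms that(1)] by auto
  qed
  obtain p where p: "p \<in> {p1, q1}" "G p (a j) = \<i>" using pick[OF o(1,2) q1(3)] by auto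
  obtain p' where p': "p' \<in> {p2, q2}" "G p' (a j) = \<i>" using pick[OF o(3,4) q2(3)] by auto
  have op: "over i p" "over i p'" using p p' o by auto
  have "p2 \<notin> {p1, q1}" using p2 by auto
  note td = third_point_disjoint[OF x p1(1) q1(1,2) p2(1) q2(1,2) this]
  have "p \<noteq> p'" using td(1) p p' by auto
  moreover have "\<not> adj x p p'" using td(2) p p' by blast
  ultimately have "G p p' = 1"
    using adj_common[OF x, of "a i" p p'] op by (auto simp: over_def)
  then show ?thesis using that op p p' by blast
qed

text \<open>If the orientations of \<open>p\<close> and \<open>u\<close> differed, their residuals
  would be proportional. A point over the third neighbour agrees in orientation with exactly one of
  them, so its residual is orthogonal to one and proportional to the other: a contradiction.\<close>

lemma over_sign_product:
  assumes ijk: "{i, j, k} = {0, 1, 2}" and p: "over i p" and u: "over j u"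
  shows "G p (a j) * G p (a k) = G u (a i) * G u (a k)"
proof (rule ccontr)
  note I = index_D[OF ijk]
  obtain w where w: "over k w" by (rule two_over[OF I(3,1) I(5)[symmetric]])
  have M: "p \<in> M" "u \<in> M" "w \<in> M" 
    using over_M[OF I(1) p] over_M[OF I(2) u] over_M[OF I(3) w] .
  assume ne: "G p (a j) * G p (a k) \<noteq> G u (a i) * G u (a k)"
  have pu: "(cmod (kernel p u))\<^sup>2 = 1" by (rule over_over(3)[OF ijk p u ne])
  have pw: "kernel p w = kernel p u * kernel u w"
    using kernel_bound(2)[OF M(1,2) kernel_self kernel_self pu M(3)] M by simp
  have ikj: "{i, k, j} = {0, 1, 2}" "{j, k, i} = {0, 1, 2}" unfolding ijk[symmetric] by blast+
  have pm: "s * t = 1 \<or> s * t = -1" if "s \<in> {\<i>, -\<i>}" "t \<in> {\<i>, -\<i>}" for s t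
    using that by auto
  note s = pm[OF over_unit(1)[OF I(1,2,4) p] over_unit(1)[OF I(1,3,5) p]]
    pm[OF over_unit(1)[OF I(2,1) I(4)[symmetric] u] over_unit(1)[OF I(2,3,6) u]]
    pm[OF over_unit(1)[OF I(3,1) I(5)[symmetric] w] over_unit(1)[OF I(3,2) I(6)[symmetric] w]]
  show False
  proof (cases "G p (a k) * G p (a j) = G w (a i) * G w (a j)")
    case True
    then have "G u (a k) * G u (a i) \<noteq> G w (a j) * G w (a i)" using ne by (simp add: mult.commute)
    from over_over(3)[OF ikj(2) u w this] have "kernel u w \<noteq> 0" by auto
    moreover have "kernel p u \<noteq> 0" using pu by auto
    ultimately show False using over_over(2)[OF ikj(1) p w True] pw by auto
  next
    case False
    have "kernel p w \<noteq> 0" using over_over(3)[OF ikj(1) p w False] by auto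
    moreover have "G u (a k) * G u (a i) = G w (a j) * G w (a i)"
      using s ne False unfolding mult.commute[of "G u (a k)"] mult.commute[of "G w (a j)"]
        mult.commute[of "G p (a k)"] by metis
    ultimately show False using over_over(2)[OF ikj(2) u w] pw by auto
  qed
qed

end

context hoggar_gram
begin

text \<open>Where \<open>p\<close> has the value -\<i> at \<open>a j\<close>, it has \<i> at
  \<open>b j\<close>, so exchanging the two names suffices. This fixes the orientation of
  \<open>p\<close>.\<close>

lemma oriented_fan_exists:
  assumes x: "x \<in> X"
  obtains c a b p where "hexagon_fan X G x c a b" "hexagon_fan.over X G x c a b 0 p"
    "G p (a 1) = \<i>" "G p (a 2) = \<i>"
proof -
  obtain c a b where f: "hexagon_fan X G x c a b" using fan_exists[OF x] .
  have step: "\<exists>a' b'. hexagon_fan X G x c a' b' \<and> hexagon_fan.over X G x c a' b' 0 p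
     \<and> G p (a' j) = \<i> \<and> (\<forall>k. k \<noteq> j \<longrightarrow> a' k = e k)"
    if f: "hexagon_fan X G x c e d" and p: "hexagon_fan.over X G x c e d 0 p" and j: "j \<in> {1, 2}"
    for e d j p
  proof -
    interpret f: hexagon_fan X G x c e d by (rule f)
    have j3: "(0::nat) < 3" "j < 3" "0 \<noteq> j" using j by auto
    show ?thesis
    proof (cases "G p (e j) = \<i>")
      case True
      then show ?thesis using f p by blast
    next
      case False
      interpret s: hexagon_fan X G x c "e(j := d j)" "d(j := e j)" using f.swap_line[OF j3(2)] .
      have "s.over 0 p" using p j3 by (auto simp: s.over_def f.over_def)
      moreover have "G p (d j) = \<i>" using f.over_unit[OF j3 p] False by auto
      ultimately show ?thesis using s.hexagon_fan_axioms
        by (intro exI[of _ "e(j := d j)"] exI[of _ "d(j := e j)"]) auto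
    qed
  qed
  interpret f: hexagon_fan X G x c a b by (rule f)
  obtain p where p: "f.over 0 p" using f.two_over[of 0 1] by auto
  obtain a1 b1 where 1: "hexagon_fan X G x c a1 b1" "hexagon_fan.over X G x c a1 b1 0 p"
    "G p (a1 1) = \<i>" using step[OF f p, of 1] by auto
  obtain a2 b2 where "hexagon_fan X G x c a2 b2" "hexagon_fan.over X G x c a2 b2 0 p"
    "G p (a2 2) = \<i>" "a2 1 = a1 1" using step[OF 1(1,2), of 2] by force
  then show ?thesis using that 1 by metis
qed

text \<open>Besides \<open>x\<close> and \<open>c\<close> take the two points of positive orientation over each of the \<open>a i\<close>.\<close>

lemma clique_exists:
  assumes x: "x \<in> X"
  obtains xs where "length xs = 8" "set xs \<subseteq> X" "sorted_wrt (\<lambda>y z. G y z = 1) xs"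
proof -
  obtain c a b p where f: "hexagon_fan X G x c a b" and p: "hexagon_fan.over X G x c a b 0 p"
    and pi: "G p (a 1) = \<i>" "G p (a 2) = \<i>" using oriented_fan_exists[OF x] .
  interpret f: hexagon_fan X G x c a b by (rule f)
  interpret s: hexagon_fan X G x c "a(0 := b 0)" "b(0 := a 0)" using f.swap_line[of 0] by simp
  obtain r where "s.over 0 r" using s.two_over[of 0 1] by auto
  then have r: "f.over_b 0 r" by (simp add: s.over_def f.over_b_def)
  have perm: "{0, 2, 1} = {0, 1, 2 :: nat}" "{1, 2, 0} = {0, 1, 2 :: nat}" by auto
  \<comment> \<open>Two points over the same \<open>a 0\<close> are compared through
    \<open>r\<close>, as \<open>over_sign_product\<close> concerns different indices.\<close>
  have s0: "G q (a 1) * G q (a 2) = -1" if "f.over 0 q" for q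
    using f.over_over_b_sign[of 0 1 2, OF refl that r] f.over_over_b_sign[of 0 1 2, OF refl p r] pi by simp
  have s1: "G q (a 0) * G q (a 2) = -1" if "f.over 1 q" for q
    using f.over_sign_product[of 0 1 2, OF refl p that] pi by simp
  have s2: "G q (a 0) * G q (a 1) = -1" if "f.over 2 q" for q
    using f.over_sign_product[OF perm(1) p that] pi by simp
  obtain p p' where p: "f.over 0 p" "f.over 0 p'" "G p (a 1) = \<i>" "G p' (a 1) = \<i>" "G p p' = 1"
    using f.two_over[of 0 1] by auto
  obtain u u' where u: "f.over 1 u" "f.over 1 u'" "G u (a 0) = \<i>" "G u' (a 0) = \<i>" "G u u' = 1"
    using f.two_over[of 1 0] by auto
  obtain w w' where w: "f.over 2 w" "f.over 2 w'" "G w (a 0) = \<i>" "G w' (a 0) = \<i>" "G w w' = 1"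
    using f.two_over[of 2 0] by auto
  have i: "z = \<i>" if "\<i> * z = -1" for z
    using that by (simp add: complex_eq_iff)
  have i2: "G p (a 2) = \<i>" "G p' (a 2) = \<i>" "G u (a 2) = \<i>" "G u' (a 2) = \<i>"
    "G w (a 1) = \<i>" "G w' (a 1) = \<i>"
    by (rule i, use s0[OF p(1)] s0[OF p(2)] s1[OF u(1)] s1[OF u(2)] s2[OF w(1)] s2[OF w(2)] p u w in simp)+
  have pu: "G q v = 1" if "q \<in> {p, p'}" "v \<in> {u, u'}" for q v
    using f.over_over(1)[of 0 1 2 q v, OF refl] that p u i2 by auto
  have pw: "G q v = 1" if "q \<in> {p, p'}" "v \<in> {w, w'}" for q v
    using f.over_over(1)[OF perm(1), of q v] that p w i2 by auto
  have uw: "G q v = 1" if "q \<in> {u, u'}" "v \<in> {w, w'}" for q v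
    using f.over_over(1)[OF perm(2), of q v] that u w i2 by auto
  have M: "{p, p', u, u', w, w'} \<subseteq> f.M" 
    using f.over_M[OF _ p(1)] f.over_M[OF _ p(2)] f.over_M[OF _ u(1)] f.over_M[OF _ u(2)]
      f.over_M[OF _ w(1)] f.over_M[OF _ w(2)] by simp
  then have M': "q \<in> X" "G x q = 1" "G c q = 1" if "q \<in> {p, p', u, u', w, w'}" for q
    using f.M_D(1,6,4)[OF subsetD[OF M that]] by auto
  have "G x c = 1" using Y_D(2)[OF f.c_Y] .
  then have "sorted_wrt (\<lambda>y z. G y z = 1) [x, c, p, p', u, u', w, w']"
    using p(5) u(5) w(5) by (simp add: pu pw uw M')
  then show ?thesis using that[of "[x, c, p, p', u, u', w, w']"] x f.in_X(1) by (simp add: M')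
qed

end

section \<open>A basis of eight lines\<close>

text \<open>Vanishing of the sum of squares means four real and four imaginary entries. As 20 = 4^2
  + 2^2 is the only decomposition into two squares, one quadruple is constant and the other splits
  as 1 + 3. \<open>H\<close> supports the constant quadruple, and \<open>r\<close> is the value
  taken only once, at \<open>b\<close>.\<close>

lemma eight_unit_signs:
  fixes f :: "nat \<Rightarrow> complex"
  assumes f: "\<And>i. i < 8 \<Longrightarrow> f i \<in> {1, \<i>, -1, -\<i>}"
    and sq: "(\<Sum>i<8. (f i)\<^sup>2) = 0" and sum: "(cmod (\<Sum>i<8. f i))\<^sup>2 = 20"
  obtains r \<eta> H b where "r \<in> {1, \<i>, -1, -\<i>}" "\<eta> \<in> {\<i>, -\<i>}" "H \<subseteq> {..<8}" "card H = 4" "b < 8" "b \<notin> H"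
    "\<And>i. i < 8 \<Longrightarrow> f i = r * (if i \<in> H then \<eta> else if i = b then 1 else -1)"
proof -
  note goal = that
  define A where "A v = {i \<in> {..<8}. f i = v}" for v
  have fin: "finite (A v)" for v by (simp add: A_def)
  have split: "(\<Sum>i<8. h (f i)) = of_nat (card (A 1)) * h 1 + of_nat (card (A \<i>)) * h \<i>
     + of_nat (card (A (-1))) * h (-1) + of_nat (card (A (-\<i>))) * h (-\<i>)" for h :: "complex \<Rightarrow> complex"
  proof -
    have "(\<Sum>i<8. h (f i)) = (\<Sum>v\<in>{1, \<i>, -1, -\<i>}. \<Sum>i\<in>A v. h (f i))"
      unfolding A_def by (rule sum.group[symmetric]) (use f in auto)
    also have "\<dots> = (\<Sum>v\<in>{1, \<i>, -1, -\<i>}. of_nat (card (A v)) * h v)"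
    proof (rule sum.cong[OF refl])
      fix v
      have "(\<Sum>i\<in>A v. h (f i)) = (\<Sum>i\<in>A v. h v)" by (rule sum.cong) (auto simp: A_def)
      then show "(\<Sum>i\<in>A v. h (f i)) = of_nat (card (A v)) * h v" by simp
    qed
    also have "\<dots> = of_nat (card (A 1)) * h 1 + of_nat (card (A \<i>)) * h \<i>
     + of_nat (card (A (-1))) * h (-1) + of_nat (card (A (-\<i>))) * h (-\<i>)"
      by (simp add: complex_eq_iff add.assoc)
    finally show ?thesis .
  qed
  define n1 n2 n3 n4 where n: "n1 = card (A 1)" "n2 = card (A \<i>)" "n3 = card (A (-1))" "n4 = card (A (-\<i>))"
  have "(8 :: complex) = of_nat (n1 + n2 + n3 + n4)" using split[of "\<lambda>_. 1"] by (simp add: n)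
  then have s8: "n1 + n2 + n3 + n4 = 8" by (metis of_nat_eq_iff of_nat_numeral)
  have "0 = real n1 - real n2 + real n3 - real n4"
    using arg_cong[OF split[of "\<lambda>z. z\<^sup>2"], of Re] sq by (simp add: n)
  then have e: "n1 + n3 = n2 + n4" by linarith
  have "(real n1 - real n3)\<^sup>2 + (real n2 - real n4)\<^sup>2 = 20"
    using split[of "\<lambda>z. z"] sum by (simp add: n cmod_power2)
  then have "real_of_int ((int n1 - int n3)\<^sup>2 + (int n2 - int n4)\<^sup>2) = real_of_int 20" by simp
  then have q: "(int n1 - int n3)\<^sup>2 + (int n2 - int n4)\<^sup>2 = 20" by (simp only: of_int_eq_iff)
  have n3: "n3 = 4 - n1" "n4 = 4 - n2" "n1 \<le> 4" "n2 \<le> 4" using s8 e by auto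
  have conclude: thesis
    if r: "r \<in> {1, \<i>, -1, -\<i>}" "\<eta> \<in> {\<i>, -\<i>}" and c: "card (A (r * \<eta>)) = 4" "card (A r) = 1" "card (A (- r * \<eta>)) = 0" for r \<eta>
  proof -
    obtain b where b: "A r = {b}" using c(2) by (rule card_1_singletonE)
    have e: "A (- r * \<eta>) = {}" using c(3) fin by simp
    have "f i = r * (if i \<in> A (r * \<eta>) then \<eta> else if i = b then 1 else -1)" if i: "i < 8" for i
    proof -
      have "f i \<noteq> - r * \<eta>" using e i by (auto simp: A_def)
      moreover have "f i = r \<longleftrightarrow> i = b" using b i by (auto simp: A_def set_eq_iff)
      moreover have "{1, \<i>, -1, -\<i>} \<subseteq> {r * \<eta>, r, - r * \<eta>, - r}"
      proof -
        have "r = 1 \<or> r = \<i> \<or> r = -1 \<or> r = -\<i>" "\<eta> = \<i> \<or> \<eta> = -\<i>" using r by auto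
        then show ?thesis by (elim disjE) simp_all
      qed
      with f[OF i] have "f i \<in> {r * \<eta>, r, - r * \<eta>, - r}" by blast
      ultimately show ?thesis using i by (auto simp: A_def)
    qed
    moreover have "b < 8" "f b = r" using b by (auto simp: A_def set_eq_iff)
    moreover have "r \<noteq> r * \<eta>" using that by auto
    moreover from this have "b \<notin> A (r * \<eta>)" using \<open>f b = r\<close> by (simp add: A_def)
    moreover have "A (r * \<eta>) \<subseteq> {..<8}" by (auto simp: A_def)
    ultimately show thesis using goal[of r \<eta> "A (r * \<eta>)" b] r c by blast
  qed
  have m: "n1 \<in> {0, 1, 2, 3, 4}" "n2 \<in> {0, 1, 2, 3, 4}" using n3 by auto
  have "\<forall>a\<in>{0, 1, 2, 3, 4}. \<forall>b\<in>{0, 1, 2, 3, 4 :: nat}.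
    (int a - int (4 - a))\<^sup>2 + (int b - int (4 - b))\<^sup>2 = 20 \<longrightarrow>
    (a, b) \<in> {(0, 1), (0, 3), (4, 1), (4, 3), (1, 0), (1, 4), (3, 0), (3, 4)}"
    by simp
  from this[THEN bspec, OF m(1), THEN bspec, OF m(2)] q n3
  consider "n1 = 0" "n2 = 1" | "n1 = 0" "n2 = 3" | "n1 = 4" "n2 = 1" | "n1 = 4" "n2 = 3"
    | "n1 = 1" "n2 = 0" | "n1 = 1" "n2 = 4" | "n1 = 3" "n2 = 0" | "n1 = 3" "n2 = 4" by fast
  then show thesis
  proof cases
    case 1 then show ?thesis by (intro conclude[of \<i> \<i>]) (use n n3 in simp_all)
  next
    case 2 then show ?thesis by (intro conclude[of "-\<i>" "-\<i>"]) (use n n3 in simp_all)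
  next
    case 3 then show ?thesis by (intro conclude[of \<i> "-\<i>"]) (use n n3 in simp_all)
  next
    case 4 then show ?thesis by (intro conclude[of "-\<i>" \<i>]) (use n n3 in simp_all)
  next
    case 5 then show ?thesis by (intro conclude[of 1 "-\<i>"]) (use n n3 in simp_all)
  next
    case 6 then show ?thesis by (intro conclude[of 1 \<i>]) (use n n3 in simp_all)
  next
    case 7 then show ?thesis by (intro conclude[of "-1" \<i>]) (use n n3 in simp_all)
  next
    case 8 then show ?thesis by (intro conclude[of "-1" "-\<i>"]) (use n n3 in simp_all)
  qed
qed

context hoggar_gram
begin

lemma ip_sum_left: "ip (\<lambda>w. \<Sum>i\<in>A. f i w) z = (\<Sum>i\<in>A. ip (f i) z)"
  unfolding ip_def sum_distrib_right sum_divide_distrib[symmetric] by (subst sum.swap) simp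

lemma ip_sum_right: "ip z (\<lambda>w. \<Sum>i\<in>A. f i w) = (\<Sum>i\<in>A. ip z (f i))"
  unfolding ip_def sum_distrib_left sum_divide_distrib[symmetric] cnj_sum by (subst sum.swap) simp

end

locale hoggar_basis = hoggar_gram +
  fixes e :: "nat \<Rightarrow> 'a"
  assumes e_X: "i < 8 \<Longrightarrow> e i \<in> X"
    and e_e: "i < 8 \<Longrightarrow> j < 8 \<Longrightarrow> i \<noteq> j \<Longrightarrow> G (e i) (e j) = 1"
begin

definition total :: "'a \<Rightarrow> complex" where
  "total x = (\<Sum>i<8. G x (e i))"

text \<open>The Gram matrix of the eight vectors is 2 I + J with J the all-ones matrix, and its
  inverse is (I - J / 10) / 2.\<close>

definition coord :: "'a \<Rightarrow> nat \<Rightarrow> complex" where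
  "coord x i = (G x (e i) - total x / 10) / 2"

lemma G_e_e: "i < 8 \<Longrightarrow> j < 8 \<Longrightarrow> G (e i) (e j) = 1 + 2 * of_bool (i = j)"
  using e_e e_X by auto

lemma sum_coord: "(\<Sum>i<8. coord x i) = total x / 10"
  by (simp add: coord_def sum_divide_distrib[symmetric] sum_subtractf total_def[symmetric])

lemma gram_times: "j < 8 \<Longrightarrow> (\<Sum>i<8. u i * G (e i) (e j)) = (\<Sum>i<8. u i) + 2 * u j"
proof -
  assume j: "j < 8"
  have "(\<Sum>i<8. u i * G (e i) (e j)) = (\<Sum>i<8. u i + (if i = j then 2 * u i else 0))"
    by (rule sum.cong) (use j G_e_e in auto)
  then show ?thesis using j by (simp add: sum.distrib)
qed

definition remainder :: "'a \<Rightarrow> 'a \<Rightarrow> complex" where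
  "remainder x w = G x w - (\<Sum>i<8. coord x i * G (e i) w)"

lemma ip_remainder:
  assumes "x \<in> X"
  shows "ip (remainder x) (remainder x) = 3 - (\<Sum>i<8. G x (e i) * cnj (G x (e i))) / 2
    + total x * cnj (total x) / 20"
proof -
  have l: "ip (remainder x) (G y) = G x y - (\<Sum>i<8. coord x i * G (e i) y)" if "y \<in> X" for y
    unfolding remainder_def ip_diff_left ip_sum_left ip_scale_left using assms that e_X by simp
  have 0: "ip (remainder x) (G (e j)) = 0" if "j < 8" for j
    using that e_X by (simp add: l gram_times sum_coord) (simp add: coord_def field_simps)
  have "ip (remainder x) (remainder x) = ip (remainder x) (G x)"
    unfolding remainder_def[of x] using 0 unfolding ip_diff_right ip_sum_right ip_scale_right
    by (simp add: remainder_def[abs_def])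
  also have "\<dots> = 3 - (\<Sum>i<8. coord x i * cnj (G x (e i)))"
    unfolding l[OF assms] using assms e_X hermitian[OF assms] by simp
  also have "(\<Sum>i<8. coord x i * cnj (G x (e i))) =
     (\<Sum>i<8. G x (e i) * cnj (G x (e i))) / 2 - total x / 20 * (\<Sum>i<8. cnj (G x (e i)))"
    unfolding sum_divide_distrib sum_distrib_left sum_subtractf[symmetric]
    by (rule sum.cong) (auto simp: coord_def algebra_simps diff_divide_distrib)
  finally show ?thesis by (simp add: total_def[symmetric] cnj_sum[symmetric] del: cnj_sum)
qed

lemma sum_G_e:
  assumes "i < 8" "j < 8"
  shows "(\<Sum>x\<in>X. G x (e i) * cnj (G x (e j))) = 96 * G (e j) (e i)"
proof -
  have "(\<Sum>x\<in>X. G x (e i) * cnj (G x (e j))) = (\<Sum>x\<in>X. G (e j) x * G x (e i))"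
    by (rule sum.cong) (use hermitian[of _ "e j"] e_X assms in auto)
  then show ?thesis using G_square e_X assms by simp
qed

lemma X_card: "card X = 256"
  using card_X e_X[of 0] by simp

text \<open>The basis vectors span \<open>\<complex>\<^sup>8\<close>: the squared norms of the remainders add up to zero.\<close>

lemma remainder_zero:
  assumes "x \<in> X" "w \<in> X"
  shows "remainder x w = 0"
proof -
  have E: "(\<Sum>i<8. \<Sum>j<8. G (e j) (e i)) = 80"
    using gram_times[of _ "\<lambda>_. 1"] by simp
  have "(\<Sum>x\<in>X. \<Sum>i<8. G x (e i) * cnj (G x (e i))) = (\<Sum>i<8. \<Sum>x\<in>X. G x (e i) * cnj (G x (e i)))"
    by (rule sum.swap)
  also have "\<dots> = 2304" using sum_G_e e_X by simp
  finally have 1: "(\<Sum>x\<in>X. \<Sum>i<8. G x (e i) * cnj (G x (e i))) = 2304" .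
  have "(\<Sum>x\<in>X. total x * cnj (total x)) = (\<Sum>x\<in>X. \<Sum>i<8. \<Sum>j<8. G x (e i) * cnj (G x (e j)))"
    unfolding total_def cnj_sum sum_product ..
  also have "\<dots> = (\<Sum>i<8. \<Sum>x\<in>X. \<Sum>j<8. G x (e i) * cnj (G x (e j)))" by (rule sum.swap)
  also have "\<dots> = (\<Sum>i<8. \<Sum>j<8. \<Sum>x\<in>X. G x (e i) * cnj (G x (e j)))"
    by (rule sum.cong[OF refl], rule sum.swap)
  also have "\<dots> = 96 * (\<Sum>i<8. \<Sum>j<8. G (e j) (e i))"
    unfolding sum_distrib_left by (intro sum.cong refl) (simp add: sum_G_e)
  finally have 2: "(\<Sum>x\<in>X. total x * cnj (total x)) = 7680" unfolding E by simp
  have "(\<Sum>x\<in>X. ip (remainder x) (remainder x)) = (\<Sum>x\<in>X. 3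
      - (\<Sum>i<8. G x (e i) * cnj (G x (e i))) / 2 + total x * cnj (total x) / 20)"
    by (rule sum.cong) (simp_all add: ip_remainder)
  \<comment> \<open>256 * 3 - 2304 / 2 + 7680 / 20 = 768 - 1152 + 384 = 0.\<close>
  also have "\<dots> = 0"
    unfolding sum.distrib sum_subtractf sum_divide_distrib[symmetric] 1 2 by (simp add: X_card)
  finally have "(\<Sum>x\<in>X. (\<Sum>w\<in>X. (cmod (remainder x w))\<^sup>2) / 96) = 0"
    unfolding ip_self of_real_sum[symmetric] of_real_eq_0_iff .
  then have "(\<Sum>w\<in>X. (cmod (remainder x w))\<^sup>2) / 96 = 0"
    using assms finite_X by (subst (asm) sum_nonneg_eq_0_iff) (auto intro!: sum_nonneg)
  then show ?thesis using assms finite_X by (simp add: sum_nonneg_eq_0_iff)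
qed

lemma G_expand:
  assumes "x \<in> X" "y \<in> X"
  shows "G x y = (\<Sum>i<8. coord x i * cnj (G y (e i)))"
  using remainder_zero[OF assms] hermitian[OF assms(2) e_X] by (simp add: remainder_def)

lemma G_expand_total:
  assumes "x \<in> X" "y \<in> X"
  shows "2 * G x y = (\<Sum>i<8. G x (e i) * cnj (G y (e i))) - total x * cnj (total y) / 10"
proof -
  have "2 * G x y = (\<Sum>i<8. G x (e i) * cnj (G y (e i)) - total x / 10 * cnj (G y (e i)))"
    unfolding G_expand[OF assms] sum_distrib_left
    by (rule sum.cong) (auto simp: coord_def field_simps)
  then show ?thesis
    unfolding sum_subtractf sum_distrib_left[symmetric] total_def[of y] cnj_sum by simp
qed

definition others :: "'a set" where
  "others = Y (e 0) - e ` {..<8}"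

lemma inj_e: "inj_on e {..<8}"
proof (rule inj_onI, rule ccontr)
  fix i j assume "i \<in> {..<8}" "j \<in> {..<8}" "e i = e j" "i \<noteq> j"
  then have "(1 :: complex) = 3" using e_e[of i j] e_X G_self[of "e j"] by (metis lessThan_iff)
  then show False by simp
qed

lemma e_Y: "i < 8 \<Longrightarrow> i \<noteq> 0 \<Longrightarrow> e i \<in> Y (e 0)"
  using e_e[of 0 i] e_X by (simp add: Y_def)

lemma card_others: "card others = 56"
proof -
  have e0: "e 0 \<notin> Y (e 0)" using e_X[of 0] by (simp add: Y_def)
  have "{..<8} = insert 0 {1..<8::nat}" by auto
  then have "others = Y (e 0) - e ` {1..<8}" using e0 by (auto simp: others_def)
  moreover have "e ` {1..<8} \<subseteq> Y (e 0)" using e_Y by auto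
  moreover have "card (e ` {1..<8}) = 7"
    by (subst card_image) (auto intro: inj_on_subset[OF inj_e])
  ultimately show ?thesis using card_Y[of "e 0"] e_X[of 0] by (simp add: card_Diff_subset)
qed

lemma others_D: "y \<in> others \<Longrightarrow> y \<in> X" "y \<in> others \<Longrightarrow> y \<in> Y (e 0)"
  by (auto simp: others_def Y_def)

lemma others_unit:
  assumes "y \<in> others" "i < 8"
  shows "G y (e i) \<in> {1, \<i>, -1, -\<i>}"
proof (cases "i = 0")
  case True
  then show ?thesis using Y_D(3)[of "e 0" y] others_D[OF assms(1)] e_X[of 0] by simp
next
  case False
  then show ?thesis
    using Y_unit[of "e 0" y "e i"] others_D[OF assms(1)] e_Y[OF assms(2)] e_X[of 0] assms
    by (auto simp: others_def)
qed

text \<open>The basis vectors already exhaust the sum of the \<open>\<bar>\<Sum>\<^sub>i G x (e i)\<^sup>2\<bar>\<^sup>2\<close>.\<close>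

lemma others_sum_squares:
  assumes "y \<in> others"
  shows "(\<Sum>i<8. (G y (e i))\<^sup>2) = 0"
proof -
  define q where "q x = (\<Sum>i<8. (G x (e i))\<^sup>2)" for x
  have sq: "(\<Sum>i<8. \<Sum>j<8. (G (e j) (e i))\<^sup>2) = 128"
    by (simp add: G_e_e numeral_eq_Suc lessThan_Suc)
  have "(\<Sum>x\<in>X. q x * cnj (q x)) = (\<Sum>x\<in>X. \<Sum>i<8. \<Sum>j<8. (G x (e i))\<^sup>2 * cnj ((G x (e j))\<^sup>2))"
    unfolding q_def cnj_sum sum_product ..
  also have "\<dots> = (\<Sum>i<8. \<Sum>x\<in>X. \<Sum>j<8. (G x (e i))\<^sup>2 * cnj ((G x (e j))\<^sup>2))" by (rule sum.swap)
  also have "\<dots> = (\<Sum>i<8. \<Sum>j<8. \<Sum>x\<in>X. (G x (e i))\<^sup>2 * cnj ((G x (e j))\<^sup>2))"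
    by (rule sum.cong[OF refl], rule sum.swap)
  also have "\<dots> = 64 * (\<Sum>i<8. \<Sum>j<8. (G (e j) (e i))\<^sup>2)"
    unfolding sum_distrib_left
  proof (intro sum.cong refl)
    fix i j :: nat assume "i \<in> {..<8}" "j \<in> {..<8}"
    then have ij: "e i \<in> X" "e j \<in> X" using e_X by auto
    have "(\<Sum>x\<in>X. (G x (e i))\<^sup>2 * cnj ((G x (e j))\<^sup>2)) = (\<Sum>x\<in>X. (G (e j) x)\<^sup>2 * (G x (e i))\<^sup>2)"
      by (rule sum.cong) (use ij G2_cnj G2_commute[of _ "e j"] in \<open>auto simp del: complex_cnj_power\<close>)
    then show "(\<Sum>x\<in>X. (G x (e i))\<^sup>2 * cnj ((G x (e j))\<^sup>2)) = 64 * (G (e j) (e i))\<^sup>2"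
      using G2_square[OF ij(2,1)] by simp
  qed
  finally have 1: "(\<Sum>x\<in>X. q x * cnj (q x)) = 8192" unfolding sq by simp
  have qe: "q (e j) = 16" if "j < 8" for j
  proof -
    have "q (e j) = (\<Sum>i<8. 1 + (if j = i then 8 else 0))"
      unfolding q_def by (rule sum.cong) (use that G_e_e in \<open>auto simp: power2_eq_square\<close>)
    then show ?thesis using that by (simp add: sum.distrib)
  qed
  have 2: "(\<Sum>x\<in>X. q x * cnj (q x)) = 4 * (q (e 0) * cnj (q (e 0)) + (\<Sum>x\<in>Y (e 0). q x * cnj (q x)))"
  proof (rule sum_orbits)
    fix w assume "w \<in> X"
    then have "q (rot w) = - q w" using e_X by (simp add: q_def power_mult_distrib sum_negf)
    then show "q (rot w) * cnj (q (rot w)) = q w * cnj (q w)" by simp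
  qed (use e_X in simp)
  have img: "e ` {1..<8} \<subseteq> Y (e 0)" using e_Y by auto
  have oth: "others = Y (e 0) - e ` {1..<8}"
  proof -
    have "{..<8} = insert 0 {1..<8::nat}" by auto
    moreover have "e 0 \<notin> Y (e 0)" using e_X[of 0] by (simp add: Y_def)
    ultimately show ?thesis by (auto simp: others_def)
  qed
  have "(\<Sum>x\<in>Y (e 0). q x * cnj (q x)) = (\<Sum>x\<in>others. q x * cnj (q x)) + (\<Sum>x\<in>e ` {1..<8}. q x * cnj (q x))"
    unfolding oth by (rule sum.subset_diff[OF img]) simp
  also have "(\<Sum>x\<in>e ` {1..<8}. q x * cnj (q x)) = (\<Sum>i\<in>{1..<8}. q (e i) * cnj (q (e i)))"
    by (subst sum.reindex) (auto intro: inj_on_subset[OF inj_e])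
  also have "\<dots> = 1792" by (simp add: qe)
  \<comment> \<open>The basis lines contribute 4 * (256 + 1792) = 8192, the whole sum.\<close>
  finally have "(\<Sum>x\<in>others. q x * cnj (q x)) = 0" using 1 2 qe[of 0] by simp
  then have "q y = 0"
    by (rule zero_if_sum_norm_zero[rotated]) (use assms in \<open>auto simp: others_def\<close>)
  then show ?thesis by (simp add: q_def)
qed

text \<open>The squared norm of \<open>y\<close>, expanded in the basis, gives 6 = 8 - |total y|^2 /
  10.\<close>

lemma others_total:
  assumes "y \<in> others"
  shows "(cmod (total y))\<^sup>2 = 20"
proof -
  have "G y (e i) * cnj (G y (e i)) = 1" if "i < 8" for i
    using others_unit[OF assms that] by auto
  then have "6 = 8 - total y * cnj (total y) / 10"
    using G_expand_total[of y y] others_D[OF assms] by simp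
  then have "total y * cnj (total y) = 20" by (simp add: field_simps)
  then have "of_real ((cmod (total y))\<^sup>2) = (of_real 20 :: complex)"
    by (simp add: complex_mult_cnj cmod_power2)
  then show ?thesis unfolding of_real_eq_iff .
qed

text \<open>\<open>r\<close> normalises the phase of \<open>y\<close>, \<open>\<eta>\<close> is the
  chirality, and \<open>H\<close> is the word of weight 4.\<close>

definition code :: "complex \<Rightarrow> complex \<Rightarrow> nat set \<Rightarrow> nat \<Rightarrow> 'a \<Rightarrow> bool" where
  "code r \<eta> H b y \<longleftrightarrow> r \<in> {1, \<i>, -1, -\<i>} \<and> \<eta> \<in> {\<i>, -\<i>} \<and> H \<subseteq> {..<8} \<and> card H = 4 \<and> b < 8 \<and> b \<notin> H
     \<and> (\<forall>i<8. G y (e i) = r * (if i \<in> H then \<eta> else if i = b then 1 else -1))"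

lemma code_exists:
  assumes "y \<in> others"
  obtains r \<eta> H b where "code r \<eta> H b y"
  using eight_unit_signs[of "\<lambda>i. G y (e i)", OF others_unit[OF assms] others_sum_squares[OF assms]]
    others_total[OF assms] unfolding total_def code_def by metis

lemma code_total:
  assumes "code r \<eta> H b y"
  shows "total y = r * (4 * \<eta> - 2)"
proof -
  have H: "H \<subseteq> {..<8}" "card H = 4" "b < 8" "b \<notin> H" using assms by (auto simp: code_def)
  have "total y = (\<Sum>i<8. r * ((if i \<in> H then \<eta> + 1 else 0) + (if i = b then 2 else 0) - 1))"
    unfolding total_def by (rule sum.cong) (use assms in \<open>auto simp: code_def\<close>)
  also have "\<dots> = r * ((\<Sum>i<8. if i \<in> H then \<eta> + 1 else 0) + 2 - 8)"
    using H by (simp add: sum_distrib_left[symmetric] sum.distrib sum_subtractf)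
  also have "(\<Sum>i<8. if i \<in> H then \<eta> + 1 else 0) = (\<Sum>i\<in>H. \<eta> + 1)"
    using H by (intro sum.mono_neutral_cong_right) auto
  finally show ?thesis using H by (simp add: algebra_simps)
qed

end

text \<open>The numbers will be the intersections of a word with four pairs of points. All have the
  same parity; if they were even, two of them would be 2.\<close>

lemma four_counts:
  fixes p q r s :: nat
  assumes "p \<le> 2" "q \<le> 2" "r \<le> 2" "s \<le> 2" "even (p + q)" "even (p + r)" "p + q + r + s = 4"
    "\<not> (p = 2 \<and> q = 2)" "\<not> (p = 2 \<and> r = 2)" "\<not> (p = 2 \<and> s = 2)" "\<not> (q = 2 \<and> r = 2)"
    "\<not> (q = 2 \<and> s = 2)" "\<not> (r = 2 \<and> s = 2)"
  shows "p = 1 \<and> q = 1 \<and> r = 1 \<and> s = 1"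
proof -
  have m: "p \<in> {0, 1, 2}" "q \<in> {0, 1, 2}" "r \<in> {0, 1, 2}" "s \<in> {0, 1, 2}" using assms(1-4) by auto
  have *: "\<forall>p\<in>{0, 1, 2}. \<forall>q\<in>{0, 1, 2}. \<forall>r\<in>{0, 1, 2}. \<forall>s\<in>{0, 1, 2 :: nat}.
     even (p + q) \<longrightarrow> even (p + r) \<longrightarrow> p + q + r + s = 4 \<longrightarrow>
    \<not> (p = 2 \<and> q = 2) \<longrightarrow> \<not> (p = 2 \<and> r = 2) \<longrightarrow> \<not> (p = 2 \<and> s = 2) \<longrightarrow> \<not> (q = 2 \<and> r = 2) \<longrightarrow>
    \<not> (q = 2 \<and> s = 2) \<longrightarrow> \<not> (r = 2 \<and> s = 2) \<longrightarrow> p = 1 \<and> q = 1 \<and> r = 1 \<and> s = 1"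
    by simp
  show ?thesis using *[THEN bspec, OF m(1), THEN bspec, OF m(2), THEN bspec, OF m(3), THEN bspec, OF m(4)] assms(5-) by blast
qed

text \<open>A self-orthogonal binary code of length 8 with at least 14 words of weight 4 is the extended
  Hamming code; three of its words serve as coordinate functions on the points of \<open>\<F>\<^sub>2\<^sup>3\<close>.\<close>

lemma cube_labelling:
  fixes \<H> :: "nat set set"
  assumes four: "\<And>H. H \<in> \<H> \<Longrightarrow> H \<subseteq> {..<8} \<and> card H = 4"
    and even: "\<And>H H'. H \<in> \<H> \<Longrightarrow> H' \<in> \<H> \<Longrightarrow> even (card (H \<inter> H'))"
    and card: "14 \<le> card \<H>"
  obtains l :: "nat \<Rightarrow> nat" where "bij_betw l {..<8} {..<8}"
    "\<And>H k. H \<in> \<H> \<Longrightarrow> k < 3 \<Longrightarrow> even (card {i \<in> H. bit (l i) k})"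
proof -
  have fin: "finite H" if "H \<in> \<H>" for H using four[OF that] finite_subset by auto
  have large: "\<exists>H\<in>\<H>. H \<notin> S" if "finite S" "card S < 14" for S
    using card_mono[OF that(1), of \<H>] that card by auto
  obtain A where A: "A \<in> \<H>" using large[of "{}"] by auto
  have "card {A, {..<8} - A} < 14" by (simp add: card_insert_if)
  then obtain B where B: "B \<in> \<H>" "B \<noteq> A" "B \<noteq> {..<8} - A" using large[of "{A, {..<8} - A}"] by auto
  have le: "card (A \<inter> B) \<le> 4" using card_mono[OF fin[OF A], of "A \<inter> B"] four[OF A] by simp
  have "card (A \<inter> B) \<noteq> 4"
  proof
    assume h: "card (A \<inter> B) = 4"
    have "A \<inter> B = A" using card_subset_eq[OF fin[OF A], of "A \<inter> B"] h four[OF A] by simp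
    moreover have "A \<inter> B = B" using card_subset_eq[OF fin[OF B(1)], of "A \<inter> B"] h four[OF B(1)] by simp
    ultimately show False using B by blast
  qed
  moreover have "card (A \<inter> B) \<noteq> 0"
  proof
    assume "card (A \<inter> B) = 0"
    then have "A \<inter> B = {}" using fin[OF A] by simp
    then have "B \<subseteq> {..<8} - A" using four[OF B(1)] by blast
    moreover have "card ({..<8} - A) = 4" using four[OF A] fin[OF A] by (simp add: card_Diff_subset)
    ultimately show False using card_subset_eq[of "{..<8} - A" B] four[OF B(1)] B by simp
  qed
  moreover have "card (A \<inter> B) \<in> {0, 2, 4}"
  proof -
    have "card (A \<inter> B) \<in> {0, 1, 2, 3, 4}" using le by auto
    then show ?thesis using even[OF A B(1)] by auto
  qed
  ultimately have AB: "card (A \<inter> B) = 2" by auto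
  \<comment> \<open>Two words that are neither equal nor complementary meet in two points, so they
    cut the eight points into four pairs.\<close>
  define P Q R S where PQRS: "P = A \<inter> B" "Q = A - B" "R = B - A" "S = {..<8} - A - B"
  have fPQRS: "finite P" "finite Q" "finite R" "finite S"
    using fin[OF A] fin[OF B(1)] by (auto simp: PQRS)
  have un: "P \<union> Q = A" "P \<union> R = B" "P \<union> Q \<union> R \<union> S = {..<8}"
    using four[OF A] four[OF B(1)] by (auto simp: PQRS)
  have disj: "P \<inter> Q = {}" "P \<inter> R = {}" "Q \<inter> R = {}" "P \<inter> S = {}" "Q \<inter> S = {}" "R \<inter> S = {}"
    by (auto simp: PQRS)
  have split: "card (H \<inter> A) = card (H \<inter> P) + card (H \<inter> Q)" "card (H \<inter> B) = card (H \<inter> P) + card (H \<inter> R)"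
    "H \<subseteq> {..<8} \<Longrightarrow> card H = card (H \<inter> P) + card (H \<inter> Q) + card (H \<inter> R) + card (H \<inter> S)" for H
  proof -
    have u: "card (H \<inter> (C \<union> D)) = card (H \<inter> C) + card (H \<inter> D)" if "finite C" "finite D" "C \<inter> D = {}" for C D
      using card_Un_disjoint[of "H \<inter> C" "H \<inter> D"] that by (auto simp: Int_Un_distrib)
    show "card (H \<inter> A) = card (H \<inter> P) + card (H \<inter> Q)" "card (H \<inter> B) = card (H \<inter> P) + card (H \<inter> R)"
      using u[of P Q] u[of P R] un disj fPQRS by auto
    assume "H \<subseteq> {..<8}"
    then have "H = H \<inter> (P \<union> Q \<union> R \<union> S)" using un by auto
    then have "card H = card (H \<inter> (P \<union> Q \<union> R \<union> S))" by simp
    also have "\<dots> = card (H \<inter> (P \<union> Q \<union> R)) + card (H \<inter> S)"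
      by (rule u) (use fPQRS disj in auto)
    also have "card (H \<inter> (P \<union> Q \<union> R)) = card (H \<inter> (P \<union> Q)) + card (H \<inter> R)"
      by (rule u) (use fPQRS disj in auto)
    also have "card (H \<inter> (P \<union> Q)) = card (H \<inter> P) + card (H \<inter> Q)"
      by (rule u) (use fPQRS disj in auto)
    finally show "card H = card (H \<inter> P) + card (H \<inter> Q) + card (H \<inter> R) + card (H \<inter> S)" .
  qed
  have c2: "card P = 2" "card Q = 2" "card R = 2" "card S = 2"
  proof -
    have i: "A \<inter> P = P" "A \<inter> Q = Q" "A \<inter> R = {}" "A \<inter> S = {}" "B \<inter> P = P" "B \<inter> R = R"
      "{..<8} \<inter> P = P" "{..<8} \<inter> Q = Q" "{..<8} \<inter> R = R" "{..<8} \<inter> S = S"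
      using four[OF A] four[OF B(1)] by (auto simp: PQRS)
    show "card P = 2" using AB by (simp add: PQRS)
    moreover have "card A = card P + card Q" "card B = card P + card R"
      using split(1)[of A] split(2)[of B] unfolding i Int_absorb .
    ultimately show QR: "card Q = 2" "card R = 2" using four[OF A] four[OF B(1)] by linarith+
    have "card {..<8::nat} = card P + card Q + card R + card S"
      using split(3)[of "{..<8}"] unfolding i by simp
    then show "card S = 2" using \<open>card P = 2\<close> QR by simp
  qed
  \<comment> \<open>A word that is not a union of two of the pairs splits every pair, so membership
    in \<open>A\<close>, \<open>B\<close> and \<open>C\<close> separates the points.\<close>
  let ?U = "{P \<union> Q, P \<union> R, P \<union> S, Q \<union> R, Q \<union> S, R \<union> S}"
  have U: "card ?U < 14"
    using card_length[of "[P \<union> Q, P \<union> R, P \<union> S, Q \<union> R, Q \<union> S, R \<union> S]"] by simp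
  have "finite ?U" by simp
  from large[OF this U] obtain C where C: "C \<in> \<H>" "C \<notin> ?U" by (elim bexE)
  have C8: "C \<subseteq> {..<8}" "card C = 4" using four[OF C(1)] by auto
  have le2: "card (C \<inter> P) \<le> 2" "card (C \<inter> Q) \<le> 2" "card (C \<inter> R) \<le> 2" "card (C \<inter> S) \<le> 2"
    using card_mono[OF fPQRS(1), of "C \<inter> P"] card_mono[OF fPQRS(2), of "C \<inter> Q"]
      card_mono[OF fPQRS(3), of "C \<inter> R"] card_mono[OF fPQRS(4), of "C \<inter> S"] c2 by auto
  have full: "D \<subseteq> C" if "card (C \<inter> D) = 2" "card D = 2" "finite D" for D
    using card_subset_eq[of D "C \<inter> D"] that by auto
  have no: "\<not> (card (C \<inter> D) = 2 \<and> card (C \<inter> E) = 2)"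
    if "D \<union> E \<in> ?U" "card D = 2" "card E = 2" "finite D" "finite E" "D \<inter> E = {}" for D E
  proof
    assume h: "card (C \<inter> D) = 2 \<and> card (C \<inter> E) = 2"
    have "D \<union> E \<subseteq> C" using full h that by blast
    moreover have "card (D \<union> E) = 4" using that by (simp add: card_Un_disjoint)
    ultimately have "D \<union> E = C" using card_subset_eq[OF fin[OF C(1)], of "D \<union> E"] C8 by simp
    then show False using C(2) that(1) by blast
  qed
  have ev: "even (card (C \<inter> P) + card (C \<inter> Q))" "even (card (C \<inter> P) + card (C \<inter> R))"
    using even[OF C(1) A] even[OF C(1) B(1)] split by auto
  have tot: "card (C \<inter> P) + card (C \<inter> Q) + card (C \<inter> R) + card (C \<inter> S) = 4"
    using split(3)[OF C8(1)] C8 by simp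
  have nn: "\<not> (card (C \<inter> P) = 2 \<and> card (C \<inter> Q) = 2)" "\<not> (card (C \<inter> P) = 2 \<and> card (C \<inter> R) = 2)"
    "\<not> (card (C \<inter> P) = 2 \<and> card (C \<inter> S) = 2)" "\<not> (card (C \<inter> Q) = 2 \<and> card (C \<inter> R) = 2)"
    "\<not> (card (C \<inter> Q) = 2 \<and> card (C \<inter> S) = 2)" "\<not> (card (C \<inter> R) = 2 \<and> card (C \<inter> S) = 2)"
    by (rule no; use c2 fPQRS disj in simp)+
  have one: "card (C \<inter> P) = 1" "card (C \<inter> Q) = 1" "card (C \<inter> R) = 1" "card (C \<inter> S) = 1"
    using four_counts[OF le2 ev tot nn] by auto
  define l :: "nat \<Rightarrow> nat" where "l i = of_bool (i \<in> A) + 2 * of_bool (i \<in> B) + 4 * of_bool (i \<in> C)" for i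
  have inj2: "i = j" if D2: "card D = 2" and D1: "card (C \<inter> D) = 1" and ij: "i \<in> D" "j \<in> D" "i \<in> C \<longleftrightarrow> j \<in> C" for i j D
  proof -
    have fD: "finite D" using D2 by (metis card.infinite zero_neq_numeral)
    have "card (D - C) = 1" using card_Diff_subset_Int[of D C] fD D1 D2 by (simp add: Int_commute)
    then obtain u where u: "D - C = {u}" by (rule card_1_singletonE)
    obtain v where v: "C \<inter> D = {v}" using D1 by (rule card_1_singletonE)
    show ?thesis
    proof (cases "i \<in> C")
      case True
      then have "i \<in> C \<inter> D" "j \<in> C \<inter> D" using ij by auto
      then show ?thesis unfolding v by simp
    next
      case False
      then have "i \<in> D - C" "j \<in> D - C" using ij by auto
      then show ?thesis unfolding u by simp
    qed
  qed
  have "inj_on l {..<8}"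
  proof (rule inj_onI)
    fix i j assume i: "i \<in> {..<8}" and j: "j \<in> {..<8}" and "l i = l j"
    then have h: "i \<in> A \<longleftrightarrow> j \<in> A" "i \<in> B \<longleftrightarrow> j \<in> B" "i \<in> C \<longleftrightarrow> j \<in> C"
      by (auto simp: l_def of_bool_def split: if_splits)
    consider (P) "i \<in> P" "j \<in> P" | (Q) "i \<in> Q" "j \<in> Q" | (R) "i \<in> R" "j \<in> R" | (S) "i \<in> S" "j \<in> S"
      using i j h by (auto simp: PQRS)
    then show "i = j"
      using inj2[OF c2(1) one(1)] inj2[OF c2(2) one(2)] inj2[OF c2(3) one(3)] inj2[OF c2(4) one(4)] h(3)
      by cases blast+
  qed
  moreover have "l ` {..<8} \<subseteq> {..<8}" by (auto simp: l_def of_bool_def)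
  ultimately have "bij_betw l {..<8} {..<8}"
    using endo_inj_surj[of "{..<8}" l] by (simp add: bij_betw_def)
  moreover have "even (card {i \<in> H. bit (l i) k})" if H: "H \<in> \<H>" and k: "k < 3" for H k
  proof -
    have b: "bit (l i) 0 \<longleftrightarrow> i \<in> A" "bit (l i) (Suc 0) \<longleftrightarrow> i \<in> B" "bit (l i) 2 \<longleftrightarrow> i \<in> C" for i
      by (auto simp: l_def of_bool_def bit_iff_odd)
    have "k = 0 \<or> k = Suc 0 \<or> k = 2" using k by auto
    then have "{i \<in> H. bit (l i) k} \<in> {H \<inter> A, H \<inter> B, H \<inter> C}" using b by auto
    then show ?thesis using even[OF H A] even[OF H B(1)] even[OF H C(1)] by auto
  qed
  ultimately show thesis by (rule that)
qed

section \<open>Inner products of coded vectors\<close>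

context hoggar_basis
begin

definition sign :: "complex \<Rightarrow> nat set \<Rightarrow> nat \<Rightarrow> nat \<Rightarrow> complex" where
  "sign \<eta> H b i = (if i \<in> H then \<eta> else if i = b then 1 else -1)"

lemma code_G: "code r \<eta> H b y \<Longrightarrow> i < 8 \<Longrightarrow> G y (e i) = r * sign \<eta> H b i"
  by (simp add: code_def sign_def)

lemma code_D: "code r \<eta> H b y \<Longrightarrow> r \<in> {1, \<i>, -1, -\<i>}" "code r \<eta> H b y \<Longrightarrow> \<eta> \<in> {\<i>, -\<i>}"
  "code r \<eta> H b y \<Longrightarrow> H \<subseteq> {..<8}" "code r \<eta> H b y \<Longrightarrow> card H = 4" "code r \<eta> H b y \<Longrightarrow> b < 8"
  "code r \<eta> H b y \<Longrightarrow> b \<notin> H"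
  by (simp_all add: code_def)

lemma G_code_code:
  assumes "y \<in> X" "z \<in> X" and y: "code r \<eta> H b y" and z: "code r' \<eta>' H' b' z"
  shows "2 * G y z = r * cnj r' * ((\<Sum>i<8. sign \<eta> H b i * cnj (sign \<eta>' H' b' i))
    - (4 * \<eta> - 2) * cnj (4 * \<eta>' - 2) / 10)"
proof -
  have "(\<Sum>i<8. G y (e i) * cnj (G z (e i))) = r * cnj r' * (\<Sum>i<8. sign \<eta> H b i * cnj (sign \<eta>' H' b' i))"
    unfolding sum_distrib_left by (rule sum.cong) (simp_all add: code_G[OF y] code_G[OF z])
  then show ?thesis
    unfolding G_expand_total[OF assms(1,2)] code_total[OF y] code_total[OF z]
    by (simp add: algebra_simps)
qed

lemma sign_product_Ints:
  assumes "\<eta> \<in> {\<i>, -\<i>}" "\<eta>' \<in> {\<i>, -\<i>}"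
  shows "Re (\<Sum>i<8. sign \<eta> H b i * cnj (sign \<eta>' H' b' i)) \<in> \<int>"
    and "Im (\<Sum>i<8. sign \<eta> H b i * cnj (sign \<eta>' H' b' i)) \<in> \<int>"
proof -
  have "Re (sign \<eta> H b i * cnj (sign \<eta>' H' b' i)) \<in> \<int>" "Im (sign \<eta> H b i * cnj (sign \<eta>' H' b' i)) \<in> \<int>" for i
    using assms by (auto simp: sign_def)
  then show "Re (\<Sum>i<8. sign \<eta> H b i * cnj (sign \<eta>' H' b' i)) \<in> \<int>"
    "Im (\<Sum>i<8. sign \<eta> H b i * cnj (sign \<eta>' H' b' i)) \<in> \<int>"
    unfolding Re_sum Im_sum by (auto intro!: Ints_sum simp del: times_complex.sel)
qed

text \<open>Otherwise \<open>10 G y z\<close> would be a unit multiple of \<open>6 \<plusminus> 8 \<i>\<close> modulo 5.\<close>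

lemma code_chirality:
  assumes "y \<in> X" "z \<in> X" and y: "code r \<eta> H b y" and z: "code r' \<eta>' H' b' z"
  shows "\<eta> = \<eta>'"
proof (rule ccontr)
  assume ne: "\<eta> \<noteq> \<eta>'"
  define V where "V = (\<Sum>i<8. sign \<eta> H b i * cnj (sign \<eta>' H' b' i))"
  obtain m n :: int where V: "Re V = m" "Im V = n"
    using sign_product_Ints[OF code_D(2)[OF y] code_D(2)[OF z], of H b H' b'] by (auto simp: V_def elim!: Ints_cases)
  have g: "Re (G y z) \<in> \<int>" "Im (G y z) \<in> \<int>" using G_values[OF assms(1,2)] by auto
  define u where "u = r * cnj r'"
  have u: "u \<in> {1, \<i>, -1, -\<i>}" using code_D(1)[OF y] code_D(1)[OF z] by (auto simp: u_def)
  have "2 * G y z = u * (V - (4 * \<eta> - 2) * cnj (4 * \<eta>' - 2) / 10)"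
    using G_code_code[OF assms] by (simp add: V_def u_def)
  then have "2 * G y z * cnj u = u * cnj u * (V - (4 * \<eta> - 2) * cnj (4 * \<eta>' - 2) / 10)" by simp
  also have "u * cnj u = 1" using u by auto
  finally have e: "2 * (G y z * cnj u) = V - (4 * \<eta> - 2) * cnj (4 * \<eta>' - 2) / 10"
    by (simp only: mult.assoc mult_1_left)
  have "(4 * \<eta> - 2) * cnj (4 * \<eta>' - 2) = -12 - 16 * \<eta>"
    using ne code_D(2)[OF y] code_D(2)[OF z] by (auto simp: algebra_simps)
  then have "2 * Re (G y z * cnj u) = Re V + 12 / 10"
    using arg_cong[OF e, of Re] code_D(2)[OF y] by auto
  moreover have "Re (G y z * cnj u) \<in> \<int>" using g u by auto
  then obtain k :: int where "Re (G y z * cnj u) = k" by (rule Ints_cases)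
  ultimately have "2 * real_of_int k = real_of_int m + 12 / 10" using V by simp
  then have "real_of_int (10 * k) = real_of_int (5 * m + 6)" by simp
  then have "10 * k = 5 * m + 6" by (simp only: of_int_eq_iff)
  then show False by presburger
qed

text \<open>Equal sign vectors give |G y z| = (8 - 20 / 10) / 2 = 3, impossible for different
  elements of \<open>Y (e 0)\<close>.\<close>

lemma code_inject:
  assumes "y \<in> others" "z \<in> others" and y: "code r \<eta> H b y" and z: "code r' \<eta> H b z"
  shows "y = z"
proof (rule ccontr)
  assume "y \<noteq> z"
  then have G: "G y z \<in> {1, \<i>, -1, -\<i>}"
    using Y_unit[of "e 0" y z] others_D assms e_X[of 0] by simp
  have "sign \<eta> H b i * cnj (sign \<eta> H b i) = 1" for i
    using code_D(2)[OF y] by (auto simp: sign_def)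
  moreover have "(4 * \<eta> - 2) * cnj (4 * \<eta> - 2) = 20"
    using code_D(2)[OF y] by (auto simp: algebra_simps)
  ultimately have "G y z = r * cnj r' * 3"
    using G_code_code[OF others_D(1)[OF assms(1)] others_D(1)[OF assms(2)] y z] by simp
  then have "cmod (G y z) = cmod r * cmod r' * 3" by (simp add: norm_mult)
  then show False using G code_D(1)[OF y] code_D(1)[OF z] by auto
qed

text \<open>Compare Re V + Im V modulo 4. It is divisible by 4 because V = 2 + 2 q, where q has Re q
  + Im q odd. Computed from the signs it is twice \<open>card (H \<inter> H')\<close>, up to
  corrections at \<open>b\<close> and \<open>b'\<close> that amount to a multiple of 4.\<close>

lemma code_even:
  assumes yX: "y \<in> X" "z \<in> X" and y: "code r \<eta> H b y" and z: "code r' \<eta> H' b' z"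
  shows "even (card (H \<inter> H'))"
proof -
  define V where "V = (\<Sum>i<8. sign \<eta> H b i * cnj (sign \<eta> H' b' i))"
  define u where "u = r * cnj r'"
  have u: "u \<in> {1, \<i>, -1, -\<i>}" using code_D(1)[OF y] code_D(1)[OF z] by (auto simp: u_def)
  have "(4 * \<eta> - 2) * cnj (4 * \<eta> - 2) = 20"
    using code_D(2)[OF y] by (auto simp: algebra_simps)
  then have "2 * G y z = u * (V - 2)"
    using G_code_code[OF assms] by (simp add: V_def u_def)
  then have "2 * G y z * cnj u = u * cnj u * (V - 2)" by simp
  also have "u * cnj u = 1" using u by auto
  finally have V: "V = 2 + 2 * (G y z * cnj u)" by (simp add: algebra_simps)
  define q where "q = G y z * cnj u"
  have "q \<in> {3, 3 * \<i>, -3, -3 * \<i>, 1, \<i>, -1, -\<i>}"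
    unfolding q_def using G_values[OF yX] u by (elim insertE emptyE) (simp_all add: complex_eq_iff)
  then have "Re V + Im V \<in> {8, -4, 4, 0}" unfolding V q_def[symmetric] by auto
  then obtain k :: int where k: "Re V + Im V = real_of_int (4 * k)"
    using that[of 2] that[of "-1"] that[of 1] that[of 0] by auto
  define \<epsilon> where "\<epsilon> = Im \<eta>"
  have \<epsilon>: "\<epsilon> = 1 \<or> \<epsilon> = -1" using code_D(2)[OF y] by (auto simp: \<epsilon>_def)
  \<comment> \<open>\<open>g i\<close> is the sum of real and imaginary part of the
    \<open>i\<close>-th summand when the exceptional signs at \<open>b\<close> and \<open>b'\<close>
    are replaced by -1. Restoring one of them negates the summand.\<close>
  define g where "g i = 1 - (1 + \<epsilon>) * of_bool (i \<in> H) + (\<epsilon> - 1) * of_bool (i \<in> H') + 2 * of_bool (i \<in> H \<inter> H')" for i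
  have H: "H \<subseteq> {..<8}" "H' \<subseteq> {..<8}" "card H = 4" "card H' = 4" "b < 8" "b' < 8" "b \<notin> H" "b' \<notin> H'"
    using code_D[OF y] code_D[OF z] by auto
  have cnt: "(\<Sum>i<8. of_bool (i \<in> A)) = real (card A)" if "A \<subseteq> {..<8}" for A :: "nat set"
  proof -
    have "(\<Sum>i<8. of_bool (i \<in> A)) = (\<Sum>i\<in>A. 1 :: real)"
      using that by (intro sum.mono_neutral_cong_right) auto
    then show ?thesis by simp
  qed
  have HH: "H \<inter> H' \<subseteq> {..<8}" using H by auto
  have sg: "(\<Sum>i<8. g i) = 2 * real (card (H \<inter> H'))"
    unfolding g_def sum.distrib sum_subtractf sum_distrib_left[symmetric] cnt[OF H(1)] cnt[OF H(2)] cnt[OF HH]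
    using H by (simp add: algebra_simps)
  have "Re V + Im V = (\<Sum>i<8. Re (sign \<eta> H b i * cnj (sign \<eta> H' b' i)) + Im (sign \<eta> H b i * cnj (sign \<eta> H' b' i)))"
    unfolding V_def Re_sum Im_sum sum.distrib ..
  also have "\<dots> = (\<Sum>i<8. g i - (if i = b then (if b = b' then 0 else 2 * g b) else 0)
      - (if i = b' then (if b = b' then 0 else 2 * g b') else 0))"
  proof (rule sum.cong[OF refl])
    fix i
    have "\<eta> = \<i> \<or> \<eta> = -\<i>" using code_D(2)[OF y] by auto
    then show "Re (sign \<eta> H b i * cnj (sign \<eta> H' b' i)) + Im (sign \<eta> H b i * cnj (sign \<eta> H' b' i))
      = g i - (if i = b then (if b = b' then 0 else 2 * g b) else 0)
      - (if i = b' then (if b = b' then 0 else 2 * g b') else 0)"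
      using H(7,8) unfolding g_def sign_def \<epsilon>_def by (elim disjE) (auto split: if_splits)
  qed
  also have "\<dots> = 2 * real (card (H \<inter> H')) - (if b = b' then 0 else 2 * g b + 2 * g b')"
    using H by (simp add: sum_subtractf sg)
  finally have V2: "Re V + Im V = 2 * real (card (H \<inter> H')) - (if b = b' then 0 else 2 * g b + 2 * g b')" .
  have "g b = 1 \<or> g b = -1" "g b' = 1 \<or> g b' = -1" using \<epsilon> H by (auto simp: g_def)
  then have "(if b = b' then 0 else 2 * g b + 2 * g b') \<in> {0, 4, -4}" by auto
  then obtain m :: int where "(if b = b' then 0 else 2 * g b + 2 * g b') = real_of_int (4 * m)"
    using that[of 0] that[of 1] that[of "-1"] by auto
  then have "real_of_int (2 * int (card (H \<inter> H'))) = real_of_int (4 * k + 4 * m)"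
    using V2 k by simp
  then have "2 * int (card (H \<inter> H')) = 4 * k + 4 * m" by (simp only: of_int_eq_iff)
  then show ?thesis by presburger
qed

text \<open>A set \<open>H\<close> leaves four choices for \<open>b\<close>, and \<open>H\<close>
  with \<open>b\<close> determines the line, so 56 lines require at least 14 sets
  \<open>H\<close>.\<close>

lemma labelling_exists:
  obtains \<eta> and l :: "nat \<Rightarrow> nat" where "bij_betw l {..<8} {..<8}" "\<eta> \<in> {\<i>, -\<i>}"
    "\<And>y. y \<in> others \<Longrightarrow> \<exists>r H b. code r \<eta> H b y \<and> (\<forall>k<3. even (card {i \<in> H. bit (l i) k}))"
proof -
  obtain y0 where y0: "y0 \<in> others" using card_others by fastforce
  obtain r0 \<eta> H0 b0 where c0: "code r0 \<eta> H0 b0 y0" using code_exists[OF y0] .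
  have ex: "\<exists>r H b. code r \<eta> H b y" if y: "y \<in> others" for y
  proof -
    obtain r \<eta>' H b where c: "code r \<eta>' H b y" using code_exists[OF y] .
    then show ?thesis using code_chirality[OF others_D(1)[OF y0] others_D(1)[OF y] c0 c] by blast
  qed
  then obtain r H b where rHb: "\<And>y. y \<in> others \<Longrightarrow> code (r y) \<eta> (H y) (b y) y" by metis
  define \<H> where "\<H> = H ` others"
  have fo: "finite others" by (simp add: others_def)
  have four: "H' \<subseteq> {..<8} \<and> card H' = 4" if "H' \<in> \<H>" for H'
    using that rHb code_D(3,4) by (fastforce simp: \<H>_def)
  have "inj_on (\<lambda>y. (H y, b y)) others"
  proof (rule inj_onI)
    fix y z assume y: "y \<in> others" and z: "z \<in> others" and "(H y, b y) = (H z, b z)"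
    then show "y = z" using code_inject[OF y z rHb[OF y]] rHb[OF z] by simp
  qed
  moreover have "(\<lambda>y. (H y, b y)) ` others \<subseteq> (SIGMA H':\<H>. {..<8} - H')"
    using rHb code_D(5,6) by (fastforce simp: \<H>_def)
  moreover have "finite (SIGMA H':\<H>. {..<8} - H')" using fo by (auto simp: \<H>_def)
  ultimately have "card others \<le> card (SIGMA H':\<H>. {..<8} - H')" by (rule card_inj_on_le)
  also have "\<dots> = (\<Sum>H'\<in>\<H>. card ({..<8} - H'))" using fo by (simp add: \<H>_def)
  also have "\<dots> = (\<Sum>H'\<in>\<H>. 4)"
  proof (rule sum.cong[OF refl])
    fix H' assume "H' \<in> \<H>"
    then show "card ({..<8} - H') = 4" using four[of H'] finite_subset[of H' "{..<8}"] by (simp add: card_Diff_subset)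
  qed
  finally have "14 \<le> card \<H>" using card_others by simp
  moreover have "even (card (H1 \<inter> H2))" if "H1 \<in> \<H>" "H2 \<in> \<H>" for H1 H2
    using that code_even[OF others_D(1) others_D(1) rHb rHb] by (auto simp: \<H>_def)
  ultimately obtain l :: "nat \<Rightarrow> nat" where l: "bij_betw l {..<8} {..<8}"
    "\<And>H k. H \<in> \<H> \<Longrightarrow> k < 3 \<Longrightarrow> even (card {i \<in> H. bit (l i) k})"
    using cube_labelling[of \<H>, OF four] by metis
  show thesis
  proof (rule that)
    show "bij_betw l {..<8} {..<8}" by (rule l(1))
    show "\<eta> \<in> {\<i>, -\<i>}" by (rule code_D(2)[OF c0])
    fix y assume y: "y \<in> others"
    then have "H y \<in> \<H>" by (simp add: \<H>_def)
    then show "\<exists>r H b. code r \<eta> H b y \<and> (\<forall>k<3. even (card {i \<in> H. bit (l i) k}))"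
      using rHb[OF y] l(2) by blast
  qed
qed

end

section \<open>Coordinates in Hoggar's configuration\<close>

lemma sylvester_eq:
  "sylvester b y = (-1) ^ (of_bool (bit b 0 \<and> bit y 0) + of_bool (bit b 1 \<and> bit y 1) + of_bool (bit b 2 \<and> bit y 2))"
proof -
  have "{k. k < 3 \<and> bit b k \<and> bit y k} = (\<Union>k\<in>{0, 1, 2}. if bit b k \<and> bit y k then {k} else {})"
    by auto
  also have "card \<dots> = of_bool (bit b 0 \<and> bit y 0) + of_bool (bit b 1 \<and> bit y 1) + of_bool (bit b 2 \<and> bit y 2)"
    by simp
  finally show ?thesis by (simp add: sylvester_def)
qed

lemma sylvester_values: "sylvester b y = 1 \<or> sylvester b y = -1"
  unfolding sylvester_def using neg_one_even_power neg_one_odd_power by blast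

lemma cnj_sylvester [simp]: "cnj (sylvester b y) = sylvester b y"
  by (simp add: sylvester_def)

lemma sylvester_square [simp]: "sylvester b y * sylvester b y = 1"
  using sylvester_values[of b y] by auto

lemma sylvester_0 [simp]: "sylvester 0 y = 1" "sylvester b 0 = 1"
  by (simp_all add: sylvester_def)

lemma sylvester_commute: "sylvester b y = sylvester y b"
  by (simp add: sylvester_def conj_commute)

definition bit_sign :: "nat \<Rightarrow> nat \<Rightarrow> nat \<Rightarrow> complex" where
  "bit_sign k b y = (if bit b k \<and> bit y k then -1 else 1)"

lemma sylvester_bit_sign: "sylvester b y = bit_sign 0 b y * bit_sign 1 b y * bit_sign 2 b y"
  by (simp add: sylvester_eq bit_sign_def)

lemma bit_sign_numeral [simp]:
  "bit_sign 0 0 y = 1" "bit_sign k b 0 = 1"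
  by (simp_all add: bit_sign_def)

lemma bits_less_8:
  "bit (1 :: nat) 0" "\<not> bit (1 :: nat) 1" "\<not> bit (1 :: nat) 2"
  "\<not> bit (2 :: nat) 0" "bit (2 :: nat) 1" "\<not> bit (2 :: nat) 2"
  "bit (3 :: nat) 0" "bit (3 :: nat) 1" "\<not> bit (3 :: nat) 2"
  "\<not> bit (4 :: nat) 0" "\<not> bit (4 :: nat) 1" "bit (4 :: nat) 2"
  "bit (5 :: nat) 0" "\<not> bit (5 :: nat) 1" "bit (5 :: nat) 2"
  "\<not> bit (6 :: nat) 0" "bit (6 :: nat) 1" "bit (6 :: nat) 2"
  "bit (7 :: nat) 0" "bit (7 :: nat) 1" "bit (7 :: nat) 2"
  by (simp_all add: bit_iff_odd)

lemma sylvester_orthogonal: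
  assumes "j < 8" "k < 8"
  shows "(\<Sum>y<8. sylvester j y * sylvester k y) = 8 * of_bool (j = k)"
proof (cases "j = k")
  case False
  have "\<exists>i\<in>{0, 1, 2}. bit j i \<noteq> bit k i"
  proof -
    have "\<forall>j<8. \<forall>k<8. (bit j 0 \<longleftrightarrow> bit k 0) \<and> (bit j 1 \<longleftrightarrow> bit k 1) \<and> (bit j 2 \<longleftrightarrow> bit k (2 :: nat)) \<longrightarrow> j = (k :: nat)"
      unfolding all_less_8 by (simp add: bits_less_8 del: One_nat_def)
    then show ?thesis using False assms by blast
  qed
  then have "bit j 0 \<noteq> bit k 0 \<or> bit j 1 \<noteq> bit k 1 \<or> bit j 2 \<noteq> bit k 2" by blast
  then show ?thesis
    unfolding sum_less_8 sylvester_bit_sign bit_sign_def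
    using False by (cases "bit j 0"; cases "bit j 1"; cases "bit j 2"; cases "bit k 0"; cases "bit k 1"; cases "bit k 2")
      (simp_all add: bits_less_8 del: One_nat_def)
qed simp

lemma sylvester_orthogonal':
  "j < 8 \<Longrightarrow> k < 8 \<Longrightarrow> (\<Sum>y<8. sylvester y j * sylvester y k) = 8 * of_bool (j = k)"
  using sylvester_orthogonal[of j k] by (simp add: sylvester_commute[of _ j] sylvester_commute[of _ k])

lemma parity_4:
  "even (of_bool p + of_bool q + of_bool r + of_bool t :: nat) \<longleftrightarrow> (p \<longleftrightarrow> (q \<longleftrightarrow> (r \<longleftrightarrow> t)))"
  by (cases p; cases q; cases r; cases t) simp_all

lemma parity_8:
  "even (of_bool p + of_bool q + of_bool r + of_bool t + of_bool p' + of_bool q' + of_bool r' + of_bool t' :: nat)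
    \<longleftrightarrow> (p \<longleftrightarrow> (q \<longleftrightarrow> (r \<longleftrightarrow> (t \<longleftrightarrow> (p' \<longleftrightarrow> (q' \<longleftrightarrow> (r' \<longleftrightarrow> t')))))))"
  unfolding add.assoc[of _ "of_bool p'"] by simp

text \<open>The condition is that \<open>S\<close> is orthogonal to the first order Reed--Muller code, which is self-dual.\<close>

lemma affine_plane:
  assumes S: "S \<subseteq> {..<8}" "card S = 4" and ev: "\<And>k. k < 3 \<Longrightarrow> even (card {j \<in> S. bit j k})"
    and c: "c < 8" "c \<notin> S"
  obtains a where "0 < a" "a < 8" "\<And>j. j < 8 \<Longrightarrow> sylvester j a = (if j \<in> S then - 1 else 1) * sylvester c a"
proof -
  have cnt: "(\<Sum>j<8. of_bool (j \<in> A)) = card A" if "A \<subseteq> {..<8}" for A :: "nat set"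
  proof -
    have "(\<Sum>j<8. of_bool (j \<in> A)) = (\<Sum>j\<in>A. 1 :: nat)"
      using that by (intro sum.mono_neutral_cong_right) auto
    then show ?thesis by simp
  qed
  have e: "even (\<Sum>j<8. of_bool (j \<in> S \<and> bit j k) :: nat)" if "k < 3" for k
  proof -
    have "{j \<in> S. bit j k} \<subseteq> {..<8}" using S(1) by blast
    from cnt[OF this] show ?thesis using ev[OF that] by simp
  qed
  have e0: "even (\<Sum>j<8. of_bool (j \<in> S) :: nat)" using cnt[OF S(1)] S by simp
  define s where "s j \<longleftrightarrow> j \<in> S" for j
  have "s 1 \<longleftrightarrow> (s 3 \<longleftrightarrow> (s 5 \<longleftrightarrow> s 7))" "s 2 \<longleftrightarrow> (s 3 \<longleftrightarrow> (s 6 \<longleftrightarrow> s 7))"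
    "s 4 \<longleftrightarrow> (s 5 \<longleftrightarrow> (s 6 \<longleftrightarrow> s 7))"
    "s 0 \<longleftrightarrow> (s 1 \<longleftrightarrow> (s 2 \<longleftrightarrow> (s 3 \<longleftrightarrow> (s 4 \<longleftrightarrow> (s 5 \<longleftrightarrow> (s 6 \<longleftrightarrow> s 7))))))"
    using e[of 0] e[of 1] e[of 2] e0 unfolding sum_less_8 s_def[symmetric]
    by (simp_all add: bits_less_8 parity_4 parity_8 del: One_nat_def even_add)
  then have lin: "s 3 \<longleftrightarrow> (s 0 \<longleftrightarrow> (s 1 \<longleftrightarrow> s 2))" "s 5 \<longleftrightarrow> (s 0 \<longleftrightarrow> (s 1 \<longleftrightarrow> s 4))"
    "s 6 \<longleftrightarrow> (s 0 \<longleftrightarrow> (s 2 \<longleftrightarrow> s 4))" "s 7 \<longleftrightarrow> (s 1 \<longleftrightarrow> (s 2 \<longleftrightarrow> s 4))"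
    by (cases "s 0"; cases "s 1"; cases "s 2"; cases "s 4"; simp only: simp_thms; blast)+
  \<comment> \<open>\<open>lin\<close> says that \<open>s\<close> is an affine function of the bits.
    Bit \<open>k\<close> of \<open>a\<close> tells whether it changes between 0 and 2^k.\<close>
  define a :: nat where "a = of_bool (s 0 \<noteq> s 1) + 2 * of_bool (s 0 \<noteq> s 2) + 4 * of_bool (s 0 \<noteq> s 4)"
  have ba: "bit a 0 \<longleftrightarrow> s 0 \<noteq> s 1" "bit a 1 \<longleftrightarrow> s 0 \<noteq> s 2" "bit a 2 \<longleftrightarrow> s 0 \<noteq> s 4"
    by (cases "s 0 = s 1"; cases "s 0 = s 2"; cases "s 0 = s 4"; simp add: a_def bit_iff_odd)+
  have j: "\<forall>j<8. sylvester j a = (if s j = s 0 then 1 else -1)"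
    unfolding all_less_8 sylvester_bit_sign bit_sign_def ba lin
    by (cases "s 0"; cases "s 1"; cases "s 2"; cases "s 4") (simp_all add: bits_less_8 del: One_nat_def)
  have "a \<noteq> 0"
  proof
    assume "a = 0"
    then have "\<forall>j<8. s j = s 0" using j by (metis sylvester_0(2) one_neq_neg_one)
    then have "S = {} \<or> S = {..<8}" using S(1) by (auto simp: s_def)
    then show False using S(2) by auto
  qed
  moreover have "a < 8" by (simp add: a_def of_bool_def)
  moreover have "sylvester i a = (if i \<in> S then - 1 else 1) * sylvester c a" if "i < 8" for i
    using j that c by (auto simp: s_def split: if_splits)
  ultimately show thesis using that by blast
qed

text \<open>The bound turns an injection from the 256 points of \<open>X\<close> into a
  bijection.\<close>

lemma finite_hoggar_points: "finite hoggar_points" and card_hoggar_points: "card hoggar_points \<le> 256"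
proof -
  define f where "f = (\<lambda>(c :: complex, a, b). c \<cdot>\<^sub>v hoggar_vector a b)"
  have "hoggar_points \<subseteq> f ` ({1, \<i>, -1, -\<i>} \<times> {..<8} \<times> {..<8})"
  proof
    fix v assume "v \<in> hoggar_points"
    then obtain c w where v: "v = c \<cdot>\<^sub>v w" "c \<in> {1, \<i>, -1, -\<i>}" "w \<in> hoggar_vectors"
      unfolding hoggar_points_def by blast
    from v(3) obtain a b where "w = hoggar_vector a b" "a < 8" "b < 8"
      unfolding hoggar_vectors_def by blast
    with v have "v = f (c, a, b)" "(c, a, b) \<in> {1, \<i>, -1, -\<i>} \<times> {..<8} \<times> {..<8}"
      by (simp_all add: f_def)
    then show "v \<in> f ` ({1, \<i>, -1, -\<i>} \<times> {..<8} \<times> {..<8})" by blast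
  qed
  moreover have "card ({1, \<i>, -1, -\<i>} \<times> {..<8 :: nat} \<times> {..<8 :: nat}) = 256"
    by (simp add: card_cartesian_product card_insert_if complex_eq_iff)
  moreover have "finite ({1, \<i>, -1, -\<i>} \<times> {..<8 :: nat} \<times> {..<8 :: nat})" by simp
  ultimately show "finite hoggar_points" "card hoggar_points \<le> 256"
    by (meson finite_surj, metis surj_card_le)
qed

text \<open>The modified coordinate of \<open>hoggar_vector 0 b\<close>; these eight vectors will be
  the images of the basis.\<close>

definition weight :: "nat \<Rightarrow> complex" where
  "weight y = (if y = 0 then -1 + 2 * \<i> else 1)"

text \<open>The entry of squared modulus 5 at 0 adds 4 to the orthogonality relation. Scaled by 3 /
  12 the result is the Gram matrix of the basis \<open>e\<close>.\<close>

lemma frame_gram: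
  assumes "j < 8" "k < 8"
  shows "(\<Sum>y<8. (sylvester j y * weight y) * cnj (sylvester k y * weight y)) = 8 * of_bool (j = k) + 4"
proof -
  have "(\<Sum>y<8. (sylvester j y * weight y) * cnj (sylvester k y * weight y))
    = (\<Sum>y<8. sylvester j y * sylvester k y + (if y = 0 then 4 else 0))"
    by (rule sum.cong) (auto simp: weight_def algebra_simps)
  then show ?thesis using sylvester_orthogonal[OF assms] by (simp add: sum.distrib)
qed

section \<open>The isometry onto Hoggar's vectors\<close>

context hoggar_basis
begin

text \<open>Up to the factor sqrt 12, the linear map that sends \<open>e i\<close> to
  \<open>hoggar_vector 0 (l i)\<close>.\<close>

definition image_coord :: "(nat \<Rightarrow> nat) \<Rightarrow> 'a \<Rightarrow> nat \<Rightarrow> complex" where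
  "image_coord l x y = (\<Sum>i<8. coord x i * (sylvester (l i) y * weight y))"

definition image :: "(nat \<Rightarrow> nat) \<Rightarrow> 'a \<Rightarrow> complex vec" where
  "image l x = vec 8 (\<lambda>y. image_coord l x y / complex_of_real (sqrt 12))"

lemma coord_rot: "x \<in> X \<Longrightarrow> i < 8 \<Longrightarrow> coord (rot x) i = \<i> * coord x i"
  using e_X by (simp add: coord_def total_def sum_distrib_left[symmetric] algebra_simps)

lemma image_rot: "x \<in> X \<Longrightarrow> image l (rot x) = \<i> \<cdot>\<^sub>v image l x"
  by (auto simp: image_def image_coord_def coord_rot sum_distrib_left mult.assoc)

text \<open>A linear map that preserves the Gram matrix of a basis preserves all inner products; the
  factor 3 is the scale of \<open>G\<close>.\<close>

lemma image_inner:
  assumes l: "bij_betw l {..<8} {..<8}" and "x \<in> X" "z \<in> X"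
  shows "image l x \<bullet>c image l z = G x z / 3"
proof -
  have l8: "l i < 8" if "i < 8" for i using l that by (auto simp: bij_betw_def)
  have linj: "l i = l j \<longleftrightarrow> i = j" if "i < 8" "j < 8" for i j
    using l that by (auto simp: bij_betw_def inj_on_def)
  have "image l x \<bullet>c image l z = (\<Sum>y<8. image_coord l x y * cnj (image_coord l z y)) / 12"
    unfolding sum_divide_distrib
    by (simp add: image_def scalar_prod_def lessThan_atLeast0 flip: of_real_mult)
  also have "(\<Sum>y<8. image_coord l x y * cnj (image_coord l z y))
    = (\<Sum>y<8. \<Sum>i<8. \<Sum>k<8. coord x i * cnj (coord z k) *
        ((sylvester (l i) y * weight y) * cnj (sylvester (l k) y * weight y)))"
    unfolding image_coord_def cnj_sum sum_product by (intro sum.cong refl) simp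
  also have "\<dots> = (\<Sum>i<8. \<Sum>y<8. \<Sum>k<8. coord x i * cnj (coord z k) *
        ((sylvester (l i) y * weight y) * cnj (sylvester (l k) y * weight y)))"
    by (rule sum.swap)
  also have "\<dots> = (\<Sum>i<8. \<Sum>k<8. \<Sum>y<8. coord x i * cnj (coord z k) *
        ((sylvester (l i) y * weight y) * cnj (sylvester (l k) y * weight y)))"
    by (rule sum.cong[OF refl], rule sum.swap)
  also have "\<dots> = (\<Sum>i<8. \<Sum>k<8. coord x i * cnj (coord z k) * (8 * of_bool (i = k) + 4))"
    unfolding sum_distrib_left[symmetric]
    by (intro sum.cong refl) (simp only: frame_gram[OF l8 l8] lessThan_iff linj)
  also have "\<dots> = (\<Sum>i<8. \<Sum>k<8. (if k = i then 8 * (coord x i * cnj (coord z k)) else 0)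
      + 4 * (coord x i * cnj (coord z k)))"
    by (intro sum.cong refl) (auto simp: algebra_simps)
  also have "\<dots> = 8 * (\<Sum>i<8. coord x i * cnj (coord z i)) + 4 * (\<Sum>i<8. \<Sum>k<8. coord x i * cnj (coord z k))"
    by (simp add: sum.distrib sum_distrib_left)
  also have "(\<Sum>i<8. \<Sum>k<8. coord x i * cnj (coord z k)) = (\<Sum>i<8. coord x i * cnj (total z / 10))"
    unfolding sum_coord[of z, symmetric] cnj_sum sum_distrib_left ..
  finally have 1: "image l x \<bullet>c image l z
    = (8 * (\<Sum>i<8. coord x i * cnj (coord z i)) + 4 * (\<Sum>i<8. coord x i * cnj (total z / 10))) / 12" .
  have "4 * G x z = (\<Sum>i<8. 8 * (coord x i * cnj (coord z i)) + 4 * (coord x i * cnj (total z / 10)))"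
    unfolding G_expand[OF assms(2,3)] sum_distrib_left
    by (rule sum.cong) (auto simp: coord_def[of z] field_simps)
  also have "\<dots> = 8 * (\<Sum>i<8. coord x i * cnj (coord z i)) + 4 * (\<Sum>i<8. coord x i * cnj (total z / 10))"
    by (simp add: sum.distrib sum_distrib_left)
  finally have "8 * (\<Sum>i<8. coord x i * cnj (coord z i)) + 4 * (\<Sum>i<8. coord x i * cnj (total z / 10)) = 4 * G x z"
    by (rule sym)
  then show ?thesis unfolding 1 by (simp only:) simp
qed

lemma image_basis:
  assumes "bij_betw l {..<8} {..<8}" "j < 8"
  shows "image l (e j) = hoggar_vector 0 (l j)"
proof -
  have "total (e j) = 10"
    unfolding total_def using assms(2) by (simp add: G_e_e sum.distrib sum_distrib_left[symmetric] of_bool_def)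
  then have c: "coord (e j) i = of_bool (i = j)" if "i < 8" for i
    using that assms(2) by (simp add: coord_def G_e_e)
  have "image_coord l (e j) y = sylvester (l j) y * weight y" for y
  proof -
    have "image_coord l (e j) y = (\<Sum>i<8. if i = j then sylvester (l i) y * weight y else 0)"
      unfolding image_coord_def by (rule sum.cong) (auto simp: c)
    then show ?thesis using assms(2) by simp
  qed
  then show ?thesis by (auto simp: image_def hoggar_vector_def weight_def)
qed

lemma image_code:
  assumes l: "bij_betw l {..<8} {..<8}" and code: "code r (-\<i>) H b y"
    and ev: "\<forall>k<3. even (card {i \<in> H. bit (l i) k})"
  obtains a where "a < 8" "image l y = r \<cdot>\<^sub>v hoggar_vector a (l b)"
proof -
  note H = code_D[OF code]
  have l8: "l i < 8" if "i < 8" for i using l that by (auto simp: bij_betw_def)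
  have inj: "inj_on l {..<8}" using l by (simp add: bij_betw_def)
  have injH: "inj_on l A" if "A \<subseteq> H" for A using inj_on_subset[OF inj] H(3) that by blast
  have "l ` H \<subseteq> {..<8}" "card (l ` H) = 4" "l b < 8" "l b \<notin> l ` H"
    using H l8 card_image[OF injH[of H]] inj_on_image_mem_iff[OF inj, of b H] by auto
  moreover have "even (card {j \<in> l ` H. bit j k})" if "k < 3" for k
  proof -
    have "{j \<in> l ` H. bit j k} = l ` {i \<in> H. bit (l i) k}" by auto
    then have "card {j \<in> l ` H. bit j k} = card {i \<in> H. bit (l i) k}"
      using card_image[OF injH, of "{i \<in> H. bit (l i) k}"] by auto
    then show ?thesis using ev that by simp
  qed
  ultimately obtain a where a: "0 < a" "a < 8"
    "\<And>j. j < 8 \<Longrightarrow> sylvester j a = (if j \<in> l ` H then - 1 else 1) * sylvester (l b) a"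
    using affine_plane[of "l ` H" "l b"] by metis
  define ch where "ch = sylvester (l b)"
  have ch: "ch a * ch a = 1" by (simp add: ch_def)
  have sg: "sign (-\<i>) H b i = - (1 + \<i>) / 2 - (1 - \<i>) / 2 * (ch a * sylvester (l i) a) + 2 * of_bool (i = b)"
    if i: "i < 8" for i
  proof -
    have "l i \<in> l ` H \<longleftrightarrow> i \<in> H" using inj_on_image_mem_iff[OF inj, of i H] i H(3) by auto
    then have "ch a * sylvester (l i) a = (if i \<in> H then -1 else 1) * (ch a * ch a)"
      using a(3)[OF l8[OF i]] by (simp add: ch_def)
    then show ?thesis using H(6) unfolding ch by (auto simp: sign_def complex_eq_iff)
  qed
  have re: "(\<Sum>i<8. f (l i)) = (\<Sum>j<8. f j)" for f :: "nat \<Rightarrow> complex"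
    by (rule sum.reindex_bij_betw[OF l])
  have s0: "(\<Sum>i<8. sylvester (l i) t) = 8 * of_bool (t = 0)" if "t < 8" for t
    using re[of "\<lambda>j. sylvester j t"] sylvester_orthogonal'[of t 0] that by simp
  have sa: "(\<Sum>i<8. sylvester (l i) a * sylvester (l i) t) = 8 * of_bool (t = a)" if "t < 8" for t
    using re[of "\<lambda>j. sylvester j a * sylvester j t"] sylvester_orthogonal'[of a t] that a by auto
  have "image_coord l y t = r * (ch t * (if t = a then -1 + 2 * \<i> else 1))" if t: "t < 8" for t
  proof -
    \<comment> \<open>The term (1 + 2 \<i>) / 5 is - total y / (10 r), by \<open>code_total\<close>
      with chirality -\<i>.\<close>
    have "image_coord l y t = (\<Sum>i<8. r * weight t / 2 *
        ((1 + 2 * \<i>) / 5 - (1 + \<i>) / 2) * sylvester (l i) t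
        - r * weight t / 2 * (1 - \<i>) / 2 * ch a * (sylvester (l i) a * sylvester (l i) t)
        + r * weight t * (if i = b then sylvester (l i) t else 0))"
      unfolding image_coord_def
    proof (rule sum.cong[OF refl])
      fix i :: nat assume "i \<in> {..<8}"
      then have i: "i < 8" by simp
      show "coord y i * (sylvester (l i) t * weight t) = r * weight t / 2 *
        ((1 + 2 * \<i>) / 5 - (1 + \<i>) / 2) * sylvester (l i) t
        - r * weight t / 2 * (1 - \<i>) / 2 * ch a * (sylvester (l i) a * sylvester (l i) t)
        + r * weight t * (if i = b then sylvester (l i) t else 0)"
        unfolding coord_def code_total[OF code] code_G[OF code i] sg[OF i]
        by (cases "i = b") (simp_all add: field_simps)
    qed
    also have "\<dots> = r * weight t / 2 * ((1 + 2 * \<i>) / 5 - (1 + \<i>) / 2) * (8 * of_bool (t = 0))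
        - r * weight t / 2 * (1 - \<i>) / 2 * ch a * (8 * of_bool (t = a)) + r * weight t * ch t"
      unfolding sum.distrib sum_subtractf sum_distrib_left[symmetric] s0[OF t] sa[OF t]
      using H(5) by (simp add: ch_def)
    also have "\<dots> = r * (ch t * (if t = a then -1 + 2 * \<i> else 1))"
    proof (cases "t = 0")
      case True
      then show ?thesis using a by (simp add: weight_def ch_def field_simps)
    next
      case False
      then show ?thesis using a by (auto simp: weight_def field_simps)
    qed
    finally show ?thesis .
  qed
  then have "image l y = r \<cdot>\<^sub>v hoggar_vector a (l b)"
    by (auto simp: image_def hoggar_vector_def ch_def)
  then show thesis using that a by blast
qed

lemma rot_into_Y:
  assumes "x \<in> X" "z \<in> X"
  obtains k where "k < 4" "(rot ^^ k) z \<in> insert x (Y x)"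
proof -
  have c: "\<exists>k<4. (rot ^^ k) z \<in> insert x (Y x)" if "(-\<i>) ^ k * G x z \<in> {1, 3}" "k < 4" for k
  proof -
    have "G x ((rot ^^ k) z) \<in> {1, 3}" "(rot ^^ k) z \<in> X" using rot_power assms that by auto
    then have "(rot ^^ k) z \<in> insert x (Y x)"
      using G_eq_3_iff assms by (auto simp: Y_def)
    then show ?thesis using that by blast
  qed
  have "\<exists>k<4. (-\<i>) ^ k * G x z \<in> {1, 3}"
  proof -
    have "G x z \<in> {1, 3} \<or> -\<i> * G x z \<in> {1, 3} \<or> - G x z \<in> {1, 3} \<or> \<i> * G x z \<in> {1, 3}"
      using G_values[OF assms] by (auto simp: complex_eq_iff)
    then have "(-\<i>) ^ 0 * G x z \<in> {1, 3} \<or> (-\<i>) ^ 1 * G x z \<in> {1, 3} \<or> (-\<i>) ^ 2 * G x z \<in> {1, 3}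
      \<or> (-\<i>) ^ 3 * G x z \<in> {1, 3}" by (simp add: power3_eq_cube)
    moreover have "(0 :: nat) < 4" "(1 :: nat) < 4" "(2 :: nat) < 4" "(3 :: nat) < 4" by auto
    ultimately show ?thesis by blast
  qed
  then show thesis using c that by blast
qed

text \<open>Representatives are mapped to Hoggar points, and so are their rotations, because the map
  commutes with multiplication by \<i>. Surjectivity follows by counting.\<close>

lemma image_bij:
  assumes l: "bij_betw l {..<8} {..<8}"
    and codes: "\<And>y. y \<in> others \<Longrightarrow> \<exists>r H b. code r (-\<i>) H b y \<and> (\<forall>k<3. even (card {i \<in> H. bit (l i) k}))"
  shows "bij_betw (image l) X hoggar_points"
proof -
  have l8: "l i < 8" if "i < 8" for i using l that by (auto simp: bij_betw_def)
  have pt: "c \<cdot>\<^sub>v hoggar_vector a b \<in> hoggar_points" if "c \<in> {1, \<i>, -1, -\<i>}" "a < 8" "b < 8" for a b c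
    unfolding hoggar_points_def hoggar_vectors_def using that by blast
  have Y: "image l y \<in> hoggar_points" if y: "y \<in> insert (e 0) (Y (e 0))" for y
  proof (cases "y \<in> others")
    case True
    then obtain r H b where c: "code r (-\<i>) H b y" "\<forall>k<3. even (card {i \<in> H. bit (l i) k})"
      using codes by blast
    obtain a where a: "a < 8" "image l y = r \<cdot>\<^sub>v hoggar_vector a (l b)"
      using image_code[OF l c] .
    then show ?thesis using pt[OF code_D(1)[OF c(1)] a(1) l8[OF code_D(5)[OF c(1)]]] by simp
  next
    case False
    then obtain j where "j < 8" "y = e j"
    proof (cases "y = e 0")
      case True
      then show ?thesis using that[of 0] by simp
    next
      case False
      then have "y \<in> e ` {..<8}" using y \<open>y \<notin> others\<close> by (auto simp: others_def)
      then show ?thesis using that by auto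
    qed
    then show ?thesis using image_basis[OF l] pt[of 1 0 "l j"] l8 by simp
  qed
  have mult: "\<i> \<cdot>\<^sub>v v \<in> hoggar_points" if v0: "v \<in> hoggar_points" for v
  proof -
    obtain c w where v: "v = c \<cdot>\<^sub>v w" "c \<in> {1, \<i>, -1, -\<i>}" "w \<in> hoggar_vectors"
      using v0 unfolding hoggar_points_def by blast
    have "\<i> * c \<in> {1, \<i>, -1, -\<i>}" using v(2) by auto
    moreover have "\<i> \<cdot>\<^sub>v v = (\<i> * c) \<cdot>\<^sub>v w" unfolding v(1) by (simp add: smult_smult_assoc)
    ultimately show ?thesis using v(3) unfolding hoggar_points_def by blast
  qed
  have unrot: "image l z \<in> hoggar_points" if z: "z \<in> X" and iz: "image l (rot z) \<in> hoggar_points" for z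
  proof -
    have "\<i> \<cdot>\<^sub>v (\<i> \<cdot>\<^sub>v (\<i> \<cdot>\<^sub>v image l (rot z))) \<in> hoggar_points" using mult iz by blast
    also have "\<i> \<cdot>\<^sub>v (\<i> \<cdot>\<^sub>v (\<i> \<cdot>\<^sub>v image l (rot z))) = image l z"
      unfolding image_rot[OF z] by (simp add: smult_smult_assoc)
    finally show ?thesis .
  qed
  have unrots: "image l ((rot ^^ k) z) \<in> hoggar_points \<Longrightarrow> image l z \<in> hoggar_points" if "z \<in> X" for k z
    using that
  proof (induction k)
    case (Suc k)
    then show ?case using unrot[OF rot_power(1)[OF Suc.prems(2)], of k] by simp
  qed simp
  have sub: "image l ` X \<subseteq> hoggar_points"
  proof
    fix v assume "v \<in> image l ` X"
    then obtain z where z: "z \<in> X" "v = image l z" by blast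
    obtain k where "(rot ^^ k) z \<in> insert (e 0) (Y (e 0))"
      using rot_into_Y[OF e_X[of 0] z(1)] by auto
    then show "v \<in> hoggar_points" using Y unrots z by blast
  qed
  have inj: "inj_on (image l) X"
  proof (rule inj_onI)
    fix x y assume xy: "x \<in> X" "y \<in> X" "image l x = image l y"
    then have "G x y / 3 = G y y / 3" using image_inner[OF l] by metis
    then show "x = y" using G_eq_3_iff[OF xy(1,2)] xy by simp
  qed
  have "image l ` X = hoggar_points"
    using card_seteq[OF finite_hoggar_points sub] card_hoggar_points card_image[OF inj] X_card by simp
  with inj show ?thesis by (simp add: bij_betw_def)
qed

end

context hoggar_gram
begin

text \<open>The alternative is the chirality of the codes.\<close>

theorem hoggar_unique:
  assumes "X \<noteq> {}"
  obtains f where "bij_betw f X hoggar_points"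
    "(\<forall>x\<in>X. \<forall>y\<in>X. f x \<bullet>c f y = G x y / 3) \<or> (\<forall>x\<in>X. \<forall>y\<in>X. f x \<bullet>c f y = cnj (G x y) / 3)"
proof -
  obtain x where "x \<in> X" using assms by blast
  then obtain xs where xs: "length xs = 8" "set xs \<subseteq> X" "sorted_wrt (\<lambda>y z. G y z = 1) xs"
    by (rule clique_exists)
  have X: "xs ! i \<in> X" if "i < 8" for i using that xs nth_mem by fastforce
  have lt: "G (xs ! i) (xs ! j) = 1" if "i < j" "j < 8" for i j
    using xs that by (simp add: sorted_wrt_iff_nth_less)
  interpret b: hoggar_basis X G "nth xs"
  proof
    fix i j :: nat assume "i < 8" "j < 8" "i \<noteq> j"
    then show "G (xs ! i) (xs ! j) = 1"
      using lt[of i j] lt[of j i] hermitian[OF X X, of j i] by (cases "i < j") auto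
  qed (rule X)
  obtain \<eta> l where l: "bij_betw l {..<8} {..<8 :: nat}" and \<eta>: "\<eta> \<in> {\<i>, -\<i>}"
    and codes: "\<And>y. y \<in> b.others \<Longrightarrow> \<exists>r H c. b.code r \<eta> H c y \<and> (\<forall>k<3. even (card {i \<in> H. bit (l i) k}))"
    by (rule b.labelling_exists, rule that, assumption, assumption, blast)
  show thesis
  proof (cases "\<eta> = -\<i>")
    case True
    show thesis
    proof (rule that)
      show "bij_betw (b.image l) X hoggar_points" by (rule b.image_bij[OF l codes[unfolded True]])
      show "(\<forall>x\<in>X. \<forall>y\<in>X. b.image l x \<bullet>c b.image l y = G x y / 3)
        \<or> (\<forall>x\<in>X. \<forall>y\<in>X. b.image l x \<bullet>c b.image l y = cnj (G x y) / 3)"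
        by (intro disjI1 ballI) (rule b.image_inner[OF l])
    qed
  next
    case False
    then have i: "\<eta> = \<i>" using \<eta> by simp
    \<comment> \<open>The eight vectors remain a basis of the required kind because their inner
      products are real. Conjugating a code changes \<open>r\<close> and \<open>\<eta>\<close> but
      neither \<open>H\<close> nor \<open>b\<close>.\<close>
    interpret c: hoggar_gram X "\<lambda>x y. cnj (G x y)" by (rule conjugate_gram)
    interpret c: hoggar_basis X "\<lambda>x y. cnj (G x y)" "nth xs"
      by unfold_locales (use X b.e_e in simp_all)
    have "c.Y = Y" unfolding c.Y_def Y_def by (intro ext Collect_cong) (simp add: complex_eq_iff)
    then have oth: "c.others = b.others" unfolding c.others_def b.others_def by simp
    have "\<exists>r H d. c.code r (-\<i>) H d y \<and> (\<forall>k<3. even (card {i \<in> H. bit (l i) k}))" if "y \<in> c.others" for y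
    proof -
      obtain r H d where *: "b.code r \<i> H d y" "\<forall>k<3. even (card {i \<in> H. bit (l i) k})"
        using codes[of y] \<open>y \<in> c.others\<close> unfolding oth i by blast
      have "c.code (cnj r) (-\<i>) H d y"
        using *(1) unfolding c.code_def b.code_def by auto
      then show ?thesis using *(2) by blast
    qed
    note codes' = this
    show thesis
    proof (rule that)
      show "bij_betw (c.image l) X hoggar_points" by (rule c.image_bij[OF l codes'])
      show "(\<forall>x\<in>X. \<forall>y\<in>X. c.image l x \<bullet>c c.image l y = G x y / 3)
        \<or> (\<forall>x\<in>X. \<forall>y\<in>X. c.image l x \<bullet>c c.image l y = cnj (G x y) / 3)"
        by (intro disjI2 ballI) (rule c.image_inner[OF l])
    qed
  qed
qed

end

section \<open>The Bose--Mesner algebra\<close>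

lemma matrix_product_assoc:
  "matrix_product X (matrix_product X L M) N = matrix_product X L (matrix_product X M N)"
proof (intro ext)
  fix x y
  have "matrix_product X (matrix_product X L M) N x y = (\<Sum>z\<in>X. \<Sum>w\<in>X. L x w * (M w z * N z y))"
    by (simp add: matrix_product_def sum_distrib_right mult.assoc)
  also have "\<dots> = (\<Sum>w\<in>X. \<Sum>z\<in>X. L x w * (M w z * N z y))" by (rule sum.swap)
  finally show "matrix_product X (matrix_product X L M) N x y = matrix_product X L (matrix_product X M N) x y"
    by (simp add: matrix_product_def sum_distrib_left)
qed

lemma matrix_product_sum_left:
  "matrix_product X (\<lambda>x y. \<Sum>i\<in>I. c i * M i x y) N = (\<lambda>x y. \<Sum>i\<in>I. c i * matrix_product X (M i) N x y)"
  unfolding matrix_product_def sum_distrib_right sum_distrib_left mult.assoc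
  by (intro ext) (rule sum.swap)

lemma matrix_product_sum_right:
  "matrix_product X N (\<lambda>x y. \<Sum>i\<in>I. c i * M i x y) = (\<lambda>x y. \<Sum>i\<in>I. c i * matrix_product X N (M i) x y)"
proof (intro ext)
  fix x y
  have "matrix_product X N (\<lambda>x y. \<Sum>i\<in>I. c i * M i x y) x y = (\<Sum>z\<in>X. \<Sum>i\<in>I. c i * (N x z * M i z y))"
    by (simp add: matrix_product_def sum_distrib_left mult.left_commute)
  also have "\<dots> = (\<Sum>i\<in>I. \<Sum>z\<in>X. c i * (N x z * M i z y))" by (rule sum.swap)
  finally show "matrix_product X N (\<lambda>x y. \<Sum>i\<in>I. c i * M i x y) x y
    = (\<Sum>i\<in>I. c i * matrix_product X N (M i) x y)"
    by (simp add: matrix_product_def sum_distrib_left)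
qed

lemma matrix_product_diff:
  "matrix_product X (\<lambda>x y. L x y - M x y) N = (\<lambda>x y. matrix_product X L N x y - matrix_product X M N x y)"
  "matrix_product X N (\<lambda>x y. L x y - M x y) = (\<lambda>x y. matrix_product X N L x y - matrix_product X N M x y)"
  by (intro ext; simp add: matrix_product_def left_diff_distrib right_diff_distrib sum_subtractf)+

lemma bose_mesner_sum:
  assumes "\<And>i. i \<in> I \<Longrightarrow> M i \<in> bose_mesner d R"
  shows "(\<lambda>x y. \<Sum>i\<in>I. c i * M i x y) \<in> bose_mesner d R"
proof -
  have "\<forall>i\<in>I. \<exists>b. M i = (\<lambda>x y. \<Sum>j\<le>d. b j * adjacency (R j) x y)"
    using assms by (simp add: bose_mesner_def)
  from bchoice[OF this] obtain b where
    b: "\<forall>i\<in>I. M i = (\<lambda>x y. \<Sum>j\<le>d. b i j * adjacency (R j) x y)" ..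
  have "(\<lambda>x y. \<Sum>i\<in>I. c i * M i x y) = (\<lambda>x y. \<Sum>j\<le>d. (\<Sum>i\<in>I. c i * b i j) * adjacency (R j) x y)"
  proof (intro ext)
    fix x y
    have "(\<Sum>i\<in>I. c i * M i x y) = (\<Sum>i\<in>I. \<Sum>j\<le>d. c i * b i j * adjacency (R j) x y)"
    proof (rule sum.cong[OF refl])
      fix i assume "i \<in> I"
      with b have "M i x y = (\<Sum>j\<le>d. b i j * adjacency (R j) x y)" by simp
      then show "c i * M i x y = (\<Sum>j\<le>d. c i * b i j * adjacency (R j) x y)"
        by (simp add: sum_distrib_left mult.assoc)
    qed
    also have "\<dots> = (\<Sum>j\<le>d. \<Sum>i\<in>I. c i * b i j * adjacency (R j) x y)" by (rule sum.swap)
    finally show "(\<Sum>i\<in>I. c i * M i x y) = (\<Sum>j\<le>d. (\<Sum>i\<in>I. c i * b i j) * adjacency (R j) x y)"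
      by (simp add: sum_distrib_right)
  qed
  then show ?thesis unfolding bose_mesner_def by (intro CollectI exI)
qed

lemma bose_mesner_diff:
  assumes "L \<in> bose_mesner d R" "M \<in> bose_mesner d R"
  shows "(\<lambda>x y. L x y - M x y) \<in> bose_mesner d R"
  using bose_mesner_sum[of "{0, 1 :: nat}" "\<lambda>i. if i = 0 then L else M" d R "\<lambda>i. if i = 0 then 1 else -1"] assms
  by simp

text \<open>The relations of a commutative scheme in an arbitrary order, so that the diagonal need not
  come first.\<close>

locale reordered_scheme =
  fixes X :: "'a set" and d :: nat and S :: "nat \<Rightarrow> ('a \<times> 'a) set"
  assumes finite_X: "finite X" and nonempty_X: "X \<noteq> {}"
    and subset: "j \<le> d \<Longrightarrow> S j \<subseteq> X \<times> X"
    and covers: "x \<in> X \<Longrightarrow> y \<in> X \<Longrightarrow> \<exists>j\<le>d. (x, y) \<in> S j"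
    and disjoint: "i \<le> d \<Longrightarrow> j \<le> d \<Longrightarrow> p \<in> S i \<Longrightarrow> p \<in> S j \<Longrightarrow> i = j"
    and converse: "j \<le> d \<Longrightarrow> \<exists>j'\<le>d. (S j)\<inverse> = S j'"
    and diagonal: "\<exists>j\<le>d. S j = Id_on X"
    and numbers: "i \<le> d \<Longrightarrow> j \<le> d \<Longrightarrow> k \<le> d \<Longrightarrow>
      \<exists>p. \<forall>(x, y) \<in> S k. card {z \<in> X. (x, z) \<in> S i \<and> (z, y) \<in> S j} = p"
    and commutes: "i \<le> d \<Longrightarrow> j \<le> d \<Longrightarrow> k \<le> d \<Longrightarrow> (x, y) \<in> S k \<Longrightarrow>
      card {z \<in> X. (x, z) \<in> S i \<and> (z, y) \<in> S j} = card {z \<in> X. (x, z) \<in> S j \<and> (z, y) \<in> S i}"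
begin

abbreviation A :: "nat \<Rightarrow> 'a \<Rightarrow> 'a \<Rightarrow> complex" where
  "A j \<equiv> adjacency (S j)"

abbreviation mult :: "('a \<Rightarrow> 'a \<Rightarrow> complex) \<Rightarrow> ('a \<Rightarrow> 'a \<Rightarrow> complex) \<Rightarrow> 'a \<Rightarrow> 'a \<Rightarrow> complex" (infixl "\<star>" 70)
  where "M \<star> N \<equiv> matrix_product X M N"

lemma A_at: "k \<le> d \<Longrightarrow> (x, y) \<in> S k \<Longrightarrow> j \<le> d \<Longrightarrow> A j x y = of_bool (j = k)"
  using disjoint[of j k "(x, y)"] by (auto simp: adjacency_def)

lemma A_outside: "j \<le> d \<Longrightarrow> x \<notin> X \<or> y \<notin> X \<Longrightarrow> A j x y = 0"
  using subset[of j] by (auto simp: adjacency_def)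

lemma sum_A_at: "k \<le> d \<Longrightarrow> (x, y) \<in> S k \<Longrightarrow> (\<Sum>j\<le>d. c j * A j x y) = c k"
proof -
  assume k: "k \<le> d" "(x, y) \<in> S k"
  have "(\<Sum>j\<le>d. c j * A j x y) = (\<Sum>j\<le>d. if j = k then c j else 0)"
    by (rule sum.cong) (auto simp: A_at[OF k])
  then show ?thesis using k by simp
qed

lemma A_mult: "(A i \<star> A j) x y = of_nat (card {z \<in> X. (x, z) \<in> S i \<and> (z, y) \<in> S j})"
proof -
  have "(A i \<star> A j) x y = (\<Sum>z\<in>X. if (x, z) \<in> S i \<and> (z, y) \<in> S j then 1 else 0)"
    unfolding matrix_product_def by (rule sum.cong) (auto simp: adjacency_def)
  then show ?thesis using finite_X by (simp add: sum.If_cases Int_def)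
qed

lemma A_mult_outside: "i \<le> d \<Longrightarrow> j \<le> d \<Longrightarrow> x \<notin> X \<or> y \<notin> X \<Longrightarrow> (A i \<star> A j) x y = 0"
  unfolding matrix_product_def by (rule sum.neutral) (use A_outside in auto)

lemma A_mult_bose_mesner:
  assumes "i \<le> d" "j \<le> d"
  shows "A i \<star> A j \<in> bose_mesner d S"
proof -
  have "\<forall>k\<in>{..d}. \<exists>p. \<forall>(x, y) \<in> S k. card {z \<in> X. (x, z) \<in> S i \<and> (z, y) \<in> S j} = p"
    using numbers[OF assms] by simp
  from bchoice[OF this] obtain p where
    p': "\<forall>k\<in>{..d}. \<forall>(x, y) \<in> S k. card {z \<in> X. (x, z) \<in> S i \<and> (z, y) \<in> S j} = p k" ..
  have p: "card {z \<in> X. (x, z) \<in> S i \<and> (z, y) \<in> S j} = p k" if "k \<le> d" "(x, y) \<in> S k" for k x y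
  proof -
    have "\<forall>(x, y) \<in> S k. card {z \<in> X. (x, z) \<in> S i \<and> (z, y) \<in> S j} = p k"
      by (rule bspec[OF p']) (simp add: that(1))
    then show ?thesis using that(2) by blast
  qed
  have "A i \<star> A j = (\<lambda>x y. \<Sum>k\<le>d. of_nat (p k) * A k x y)"
  proof (intro ext)
    fix x y
    show "(A i \<star> A j) x y = (\<Sum>k\<le>d. of_nat (p k) * A k x y)"
    proof (cases "x \<in> X \<and> y \<in> X")
      case True
      then obtain k where k: "k \<le> d" "(x, y) \<in> S k" using covers by blast
      show ?thesis unfolding sum_A_at[OF k] A_mult p[OF k] ..
    next
      case False
      then show ?thesis using A_mult_outside[OF assms] A_outside by simp
    qed
  qed
  then show ?thesis unfolding bose_mesner_def by (intro CollectI exI)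
qed

lemma A_mult_commute:
  assumes "i \<le> d" "j \<le> d"
  shows "A i \<star> A j = A j \<star> A i"
proof (intro ext)
  fix x y
  show "(A i \<star> A j) x y = (A j \<star> A i) x y"
  proof (cases "x \<in> X \<and> y \<in> X")
    case True
    then obtain k where "k \<le> d" "(x, y) \<in> S k" using covers by blast
    then show ?thesis using commutes[OF assms, of k x y] by (simp add: A_mult)
  next
    case False
    then show ?thesis using A_mult_outside assms by simp
  qed
qed

lemma bose_mesner_D: "M \<in> bose_mesner d S \<Longrightarrow> \<exists>c. M = (\<lambda>x y. \<Sum>j\<le>d. c j * A j x y)"
  by (simp add: bose_mesner_def)

lemma bose_mesner_mult:
  assumes M: "M \<in> bose_mesner d S" and N: "N \<in> bose_mesner d S"
  shows "M \<star> N \<in> bose_mesner d S"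
proof -
  obtain b c where b: "M = (\<lambda>x y. \<Sum>j\<le>d. b j * A j x y)" and c: "N = (\<lambda>x y. \<Sum>j\<le>d. c j * A j x y)"
    using bose_mesner_D[OF M] bose_mesner_D[OF N] by blast
  show ?thesis
    unfolding b matrix_product_sum_left
  proof (rule bose_mesner_sum)
    fix i assume "i \<in> {..d}"
    then show "A i \<star> N \<in> bose_mesner d S"
      unfolding c matrix_product_sum_right by (intro bose_mesner_sum A_mult_bose_mesner) auto
  qed
qed

lemma bose_mesner_commute:
  assumes M: "M \<in> bose_mesner d S" and N: "N \<in> bose_mesner d S"
  shows "M \<star> N = N \<star> M"
proof -
  obtain b c where b: "M = (\<lambda>x y. \<Sum>j\<le>d. b j * A j x y)" and c: "N = (\<lambda>x y. \<Sum>j\<le>d. c j * A j x y)"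
    using bose_mesner_D[OF M] bose_mesner_D[OF N] by blast
  have "A i \<star> N = N \<star> A i" if "i \<le> d" for i
    unfolding c matrix_product_sum_right matrix_product_sum_left
  proof (intro ext sum.cong refl)
    fix x y j assume "j \<in> {..d}"
    then have "A i \<star> A j = A j \<star> A i" using A_mult_commute[OF that] by blast
    then show "c j * (A i \<star> A j) x y = c j * (A j \<star> A i) x y" by (rule arg_cong)
  qed
  then show ?thesis
    unfolding b matrix_product_sum_right matrix_product_sum_left
    by (intro ext sum.cong refl) simp
qed

text \<open>If \<open>E \<star> F \<noteq> 0\<close>, then primitivity applied to \<open>E = E \<star> F + (E - E \<star> F)\<close> gives \<open>E = E \<star> F\<close>.\<close>

lemma primitive_absorb:
  assumes E: "primitive_idempotent X d S E" and F: "primitive_idempotent X d S F"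
    and nz: "E \<star> F \<noteq> (\<lambda>x y. 0)"
  shows "E \<star> F = E"
proof -
  have E': "E \<in> bose_mesner d S" "E \<star> E = E" and F': "F \<in> bose_mesner d S" "F \<star> F = F"
    using E F by (auto simp: primitive_idempotent_def nonzero_idempotent_def)
  define P where "P = E \<star> F"
  define Q where "Q = (\<lambda>x y. E x y - P x y)"
  have FE: "F \<star> E = P" using bose_mesner_commute[OF F'(1) E'(1)] by (simp add: P_def)
  have PB: "P \<in> bose_mesner d S" unfolding P_def by (rule bose_mesner_mult[OF E'(1) F'(1)])
  have EP: "E \<star> P = P" unfolding P_def matrix_product_assoc[symmetric] E'(2) ..
  have PE: "P \<star> E = P" using bose_mesner_commute[OF PB E'(1)] EP by simp
  have FP: "F \<star> P = P"
    unfolding FE[symmetric] matrix_product_assoc[symmetric] F'(2) ..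
  have PP: "P \<star> P = P"
  proof -
    have "P \<star> P = E \<star> (F \<star> P)" using matrix_product_assoc[of X E F P] by (simp only: P_def)
    then show ?thesis by (simp only: FP EP)
  qed
  have QB: "Q \<in> bose_mesner d S" unfolding Q_def by (rule bose_mesner_diff[OF E'(1) PB])
  have "Q \<star> Q = Q" "P \<star> Q = (\<lambda>x y. 0)" "Q \<star> P = (\<lambda>x y. 0)"
    unfolding Q_def matrix_product_diff by (simp_all add: E'(2) EP PE PP)
  moreover have "E = (\<lambda>x y. P x y + Q x y)" by (simp add: Q_def)
  moreover have "nonzero_idempotent X d S P"
    using PB PP nz by (simp add: nonzero_idempotent_def P_def)
  moreover have "\<not> (nonzero_idempotent X d S P \<and> nonzero_idempotent X d S Q \<and> P \<star> Q = (\<lambda>x y. 0) \<and>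
      Q \<star> P = (\<lambda>x y. 0) \<and> E = (\<lambda>x y. P x y + Q x y))"
    using E unfolding primitive_idempotent_def by blast
  ultimately have "\<not> nonzero_idempotent X d S Q" by blast
  then have "Q = (\<lambda>x y. 0)"
    unfolding nonzero_idempotent_def using QB \<open>Q \<star> Q = Q\<close> by blast
  then show ?thesis by (simp add: Q_def P_def fun_eq_iff)
qed

text \<open>If the product were nonzero, each idempotent would absorb the other, and commutativity
  would make them equal.\<close>

lemma primitive_orthogonal:
  assumes E: "primitive_idempotent X d S E" and F: "primitive_idempotent X d S F" and "E \<noteq> F"
  shows "E \<star> F = (\<lambda>x y. 0)"
proof (rule ccontr)
  assume nz: "E \<star> F \<noteq> (\<lambda>x y. 0)"
  have "E \<star> F = F \<star> E"
    using E F by (intro bose_mesner_commute) (auto simp: primitive_idempotent_def nonzero_idempotent_def)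
  then show False using primitive_absorb[OF E F nz] primitive_absorb[OF F E] nz assms(3) by simp
qed

end

section \<open>From the eigenmatrix to a Gram matrix\<close>

lemma all_le_7: "(\<forall>j\<le>7. P j) \<longleftrightarrow> P 0 \<and> P 1 \<and> P 2 \<and> P 3 \<and> P 4 \<and> P 5 \<and> P 6 \<and> P (7 :: nat)"
proof -
  have "j \<le> 7 \<longleftrightarrow> j < 8" for j :: nat by auto
  then show ?thesis using all_less_8[of P] by simp
qed

lemma sum_le_7: "sum f {..7} = f 0 + f 1 + f 2 + f 3 + f 4 + f 5 + f 6 + f (7 :: nat)"
  for f :: "nat \<Rightarrow> 'b :: comm_monoid_add"
proof -
  have "{..7 :: nat} = {..<8}" by auto
  then show ?thesis using sum_less_8[of f] by simp
qed

text \<open>Nested lists reduce each identity between eigenvalues to a finite evaluation.\<close>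

definition eigen_rows :: "complex list list" where
  "eigen_rows =
    [[1,  1,  1,  1, 63,      63,  63,       63],
     [1,  \<i>, -1, -\<i>, 21,  21 * \<i>, -21, -21 * \<i>],
     [1, -1,  1, -1, -9,       9,  -9,        9],
     [1, -\<i>, -1,  \<i>, 21, -21 * \<i>, -21,  21 * \<i>],
     [1,  1,  1,  1, -1,      -1,  -1,       -1],
     [1,  \<i>, -1, -\<i>, -3,  -3 * \<i>,   3,   3 * \<i>],
     [1, -1,  1, -1,  7,      -7,   7,       -7],
     [1, -\<i>, -1,  \<i>, -3,   3 * \<i>,   3,  -3 * \<i>]]"

locale hoggar_parameters = reordered_scheme X 7 S for X :: "'a set" and S +
  fixes E :: "nat \<Rightarrow> 'a \<Rightarrow> 'a \<Rightarrow> complex"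
  assumes E_primitive: "i \<le> 7 \<Longrightarrow> primitive_idempotent X 7 S (E i)"
    and E_inj: "inj_on E {..7}"
    and A_E: "j \<le> 7 \<Longrightarrow> adjacency (S j) = (\<lambda>x y. \<Sum>i\<le>7. eigen_rows ! i ! j * E i x y)"
begin

lemma E_mult: "i \<le> 7 \<Longrightarrow> k \<le> 7 \<Longrightarrow> E i \<star> E k = (if i = k then E i else (\<lambda>x y. 0))"
  using E_primitive[of i] primitive_orthogonal[OF E_primitive E_primitive, of i k] inj_onD[OF E_inj, of i k]
  by (auto simp: primitive_idempotent_def nonzero_idempotent_def)

lemma E_nonzero: "i \<le> 7 \<Longrightarrow> \<exists>x y. E i x y \<noteq> 0"
  using E_primitive[of i] by (auto simp: primitive_idempotent_def nonzero_idempotent_def fun_eq_iff)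

lemma mult_spectral:
  "(\<lambda>x y. \<Sum>i\<le>7. a i * E i x y) \<star> (\<lambda>x y. \<Sum>i\<le>7. b i * E i x y) = (\<lambda>x y. \<Sum>i\<le>7. a i * b i * E i x y)"
proof (intro ext)
  fix x y
  have "((\<lambda>x y. \<Sum>i\<le>7. a i * E i x y) \<star> (\<lambda>x y. \<Sum>i\<le>7. b i * E i x y)) x y
    = (\<Sum>i\<le>7. \<Sum>k\<le>7. a i * (b k * (E i \<star> E k) x y))"
    by (simp only: matrix_product_sum_left matrix_product_sum_right sum_distrib_left)
  also have "\<dots> = (\<Sum>i\<le>7. \<Sum>k\<le>7. if k = i then a i * b i * E i x y else 0)"
  proof (rule sum.cong[OF refl], rule sum.cong[OF refl])
    fix i k :: nat assume "i \<in> {..7}" "k \<in> {..7}"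
    then show "a i * (b k * (E i \<star> E k) x y) = (if k = i then a i * b i * E i x y else 0)"
      using E_mult[of i k] by simp
  qed
  finally show "((\<lambda>x y. \<Sum>i\<le>7. a i * E i x y) \<star> (\<lambda>x y. \<Sum>i\<le>7. b i * E i x y)) x y
    = (\<Sum>i\<le>7. a i * b i * E i x y)" by simp
qed

lemma combination_spectral:
  "(\<Sum>j\<le>7. c j * A j x y) = (\<Sum>i\<le>7. (\<Sum>j\<le>7. c j * eigen_rows ! i ! j) * E i x y)"
proof -
  have "(\<Sum>j\<le>7. c j * A j x y) = (\<Sum>j\<le>7. \<Sum>i\<le>7. c j * eigen_rows ! i ! j * E i x y)"
  proof (rule sum.cong[OF refl])
    fix j :: nat assume "j \<in> {..7}"
    then have "A j x y = (\<Sum>i\<le>7. eigen_rows ! i ! j * E i x y)" using A_E[of j] by simp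
    then show "c j * A j x y = (\<Sum>i\<le>7. c j * eigen_rows ! i ! j * E i x y)"
      by (simp add: sum_distrib_left mult.assoc)
  qed
  also have "\<dots> = (\<Sum>i\<le>7. \<Sum>j\<le>7. c j * eigen_rows ! i ! j * E i x y)" by (rule sum.swap)
  finally show ?thesis by (simp add: sum_distrib_right)
qed

text \<open>The \<open>E i\<close> are orthogonal idempotents, so a product formula may be checked
  on the eigenvalues, row by row.\<close>

lemma A_mult_eigen:
  assumes "j \<le> 7" "k \<le> 7"
    and "\<forall>i\<le>7. eigen_rows ! i ! j * eigen_rows ! i ! k = (\<Sum>m\<le>7. c m * eigen_rows ! i ! m)"
  shows "(A j \<star> A k) x y = (\<Sum>m\<le>7. c m * A m x y)"
proof -
  have "(A j \<star> A k) x y = (\<Sum>i\<le>7. eigen_rows ! i ! j * eigen_rows ! i ! k * E i x y)"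
    unfolding A_E[OF assms(1)] A_E[OF assms(2)] mult_spectral ..
  also have "\<dots> = (\<Sum>i\<le>7. (\<Sum>m\<le>7. c m * eigen_rows ! i ! m) * E i x y)"
    by (rule sum.cong) (use assms(3) in auto)
  finally show ?thesis unfolding combination_spectral .
qed

text \<open>After the reordering the diagonal could be any \<open>S j\<close>. The identity matrix
  has eigenvalue 1 on \<open>E 1\<close>, and row 1 contains 1 only in column 0.\<close>

lemma S_0: "S 0 = Id_on X"
proof -
  obtain j where j: "j \<le> 7" "S j = Id_on X" using diagonal by blast
  have id: "A j \<star> E 1 = E 1"
  proof (intro ext)
    fix x y
    have "E 1 \<in> bose_mesner 7 S"
      using E_primitive[of 1] by (simp add: primitive_idempotent_def nonzero_idempotent_def)
    from bose_mesner_D[OF this] obtain c where c: "E 1 = (\<lambda>x y. \<Sum>j\<le>7. c j * A j x y)" ..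
    have "(A j \<star> E 1) x y = (\<Sum>z\<in>X. if z = x then E 1 x y else 0)"
      unfolding matrix_product_def adjacency_def j(2) by (rule sum.cong) auto
    also have "\<dots> = (if x \<in> X then E 1 x y else 0)" using finite_X by simp
    also have "\<dots> = E 1 x y" using A_outside[of _ x y] by (simp add: c del: One_nat_def)
    finally show "(A j \<star> E 1) x y = E 1 x y" .
  qed
  have e: "E 1 = (\<lambda>x y. \<Sum>i\<le>7. (if i = 1 then 1 else 0) * E i x y)"
    by (simp add: sum_le_7)
  have "A j \<star> E 1 = (\<lambda>x y. \<Sum>i\<le>7. eigen_rows ! i ! j * E i x y)
      \<star> (\<lambda>x y. \<Sum>i\<le>7. (if i = 1 then 1 else 0) * E i x y)"
    by (rule arg_cong2[OF A_E[OF j(1)] e])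
  also have "\<dots> = (\<lambda>x y. \<Sum>i\<le>7. eigen_rows ! i ! j * (if i = 1 then 1 else 0) * E i x y)"
    by (rule mult_spectral)
  also have "\<dots> = (\<lambda>x y. eigen_rows ! 1 ! j * E 1 x y)" by (simp add: sum_le_7)
  finally have "E 1 = (\<lambda>x y. eigen_rows ! 1 ! j * E 1 x y)" unfolding id .
  then have "eigen_rows ! 1 ! j * E 1 x y = E 1 x y" for x y by (metis (no_types))
  moreover obtain x y where "E 1 x y \<noteq> 0" using E_nonzero[of 1] by auto
  ultimately have P1: "eigen_rows ! 1 ! j = 1" by (metis mult_cancel_right1)
  have "\<forall>j\<le>7. eigen_rows ! 1 ! j = 1 \<longrightarrow> j = 0"
    unfolding all_le_7 by (simp add: eigen_rows_def complex_eq_iff)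
  then show ?thesis using P1 j by blast
qed

text \<open>Multiplying columns of the eigenmatrix by column 1 permutes them by
  \<open>next_index\<close>; conjugating them permutes them by \<open>conj_index\<close>.\<close>

definition next_index :: "nat \<Rightarrow> nat" where
  "next_index j = [1, 2, 3, 0, 5, 6, 7, 4] ! j"

definition conj_index :: "nat \<Rightarrow> nat" where
  "conj_index j = [0, 3, 2, 1, 4, 7, 6, 5] ! j"

lemma index_le: "\<forall>j\<le>7. next_index j \<le> 7 \<and> conj_index j \<le> 7"
  unfolding all_le_7 by (simp add: next_index_def conj_index_def)

lemma A_1_mult:
  assumes "j \<le> 7"
  shows "A 1 \<star> A j = A (next_index j)"
proof (intro ext)
  fix x y
  have "\<forall>j\<le>7. \<forall>i\<le>7. eigen_rows ! i ! 1 * eigen_rows ! i ! j = eigen_rows ! i ! next_index j"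
    unfolding all_le_7 by (simp add: eigen_rows_def next_index_def complex_eq_iff)
  then have *: "\<forall>i\<le>7. eigen_rows ! i ! 1 * eigen_rows ! i ! j
      = (\<Sum>m\<le>7. (if m = next_index j then 1 else 0) * eigen_rows ! i ! m)"
    using index_le assms by (simp add: if_distrib[of "\<lambda>c. c * _"] cong: if_cong)
  have "(A 1 \<star> A j) x y = (\<Sum>m\<le>7. (if m = next_index j then 1 else 0) * A m x y)"
    by (rule A_mult_eigen[OF _ assms *]) simp
  then show "(A 1 \<star> A j) x y = A (next_index j) x y"
    using index_le assms by (simp add: if_distrib[of "\<lambda>c. c * _"] cong: if_cong)
qed

text \<open>This provides a pair of points in \<open>S j\<close> whose reverse lies in
  \<open>S (conj_index j)\<close>, which identifies the converse relation.\<close>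

lemma A_conj_mult:
  assumes "j \<le> 7" "x \<in> X"
  shows "(A j \<star> A (conj_index j)) x x \<noteq> 0"
proof -
  \<comment> \<open>Intersection numbers read off from the eigenmatrix: the first four relations are
    permutations, the others have valency 63 and share one list of coefficients.\<close>
  define c :: "nat \<Rightarrow> complex" where
    "c m = (if j < 4 then of_bool (m = 0) else [63, 0, 0, 0, 24, 16, 6, 16] ! m)" for m
  have "\<forall>j\<le>7. \<forall>i\<le>7. eigen_rows ! i ! j * eigen_rows ! i ! conj_index j
     = (\<Sum>m\<le>7. (if j < 4 then of_bool (m = 0) else [63, 0, 0, 0, 24, 16, 6, 16] ! m) * eigen_rows ! i ! m)"
    unfolding all_le_7 sum_le_7 by (simp add: eigen_rows_def conj_index_def)
  then have "\<forall>i\<le>7. eigen_rows ! i ! j * eigen_rows ! i ! conj_index j = (\<Sum>m\<le>7. c m * eigen_rows ! i ! m)"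
    using assms unfolding c_def by blast
  then have "(A j \<star> A (conj_index j)) x x = (\<Sum>m\<le>7. c m * A m x x)"
    using A_mult_eigen assms index_le by blast
  also have "\<dots> = c 0" by (rule sum_A_at) (use S_0 assms in auto)
  finally show ?thesis by (simp add: c_def)
qed

lemma conj_neighbour:
  assumes "j \<le> 7" "x \<in> X"
  obtains z where "z \<in> X" "(x, z) \<in> S j" "(z, x) \<in> S (conj_index j)"
proof -
  have "{z \<in> X. (x, z) \<in> S j \<and> (z, x) \<in> S (conj_index j)} \<noteq> {}"
    using A_conj_mult[OF assms] unfolding A_mult by (metis card.empty of_nat_0)
  then show ?thesis using that by blast
qed

text \<open>The converse of \<open>S j\<close> is one of the relations, so a single pair decides
  which.\<close>

lemma S_converse:
  assumes j: "j \<le> 7" and xy: "(x, y) \<in> S j"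
  shows "(y, x) \<in> S (conj_index j)"
proof -
  obtain x0 where x0: "x0 \<in> X" using nonempty_X by blast
  obtain z where z: "(x0, z) \<in> S j" "(z, x0) \<in> S (conj_index j)" using conj_neighbour[OF j x0] .
  obtain k where k: "k \<le> 7" "(S j)\<inverse> = S k" using converse[OF j] by blast
  have "(z, x0) \<in> S k" using z(1) k(2) by blast
  then have "k = conj_index j" using disjoint[OF k(1) _ _ z(2)] index_le j by blast
  then show ?thesis using xy k(2) by blast
qed

definition inner :: "nat \<Rightarrow> complex" where
  "inner j = [3, 3 * \<i>, -3, -3 * \<i>, 1, \<i>, -1, -\<i>] ! j"

definition gram :: "'a \<Rightarrow> 'a \<Rightarrow> complex" where
  "gram x y = (\<Sum>j\<le>7. inner j * A j x y)"

lemma gram_at: "j \<le> 7 \<Longrightarrow> (x, y) \<in> S j \<Longrightarrow> gram x y = inner j"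
  unfolding gram_def by (rule sum_A_at)

text \<open>\<open>inner j\<close> is 3 times the conjugate of row 3 divided by the valency of
  \<open>S j\<close>, which isolates \<open>E 3\<close>. The factor is 3 * 256 / 8 for the rank 8 of
  \<open>E 3\<close>.\<close>

lemma gram_E: "gram = (\<lambda>x y. 96 * E 3 x y)"
proof (intro ext)
  fix x y
  have "\<forall>i\<le>7. (\<Sum>j\<le>7. inner j * eigen_rows ! i ! j) = (if i = 3 then 96 else 0)"
    unfolding all_le_7 sum_le_7 by (simp add: eigen_rows_def inner_def)
  then have "gram x y = (\<Sum>i\<le>7. (if i = 3 then 96 else 0) * E i x y)"
    unfolding gram_def combination_spectral by (intro sum.cong refl) auto
  then show "gram x y = 96 * E 3 x y" by (simp add: sum_le_7)
qed

text \<open>Squaring the inner products gives 9 times row 6 divided by the valencies, and 64 = 9 *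
  256 / 36 for the rank 36 of \<open>E 6\<close>.\<close>

lemma gram_square_E:
  assumes "x \<in> X" "y \<in> X"
  shows "(gram x y)\<^sup>2 = 64 * E 6 x y"
proof -
  obtain j where j: "j \<le> 7" "(x, y) \<in> S j" using covers assms by blast
  have "(gram x y)\<^sup>2 = (\<Sum>j\<le>7. (inner j)\<^sup>2 * A j x y)"
    unfolding gram_at[OF j] sum_A_at[OF j] ..
  also have "\<dots> = (\<Sum>i\<le>7. (if i = 6 then 64 else 0) * E i x y)"
  proof -
    have "\<forall>i\<le>7. (\<Sum>j\<le>7. (inner j)\<^sup>2 * eigen_rows ! i ! j) = (if i = 6 then 64 else 0)"
      unfolding all_le_7 sum_le_7 by (simp add: eigen_rows_def inner_def power_mult_distrib)
    then show ?thesis unfolding combination_spectral by (intro sum.cong refl) auto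
  qed
  finally show ?thesis by (simp add: sum_le_7)
qed

lemma E_idempotent: "i \<le> 7 \<Longrightarrow> (\<Sum>w\<in>X. E i x w * E i w y) = E i x y"
  using fun_cong[OF fun_cong[OF E_mult[of i i]], of x y] by (simp add: matrix_product_def)

lemma inner_values:
  "\<forall>j\<le>7. inner j \<in> {3, 3 * \<i>, -3, -3 * \<i>, 1, \<i>, -1, -\<i>} \<and> (inner j = 3 \<longleftrightarrow> j = 0)
    \<and> inner (conj_index j) = cnj (inner j) \<and> inner (next_index j) = \<i> * inner j"
  unfolding all_le_7 by (simp add: inner_def conj_index_def next_index_def complex_eq_iff)

lemma inner_inject: "\<forall>j\<le>7. \<forall>k\<le>7. inner j = inner k \<longrightarrow> j = k"
  unfolding all_le_7 by (simp add: inner_def complex_eq_iff)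

sublocale gram: hoggar_gram X gram
proof
  show "finite X" by (rule finite_X)
  fix x y assume xy: "x \<in> X" "y \<in> X"
  obtain j where j: "j \<le> 7" "(x, y) \<in> S j" using covers xy by blast
  have j': "(y, x) \<in> S (conj_index j)" "conj_index j \<le> 7" using S_converse[OF j] index_le j(1) by auto
  show "gram y x = cnj (gram x y)"
    unfolding gram_at[OF j] gram_at[OF j'(2,1)] using inner_values j(1) by blast
  show "gram x y \<in> {3, 3 * \<i>, -3, -3 * \<i>, 1, \<i>, -1, -\<i>}"
    unfolding gram_at[OF j] using inner_values j(1) by blast
  have "j = 0 \<longleftrightarrow> x = y"
  proof
    assume "x = y"
    then have "(x, y) \<in> S 0" using S_0 xy by auto
    then show "j = 0" using disjoint[OF j(1) _ j(2)] by simp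
  qed (use S_0 j in auto)
  then show "gram x y = 3 \<longleftrightarrow> x = y" unfolding gram_at[OF j] using inner_values j(1) by blast
  have "(\<Sum>w\<in>X. gram x w * gram w y) = (\<Sum>w\<in>X. 9216 * (E 3 x w * E 3 w y))"
    by (simp add: gram_E)
  also have "\<dots> = 96 * gram x y"
    unfolding sum_distrib_left[symmetric] using E_idempotent[of 3 x y] by (simp add: gram_E)
  finally show "(\<Sum>w\<in>X. gram x w * gram w y) = 96 * gram x y" .
  have "(\<Sum>w\<in>X. (gram x w)\<^sup>2 * (gram w y)\<^sup>2) = (\<Sum>w\<in>X. 4096 * (E 6 x w * E 6 w y))"
    by (rule sum.cong) (simp_all add: gram_square_E xy)
  also have "\<dots> = 64 * (gram x y)\<^sup>2"
    unfolding sum_distrib_left[symmetric] using E_idempotent[of 6 x y] by (simp add: gram_square_E xy)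
  finally show "(\<Sum>w\<in>X. (gram x w)\<^sup>2 * (gram w y)\<^sup>2) = 64 * (gram x y)\<^sup>2" .
next
  fix x assume x: "x \<in> X"
  \<comment> \<open>Multiplication by \<open>A 1\<close> carries \<open>S j\<close> to
    \<open>S (next_index j)\<close>, so the values at \<open>z\<close> are \<i> times those at
    \<open>x\<close>.\<close>
  obtain z where z: "z \<in> X" "(x, z) \<in> S 3" "(z, x) \<in> S 1"
    using conj_neighbour[of 3 x] x by (auto simp: conj_index_def)
  have "gram z y = \<i> * gram x y" if y: "y \<in> X" for y
  proof -
    obtain j where j: "j \<le> 7" "(x, y) \<in> S j" using covers x y by blast
    have n: "next_index j \<le> 7" using index_le j(1) by blast
    have "x \<in> {w \<in> X. (z, w) \<in> S 1 \<and> (w, y) \<in> S j}" using z j x by simp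
    then have "card {w \<in> X. (z, w) \<in> S 1 \<and> (w, y) \<in> S j} \<noteq> 0" using finite_X by auto
    then have "A (next_index j) z y \<noteq> 0"
      unfolding A_1_mult[OF j(1), symmetric] A_mult by simp
    then have "(z, y) \<in> S (next_index j)" by (simp add: adjacency_def split: if_splits)
    then show ?thesis unfolding gram_at[OF j] using gram_at[OF n] inner_values j(1) by simp
  qed
  then show "\<exists>x'\<in>X. \<forall>y\<in>X. gram x' y = \<i> * gram x y" using z(1) by blast
qed

end

section \<open>The isomorphism of schemes\<close>

lemma hoggar_eigenmatrix_entry:
  assumes "i \<le> 7" "j \<le> 7"
  shows "hoggar_eigenmatrix $$ (i, j) = eigen_rows ! i ! j"
proof -
  have "\<forall>i\<le>7. \<forall>j\<le>7. hoggar_eigenmatrix $$ (i, j) = eigen_rows ! i ! j"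
    unfolding all_le_7 by (simp add: hoggar_eigenmatrix_def eigen_rows_def mat_of_rows_list_def)
  then show ?thesis using assms by blast
qed

lemma hoggar_relation_iff:
  "v \<in> hoggar_points \<Longrightarrow> w \<in> hoggar_points \<Longrightarrow>
    (v, w) \<in> hoggar_relation j \<longleftrightarrow> v \<bullet>c w = hoggar_inner_products ! j"
  by (simp add: hoggar_relation_def)

lemma reordered_schemeI:
  assumes scheme: "commutative_association_scheme X d R" and \<tau>: "\<tau> permutes {..d}"
  shows "reordered_scheme X d (R \<circ> \<tau>)"
proof -
  interpret commutative_association_scheme X d R by (rule scheme)
  have le: "\<tau> j \<le> d" if "j \<le> d" for j using permutes_in_image[OF \<tau>, of j] that by simp
  have ex: "\<exists>i\<le>d. \<tau> i = j" if "j \<le> d" for j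
    using permutes_in_image[OF permutes_inv[OF \<tau>], of j] permutes_inverses(1)[OF \<tau>, of j] that by auto
  show ?thesis
  proof unfold_locales
    show "finite X" by (rule finite_points)
    show "X \<noteq> {}" by (rule nonempty_points)
    show "(R \<circ> \<tau>) j \<subseteq> X \<times> X" if "j \<le> d" for j
      using union_relations le[OF that] by auto
    show "\<exists>j\<le>d. (x, y) \<in> (R \<circ> \<tau>) j" if "x \<in> X" "y \<in> X" for x y
    proof -
      have "(x, y) \<in> (\<Union>j\<le>d. R j)" using union_relations that by simp
      then obtain k where k: "k \<le> d" "(x, y) \<in> R k" by blast
      obtain i where "i \<le> d" "\<tau> i = k" using ex[OF k(1)] by blast
      then show ?thesis using k(2) by (intro exI[of _ i]) simp
    qed
    show "i = j" if "i \<le> d" "j \<le> d" "p \<in> (R \<circ> \<tau>) i" "p \<in> (R \<circ> \<tau>) j" for i j p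
    proof -
      have "\<tau> i = \<tau> j"
      proof (rule ccontr)
        assume "\<tau> i \<noteq> \<tau> j"
        then have "R (\<tau> i) \<inter> R (\<tau> j) = {}"
          using disjoint_relations le[OF that(1)] le[OF that(2)] by (simp add: disjoint_family_on_def)
        then show False using that(3,4) by auto
      qed
      then show ?thesis by (rule permutes_inj[OF \<tau>, THEN injD])
    qed
    show "\<exists>j'\<le>d. ((R \<circ> \<tau>) j)\<inverse> = (R \<circ> \<tau>) j'" if j: "j \<le> d" for j
    proof -
      obtain k where k: "k \<le> d" "(R (\<tau> j))\<inverse> = R k" using converse_relation[OF le[OF j]] by blast
      obtain i where "i \<le> d" "\<tau> i = k" using ex[OF k(1)] by blast
      then show ?thesis using k(2) by (intro exI[of _ i]) simp
    qed
    show "\<exists>j\<le>d. (R \<circ> \<tau>) j = Id_on X"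
    proof -
      obtain i where "i \<le> d" "\<tau> i = 0" using ex[of 0] by blast
      then show ?thesis using identity_relation by (intro exI[of _ i]) simp
    qed
    show "\<exists>p. \<forall>(x, y) \<in> (R \<circ> \<tau>) k. card {z \<in> X. (x, z) \<in> (R \<circ> \<tau>) i \<and> (z, y) \<in> (R \<circ> \<tau>) j} = p"
      if "i \<le> d" "j \<le> d" "k \<le> d" for i j k
      using intersection_numbers[OF le[OF that(1)] le[OF that(2)] le[OF that(3)]] by simp
    show "card {z \<in> X. (x, z) \<in> (R \<circ> \<tau>) i \<and> (z, y) \<in> (R \<circ> \<tau>) j}
        = card {z \<in> X. (x, z) \<in> (R \<circ> \<tau>) j \<and> (z, y) \<in> (R \<circ> \<tau>) i}"
      if "i \<le> d" "j \<le> d" "k \<le> d" "(x, y) \<in> (R \<circ> \<tau>) k" for i j k x y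
      using commutative[OF le[OF that(1)] le[OF that(2)] le[OF that(3)], of x y] that(4) by simp
  qed
qed

theorem theorem6p1:
  fixes X :: "'a set"
    and R :: "nat \<Rightarrow> ('a \<times> 'a) set"
    and \<tau> :: "nat \<Rightarrow> nat"
    and E :: "nat \<Rightarrow> 'a \<Rightarrow> 'a \<Rightarrow> complex"
  assumes "commutative_association_scheme X 7 R"
    and "\<tau> permutes {..7}"
    and "is_first_eigenmatrix X 7 (R \<circ> \<tau>) E hoggar_eigenmatrix"
  shows "scheme_isomorphic 7 X R hoggar_points hoggar_relation"
proof -
  interpret reordered_scheme X 7 "R \<circ> \<tau>" by (rule reordered_schemeI[OF assms(1,2)])
  interpret hoggar_parameters X "R \<circ> \<tau>" E
  proof
    note E = assms(3)[unfolded is_first_eigenmatrix_def]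
    show "primitive_idempotent X 7 (R \<circ> \<tau>) (E i)" if "i \<le> 7" for i
      using E that by (auto simp: bij_betw_def)
    show "inj_on E {..7}" using E by (simp add: bij_betw_def)
    fix j :: nat assume j: "j \<le> 7"
    have "adjacency ((R \<circ> \<tau>) j) = (\<lambda>x y. \<Sum>i\<le>7. hoggar_eigenmatrix $$ (i, j) * E i x y)"
      using E j by blast
    then show "adjacency ((R \<circ> \<tau>) j) = (\<lambda>x y. \<Sum>i\<le>7. eigen_rows ! i ! j * E i x y)"
      using j by (simp add: hoggar_eigenmatrix_entry)
  qed
  have \<tau>': "inv_into UNIV \<tau> permutes {..7}" by (rule permutes_inv[OF assms(2)])
  have le: "inv_into UNIV \<tau> j \<le> 7" if "j \<le> 7" for j using permutes_in_image[OF \<tau>', of j] that by simp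
  have R: "(x, y) \<in> R j \<longleftrightarrow> gram x y = inner (inv_into UNIV \<tau> j)"
    if j: "j \<le> 7" and xy: "x \<in> X" "y \<in> X" for x y j
  proof -
    have Rj: "R j = (R \<circ> \<tau>) (inv_into UNIV \<tau> j)" using permutes_inverses(1)[OF assms(2)] by simp
    obtain k where k: "k \<le> 7" "(x, y) \<in> (R \<circ> \<tau>) k" using covers xy by blast
    have "gram x y = inner (inv_into UNIV \<tau> j) \<longleftrightarrow> k = inv_into UNIV \<tau> j"
      unfolding gram_at[OF k] using inner_inject k(1) le[OF j] by blast
    also have "\<dots> \<longleftrightarrow> (x, y) \<in> R j"
      unfolding Rj using disjoint[OF k(1) le[OF j] k(2)] k(2) by blast
    finally show ?thesis by blast
  qed
  have third: "\<forall>j\<le>7. hoggar_inner_products ! j = inner j / 3"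
    unfolding all_le_7 by (simp add: hoggar_inner_products_def inner_def)
  obtain f where f: "bij_betw f X hoggar_points"
    "(\<forall>x\<in>X. \<forall>y\<in>X. f x \<bullet>c f y = gram x y / 3) \<or> (\<forall>x\<in>X. \<forall>y\<in>X. f x \<bullet>c f y = cnj (gram x y) / 3)"
    using gram.hoggar_unique[OF nonempty_X] .
  have fX: "f x \<in> hoggar_points" if "x \<in> X" for x using f(1) that by (auto simp: bij_betw_def)
  show ?thesis
    using f(2)
  proof
    assume inn: "\<forall>x\<in>X. \<forall>y\<in>X. f x \<bullet>c f y = gram x y / 3"
    have "(x, y) \<in> R j \<longleftrightarrow> (f x, f y) \<in> hoggar_relation (inv_into UNIV \<tau> j)" 
      if "j \<le> 7" "x \<in> X" "y \<in> X" for x y j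
    proof -
      have e: "f x \<bullet>c f y = gram x y / 3" using inn that by blast
      have h: "hoggar_inner_products ! inv_into UNIV \<tau> j = inner (inv_into UNIV \<tau> j) / 3"
        using third le[OF that(1)] by blast
      show ?thesis
        unfolding R[OF that] hoggar_relation_iff[OF fX[OF that(2)] fX[OF that(3)]] e h by simp
    qed
    then show ?thesis unfolding scheme_isomorphic_def using f(1) \<tau>' by blast
  next
    assume inn: "\<forall>x\<in>X. \<forall>y\<in>X. f x \<bullet>c f y = cnj (gram x y) / 3"
    \<comment> \<open>Conjugation exchanges the inner products \<i> and -\<i> as well as \<i>/3 and
      -\<i>/3. Renumbering relations 1, 3 and 5, 7 compensates for it.\<close>
    define c where "c = Transposition.transpose 1 3 \<circ> Transposition.transpose 5 (7 :: nat)"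
    have c: "c permutes {..7}"
      unfolding c_def by (intro permutes_compose permutes_swap_id) auto
    have ci: "\<forall>j\<le>7. c j = conj_index j"
      unfolding all_le_7 c_def by (simp add: conj_index_def Transposition.transpose_def)
    have "(x, y) \<in> R j \<longleftrightarrow> (f x, f y) \<in> hoggar_relation ((c \<circ> inv_into UNIV \<tau>) j)"
      if "j \<le> 7" "x \<in> X" "y \<in> X" for x y j
    proof -
      define k where "k = inv_into UNIV \<tau> j"
      have k: "k \<le> 7" using le[OF that(1)] by (simp add: k_def)
      have ck: "c k = conj_index k" "conj_index k \<le> 7" using ci index_le k by auto
      have h: "hoggar_inner_products ! c k = inner (conj_index k) / 3" using third ck by simp
      have ik: "inner (conj_index k) = cnj (inner k)" using inner_values k by blast
      have e: "f x \<bullet>c f y = cnj (gram x y) / 3" using inn that by blast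
      have "(f x, f y) \<in> hoggar_relation (c k) \<longleftrightarrow> cnj (gram x y) = cnj (inner k)"
        unfolding hoggar_relation_iff[OF fX[OF that(2)] fX[OF that(3)]] e h ik by simp
      then show ?thesis unfolding R[OF that] k_def[symmetric] o_apply complex_cnj_cancel_iff by blast
    qed
    moreover have "c \<circ> inv_into UNIV \<tau> permutes {..7}" by (rule permutes_compose[OF \<tau>' c])
    ultimately show ?thesis unfolding scheme_isomorphic_def using f(1) by blast
  qed
qed

end
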